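(* For every $d\ge1$ there exists a constant $C_d>0$ depending only on $d$ such that the following holds. Let $C>0$, $0\le r<1$, and let $P(x,dy)$ be a Markov kernel on $\mathbb R^d$ (with the Euclidean distance) such that (1) for every $x\in\mathbb R^d$ the measure $P(x,\cdot)$ satisfies a $\mathbf T_1(C)$ inequality; (2) $W_1(P(x,\cdot),P(y,\cdot))\le r|x-y|$ for all $x,y\in\mathbb R^d$. Let $\pi$ denote its invariant probability measure, let $m_1=\int|x|\,\pi(dx)$, let $(X_i)_{i\ge0}$ be the Markov chain associated with $P$ under $X_0=0$, and let $L_n=\frac1n\sum_{i=1}^n\delta_{X_i}$. Set $$a=\frac2C\left(\sqrt{4m_1^2+C\log2}-2m_1\right).$$ Then for all $n\ge1$ and all $0<t\le\frac{1}{2a}$, $$\mathbb P\big(W_1(L_n,\pi)\ge t\big)\le K(n,t)\,\exp\left(-n\,\frac{(1-r)^2}{8C}\,t^2\right),$$ where $$K(n,t)=\exp\left(\left[\frac{m_1}{\sqrt{nC}}+C_d\left(\frac1{at}\log\frac1{at}\right)^{d/2}\right]^2\right).$$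
   Context: $W_1(\mu,\nu)=\inf_\pi\int|x-y|\,\pi(dx,dy)$ over couplings $\pi$ of $\mu,\nu$. The relative entropy is $H(\nu|\mu)=\int\log\frac{d\nu}{d\mu}\,d\nu$ if $\nu\ll\mu$ and $+\infty$ otherwise. A probability measure $\mu$ with finite first moment satisfies $\mathbf T_1(C)$ if $W_1(\mu,\nu)\le\sqrt{C\,H(\nu|\mu)}$ for all probability measures $\nu$ with finite first moment. Under (1) and (2) the invariant probability measure exists and is unique. *)

theory Defs
  imports "HOL-Probability.Probability"
begin

definition P1 :: "'a::euclidean_space measure set" where
  "P1 = {\<mu>. prob_space \<mu> \<and> sets \<mu> = sets borel \<and> integrable \<mu> norm}"

definition couplings :: "'a measure \<Rightarrow> 'b measure \<Rightarrow> ('a \<times> 'b) measure set" where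
  "couplings \<mu> \<nu> = {Q. prob_space Q \<and> sets Q = sets (\<mu> \<Otimes>\<^sub>M \<nu>) \<and> distr Q \<mu> fst = \<mu> \<and> distr Q \<nu> snd = \<nu>}"

definition W1 :: "'a::euclidean_space measure \<Rightarrow> 'a measure \<Rightarrow> ennreal" where
  "W1 \<mu> \<nu> = (INF Q\<in>couplings \<mu> \<nu>. \<integral>\<^sup>+z. ennreal (norm (fst z - snd z)) \<partial>Q)"

text \<open>
  For \<open>\<nu> \<ll> \<mu>\<close> the negative part of \<open>log (d\<nu>/d\<mu>)\<close> is always \<open>\<nu>\<close>-integrable,
  so the integral is infinite exactly when the integrand is not integrable. The library's
  \<^const>\<open>KL_divergence\<close> would be \<open>0\<close> there. It takes its arguments in the order \<open>\<mu>, \<nu>\<close>, and its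
  value is nonnegative on probability measures, so \<^const>\<open>ennreal\<close> does not truncate.
\<close>

definition rel_entropy :: "'a measure \<Rightarrow> 'a measure \<Rightarrow> ennreal" where
  "rel_entropy \<nu> \<mu> =
    (if absolutely_continuous \<mu> \<nu> \<and> integrable \<nu> (entropy_density (exp 1) \<mu> \<nu>)
     then ennreal (KL_divergence (exp 1) \<mu> \<nu>) else \<infinity>)"

definition ennreal_sqrt :: "ennreal \<Rightarrow> ennreal" where
  "ennreal_sqrt x = (if x = \<infinity> then \<infinity> else ennreal (sqrt (enn2real x)))"

definition T1 :: "real \<Rightarrow> 'a::euclidean_space measure \<Rightarrow> bool" where
  "T1 C \<mu> \<longleftrightarrow> \<mu> \<in> P1 \<and> (\<forall>\<nu>\<in>P1. W1 \<mu> \<nu> \<le> ennreal_sqrt (ennreal C * rel_entropy \<nu> \<mu>))"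

definition markov_kernel :: "('a::topological_space \<Rightarrow> 'a measure) \<Rightarrow> bool" where
  "markov_kernel P \<longleftrightarrow> P \<in> borel \<rightarrow>\<^sub>M prob_algebra borel"

definition invariant_prob :: "('a::topological_space \<Rightarrow> 'a measure) \<Rightarrow> 'a measure \<Rightarrow> bool" where
  "invariant_prob P \<pi> \<longleftrightarrow> prob_space \<pi> \<and> sets \<pi> = sets borel \<and> \<pi> \<bind> P = \<pi>"

text \<open>
  The law of the Markov chain with kernel \<open>P\<close> and \<open>X\<^sub>0 = x\<close> on path space: the Ionescu-Tulcea
  measure whose \<open>n\<close>-th step kernel reads off the last coordinate of the past. The chain itself is
  the coordinate process \<open>X\<^sub>i \<omega> = \<omega> i\<close>.
\<close>

definition chain_step :: "('a::topological_space \<Rightarrow> 'a measure) \<Rightarrow> 'a \<Rightarrow> nat \<Rightarrow> (nat \<Rightarrow> 'a) \<Rightarrow> 'a measure" where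
  "chain_step P x n \<omega> = (case n of 0 \<Rightarrow> return borel x | Suc m \<Rightarrow> P (\<omega> m))"

definition chain_law :: "('a::topological_space \<Rightarrow> 'a measure) \<Rightarrow> 'a \<Rightarrow> (nat \<Rightarrow> 'a) measure" where
  "chain_law P x =
    projective_family.lim UNIV (Ionescu_Tulcea.CI (chain_step P x) (\<lambda>_. borel)) (\<lambda>_. borel)"

lemma Ionescu_Tulcea_chain_step:
  fixes P :: "'a::topological_space \<Rightarrow> 'a measure"
  assumes "markov_kernel P"
  shows "Ionescu_Tulcea (chain_step P x) (\<lambda>_. borel)"
proof (unfold Ionescu_Tulcea_def, intro conjI allI impI)
  have [measurable]: "P \<in> borel \<rightarrow>\<^sub>M prob_algebra borel"
    using assms by (simp add: markov_kernel_def)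
  have *: "chain_step P x n \<in> (\<Pi>\<^sub>M i\<in>{0..<n}. borel) \<rightarrow>\<^sub>M prob_algebra borel" for n
  proof (cases n)
    case 0
    have "return borel x \<in> space (prob_algebra borel)"
      by (simp add: space_prob_algebra prob_space_return)
    then show ?thesis using 0 by (simp add: chain_step_def[abs_def])
  next
    case (Suc m)
    then show ?thesis by (simp add: chain_step_def[abs_def])
  qed
  show "chain_step P x n \<in> (\<Pi>\<^sub>M i\<in>{0..<n}. borel) \<rightarrow>\<^sub>M subprob_algebra borel" for n
    using * by (rule measurable_prob_algebraD)
  fix n and \<omega> :: "nat \<Rightarrow> 'a" assume "\<omega> \<in> space (\<Pi>\<^sub>M i\<in>{0..<n}. borel :: 'a measure)"
  then show "prob_space (chain_step P x n \<omega>)"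
    using measurable_space[OF *[of n]] by (simp add: space_prob_algebra)
qed

lemma
  fixes P :: "'a::topological_space \<Rightarrow> 'a measure"
  assumes P: "markov_kernel P"
  shows sets_chain_law: "sets (chain_law P x) = sets (\<Pi>\<^sub>M i\<in>UNIV. borel)"
    and prob_space_chain_law: "prob_space (chain_law P x)"
    and chain_law_start: "distr (chain_law P x) borel (\<lambda>\<omega>. \<omega> 0) = return borel x"
    and chain_law_markov:
      "\<And>A B n. \<lbrakk>A \<in> sets (\<Pi>\<^sub>M i\<in>{0..<Suc n}. borel); B \<in> sets borel\<rbrakk> \<Longrightarrow>
        emeasure (chain_law P x) {\<omega>. restrict \<omega> {0..<Suc n} \<in> A \<and> \<omega> (Suc n) \<in> B}
          = (\<integral>\<^sup>+\<omega>. indicator A (restrict \<omega> {0..<Suc n}) * emeasure (P (\<omega> n)) B \<partial>chain_law P x)"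
proof -
  interpret IT: Ionescu_Tulcea "chain_step P x" "\<lambda>_. borel"
    using P by (rule Ionescu_Tulcea_chain_step)
  have law: "chain_law P x = IT.PF.lim"
    by (simp add: chain_law_def)
  have CI: "IT.CI {0..<m} = IT.C 0 m (\<lambda>_. undefined)" for m
  proof (rule measure_eqI)
    show "sets (IT.CI {0..<m}) = sets (IT.C 0 m (\<lambda>_. undefined))"
      by (simp add: IT.CI_def IT.sets_C space_PiM)
    fix A assume "A \<in> sets (IT.CI {0..<m})"
    then have A: "A \<in> sets (PiM {0..<m} (\<lambda>_. borel))"
      by (simp add: IT.CI_def)
    show "emeasure (IT.CI {0..<m}) A = emeasure (IT.C 0 m (\<lambda>_. undefined)) A"
      using IT.emeasure_CI[OF order.refl A] A by (metis prod_emb_id sets.sets_into_space space_PiM)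
  qed
  have distr: "distr (chain_law P x) (PiM {0..<m} (\<lambda>_. borel)) (\<lambda>\<omega>. restrict \<omega> {0..<m})
      = IT.C 0 m (\<lambda>_. undefined)" for m
    unfolding law by (simp add: IT.distr_lim CI)
  have res[measurable]: "(\<lambda>\<omega>. restrict \<omega> {0..<m}) \<in> chain_law P x \<rightarrow>\<^sub>M PiM {0..<m} (\<lambda>_. borel)" for m
    by (simp add: law measurable_cong_sets[OF IT.PF.sets_lim] measurable_restrict)
  have u: "(\<lambda>_. undefined) \<in> space (PiM {0..<0::nat} (\<lambda>_. borel))"
    by (simp add: space_PiM)
  show sets: "sets (chain_law P x) = sets (\<Pi>\<^sub>M i\<in>UNIV. borel)"
    by (simp add: law)
  then have space: "space (chain_law P x) = UNIV"
    by (simp add: sets_eq_imp_space_eq[OF sets] space_PiM)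
  have "prob_space (IT.C 0 0 (\<lambda>_. undefined))"
    using u by (intro IT.prob_space_C) simp
  then show "prob_space (chain_law P x)"
    unfolding distr[of 0, symmetric] by (rule prob_space_distrD[OF res])
  have step: "emeasure (chain_law P x) {\<omega>. restrict \<omega> {0..<m} \<in> A \<and> \<omega> m \<in> B}
      = (\<integral>\<^sup>+\<omega>. indicator A (restrict \<omega> {0..<m}) * emeasure (chain_step P x m (restrict \<omega> {0..<m})) B \<partial>chain_law P x)"
    if [measurable]: "A \<in> sets (\<Pi>\<^sub>M i\<in>{0..<m}. borel)" "B \<in> sets borel" for m A B
  proof -
    let ?N = "\<lambda>m. \<Pi>\<^sub>M i\<in>{0..<m}. borel :: 'a measure"
    define X where "X = {\<omega> \<in> space (?N (Suc m)). restrict \<omega> {0..<m} \<in> A \<and> \<omega> m \<in> B}"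
    have [measurable]: "(\<lambda>\<omega>. restrict \<omega> {0..<m}) \<in> ?N (Suc m) \<rightarrow>\<^sub>M ?N m"
      by (rule measurable_restrict_subset) auto
    have X: "X \<in> sets (?N (Suc m))"
      unfolding X_def by measurable
    have "emeasure (chain_law P x) {\<omega>. restrict \<omega> {0..<m} \<in> A \<and> \<omega> m \<in> B}
        = emeasure (distr (chain_law P x) (?N (Suc m)) (\<lambda>\<omega>. restrict \<omega> {0..<Suc m})) X"
      by (subst emeasure_distr[OF res X])
         (auto simp: X_def space space_PiM restrict_restrict Int_absorb1 Int_absorb2
           intro!: arg_cong[where f="emeasure _"])
    also have "\<dots> = emeasure (IT.C 0 m (\<lambda>_. undefined) \<bind> IT.eP m) X"
      by (simp add: distr)
    also have "\<dots> = (\<integral>\<^sup>+\<omega>. emeasure (IT.eP m \<omega>) X \<partial>IT.C 0 m (\<lambda>_. undefined))"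
      using X IT.prob_space_C[OF u, of m]
      by (intro emeasure_bind[where N="?N (Suc m)"])
         (auto simp: prob_space.not_empty measurable_cong_sets[OF IT.sets_C[OF u] refl] IT.measurable_eP)
    also have "\<dots> = (\<integral>\<^sup>+\<omega>. indicator A \<omega> * emeasure (chain_step P x m \<omega>) B \<partial>IT.C 0 m (\<lambda>_. undefined))"
    proof (rule nn_integral_cong)
      fix \<omega> assume "\<omega> \<in> space (IT.C 0 m (\<lambda>_. undefined))"
      then have \<omega>: "\<omega> \<in> space (?N m)"
        using IT.space_C[OF u, of m] by simp
      have r: "restrict (fun_upd \<omega> m y) {0..<m} = \<omega>" for y
        using \<omega> by (auto simp: space_PiM PiE_iff extensional_def restrict_def fun_eq_iff)
      have e: "fun_upd \<omega> m y \<in> extensional {0..<Suc m}" for y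
        using \<omega> by (auto simp: space_PiM PiE_iff extensional_def)
      have "(\<lambda>y. fun_upd \<omega> m y) -` X \<inter> space borel = (if \<omega> \<in> A then B else {})"
        by (auto simp: X_def space_PiM PiE_iff r e)
      then show "emeasure (IT.eP m \<omega>) X = indicator A \<omega> * emeasure (chain_step P x m \<omega>) B"
        using IT.emeasure_eP[OF \<omega> X] by (simp split: split_indicator)
    qed
    also have "\<dots> = (\<integral>\<^sup>+\<omega>. indicator A \<omega> * emeasure (chain_step P x m \<omega>) B
        \<partial>distr (chain_law P x) (?N m) (\<lambda>\<omega>. restrict \<omega> {0..<m}))"
      by (simp add: distr)
    also have "\<dots> = (\<integral>\<^sup>+\<omega>. indicator A (restrict \<omega> {0..<m})
        * emeasure (chain_step P x m (restrict \<omega> {0..<m})) B \<partial>chain_law P x)"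
      using IT.P[of m] that
      by (subst nn_integral_distr[OF res])
         (auto intro!: borel_measurable_times_ennreal measurable_emeasure_kernel)
    finally show ?thesis .
  qed
  show "emeasure (chain_law P x) {\<omega>. restrict \<omega> {0..<Suc n} \<in> A \<and> \<omega> (Suc n) \<in> B}
      = (\<integral>\<^sup>+\<omega>. indicator A (restrict \<omega> {0..<Suc n}) * emeasure (P (\<omega> n)) B \<partial>chain_law P x)"
    if "A \<in> sets (\<Pi>\<^sub>M i\<in>{0..<Suc n}. borel)" "B \<in> sets borel" for A B n
    using step[OF that] by (simp add: chain_step_def)
  interpret Q: prob_space "chain_law P x" by fact
  show "distr (chain_law P x) borel (\<lambda>\<omega>. \<omega> 0) = return borel x"
  proof (rule measure_eqI)
    fix B assume "B \<in> sets (distr (chain_law P x) borel (\<lambda>\<omega>. \<omega> 0))"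
    then have B: "B \<in> sets borel" by simp
    have m: "(\<lambda>\<omega>. \<omega> 0) \<in> chain_law P x \<rightarrow>\<^sub>M borel"
      by (simp add: measurable_cong_sets[OF sets refl])
    have "emeasure (distr (chain_law P x) borel (\<lambda>\<omega>. \<omega> 0)) B
        = emeasure (chain_law P x) {\<omega>. restrict \<omega> {0..<0::nat} \<in> {\<lambda>_. undefined} \<and> \<omega> 0 \<in> B}"
      using B by (subst emeasure_distr[OF m]) (auto simp: space vimage_def restrict_def)
    also have "\<dots> = emeasure (return borel x) B"
      using B by (subst step) (auto simp: chain_step_def PiM_empty restrict_def Q.emeasure_space_1)
    finally show "emeasure (distr (chain_law P x) borel (\<lambda>\<omega>. \<omega> 0)) B = emeasure (return borel x) B" .
  qed simp
qed

definition empirical_measure :: "nat \<Rightarrow> (nat \<Rightarrow> 'a::topological_space) \<Rightarrow> 'a measure" where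
  "empirical_measure n X = distr (uniform_count_measure {1..n}) borel X"

lemma emeasure_empirical_measure:
  assumes "n \<ge> 1" "A \<in> sets borel"
  shows "emeasure (empirical_measure n X) A = ennreal (1 / n) * (\<Sum>i=1..n. emeasure (return borel (X i)) A)"
proof -
  have "emeasure (empirical_measure n X) A = emeasure (uniform_count_measure {1..n}) {i \<in> {1..n}. X i \<in> A}"
    unfolding empirical_measure_def using assms(2)
    by (subst emeasure_distr)
       (auto simp: space_uniform_count_measure sets_uniform_count_measure measurable_def
         intro!: arg_cong[where f="emeasure _"])
  also have "\<dots> = ennreal (real (card {i \<in> {1..n}. X i \<in> A}) / real n)"
    by (subst emeasure_uniform_count_measure) auto
  also have "\<dots> = ennreal (1 / n) * ennreal (\<Sum>i=1..n. indicator A (X i))"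
    by (subst ennreal_mult[symmetric])
       (auto simp: sum_nonneg indicator_def sum.If_cases Int_def)
  also have "ennreal (\<Sum>i=1..n. indicator A (X i)) = (\<Sum>i=1..n. emeasure (return borel (X i)) A)"
    using assms(2) by (subst sum_ennreal[symmetric]) (auto simp: ennreal_indicator intro!: sum.cong)
  finally show ?thesis .
qed

end

theory Submission
  imports Defs
begin

text \<open>
  Idea. By Kantorovich duality \<open>W1 (L_n, \<pi>)\<close> is a supremum \<open>F\<close> over 1-Lipschitz functions, hence
  \<open>1/n\<close>-Lipschitz in every coordinate of the path; by contraction and \<open>T1\<close> the Doob martingale of
  \<open>F\<close> has subgaussian increments and \<open>F\<close> concentrates around its mean at scale
  \<open>sqrt (C / n) / (1 - r)\<close>. The bias from the start at \<open>0\<close> is at most \<open>m1 / (n (1 - r))\<close>, so it remains to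
  bound the mean of \<open>F\<close> in the stationary regime. There a 1-Lipschitz function is approximated by
  interpolants on dyadic grids of mesh \<open>2^j s0\<close>, those of level \<open>j\<close> living only on a box of radius about
  \<open>min (2^j s0 / (a t), R)\<close>, so that the resolution is relative to the distance from the origin and the error is
  controlled by the first moment alone; each level is estimated in \<open>L^2\<close> through the decay of
  correlations.

  The exponential moments of \<open>\<pi>\<close> are governed by \<open>C / (1 - r)\<close>, whereas \<open>a\<close> does not involve \<open>r\<close>.
  When \<open>a\<^sup>2 C / (1 - r) \<le> 1\<close> the variance of \<open>\<pi>\<close> controls the correlations. Otherwise \<open>R\<close> may exceed
  \<open>1/a\<close> by a power of \<open>1 / (1 - r)\<close>, but functions bounded by the mesh have covariances
  bounded by mesh times \<open>m1\<close>, and summing over the levels gains exactly the factor lost in \<open>R\<close>.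
\<close>

section \<open>Transport-entropy inequalities and subgaussian moments\<close>

text \<open>The final estimate runs on a budget. With \<open>D = C / (n (1 - r)^2)\<close> the
  exponential moments of the dual functional are at most those of a Gaussian of variance
  \<open>D / 2\<close> around a mean \<open>E\<close>. If \<open>E <= t / 2 + G\<close> with
  \<open>G = sqrt D * X\<close>, then \<open>(t / 2 - G)^2 >= t^2 / 8 - G^2\<close> produces exactly
  \<open>exp (X^2) * exp (- t^2 / (8 D))\<close>. So the approximation error may consume
  \<open>t / 2\<close>, everything else in the mean must be a multiple of \<open>sqrt D\<close>, and
  the bracket in \<open>K\<close> is that part of the mean in units of \<open>sqrt D\<close>.

  The number \<open>a\<close> is the positive root of \<open>C a^2 / 4 + 2 a m1 = ln 2\<close>. What
  matters is \<open>a * m1 <= 1 / 2\<close>, so that \<open>1 / a\<close> dominates the first moment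
  of \<open>\<pi>\<close>; moreover \<open>u = 1 / (a t) >= 2\<close> keeps \<open>ln u\<close> away
  from 0, so that constants can be absorbed into it.

  A uniform mesh of order \<open>t\<close> on a ball of radius \<open>R\<close> would need about
  \<open>(R / t)^d\<close> functions, with \<open>R\<close> depending on \<open>r\<close>. With
  relative resolution every level has only about \<open>u^d\<close> of them, and in the second
  regime \<open>R\<close> enters through a single factor instead of a d-th power.\<close>

lemma P1D:
  assumes "\<mu> \<in> P1"
  shows "prob_space \<mu>" "sets \<mu> = sets borel" "integrable \<mu> norm" "space \<mu> = UNIV"
    "borel_measurable \<mu> = borel_measurable borel"
  using assms sets_eq_imp_space_eq[of \<mu> borel] measurable_cong_sets[of \<mu> borel borel borel]
  by (auto simp: P1_def)

lemma lipschitz_borel_measurable: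
  fixes f :: "'a::euclidean_space \<Rightarrow> real"
  assumes "L-lipschitz_on UNIV f"
  shows "f \<in> borel_measurable borel"
  using assms by (intro borel_measurable_continuous_onI lipschitz_on_continuous_on)

lemma lipschitz_real_abs:
  fixes f :: "'a::euclidean_space \<Rightarrow> real"
  assumes "L-lipschitz_on UNIV f"
  shows "\<bar>f x - f y\<bar> \<le> L * norm (x - y)"
  using lipschitz_onD[OF assms, of x y] by (simp add: dist_norm)

lemma lipschitz_realI:
  fixes f :: "'a::euclidean_space \<Rightarrow> real"
  assumes "0 \<le> L" "\<And>x y. f x - f y \<le> L * norm (x - y)"
  shows "L-lipschitz_on UNIV f"
proof (rule lipschitz_onI)
  fix x y
  show "dist (f x) (f y) \<le> L * dist x y"
    using assms(2)[of x y] assms(2)[of y x] by (simp add: dist_norm norm_minus_commute abs_le_iff)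
qed fact

lemma lipschitz_integrable:
  fixes f :: "'a::euclidean_space \<Rightarrow> real"
  assumes "\<mu> \<in> P1" and f: "L-lipschitz_on UNIV f"
  shows "integrable \<mu> f"
proof -
  interpret prob_space \<mu> using assms by (simp add: P1D)
  show ?thesis
  proof (rule Bochner_Integration.integrable_bound)
    show "integrable \<mu> (\<lambda>x. \<bar>f 0\<bar> + L * norm x)"
      using P1D[OF assms(1)] by (intro Bochner_Integration.integrable_add integrable_mult_right) auto
    show "f \<in> borel_measurable \<mu>"
      using P1D[OF assms(1)] lipschitz_borel_measurable[OF f] by simp
    have "norm (f x) \<le> norm (\<bar>f 0\<bar> + L * norm x)" for x
      using lipschitz_real_abs[OF f, of x 0] lipschitz_on_nonneg[OF f] by simp
    then show "AE x in \<mu>. norm (f x) \<le> norm (\<bar>f 0\<bar> + L * norm x)" by simp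
  qed
qed

text \<open>The easy half of Kantorovich duality: under any coupling the difference is the integral
  of \<open>f (fst z) - f (snd z)\<close>. \<open>W1\<close> is an infimum, so a coupling of cost
  below \<open>w + e / (L + 1)\<close> is taken; the \<open>+ 1\<close> covers
  \<open>L = 0\<close>.\<close>

lemma integral_diff_le_W1:
  fixes f :: "'a::euclidean_space \<Rightarrow> real"
  assumes \<mu>: "\<mu> \<in> P1" and \<nu>: "\<nu> \<in> P1" and f: "L-lipschitz_on UNIV f"
    and w: "W1 \<mu> \<nu> \<le> ennreal w" "0 \<le> w"
  shows "(\<integral>x. f x \<partial>\<mu>) - (\<integral>x. f x \<partial>\<nu>) \<le> L * w"
proof (rule field_le_epsilon)
  fix e :: real assume e: "0 < e"
  have L: "0 \<le> L" using f by (rule lipschitz_on_nonneg)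
  have "W1 \<mu> \<nu> < ennreal (w + e / (L + 1))"
    using w e L by (auto intro!: le_less_trans[OF w(1)] simp: ennreal_lessI)
  then obtain Q where Q: "Q \<in> couplings \<mu> \<nu>"
    and cost: "(\<integral>\<^sup>+z. ennreal (norm (fst z - snd z)) \<partial>Q) < ennreal (w + e / (L + 1))"
    unfolding W1_def by (auto simp: INF_less_iff)
  have Qs: "sets Q = sets (\<mu> \<Otimes>\<^sub>M \<nu>)" and Q1: "distr Q \<mu> fst = \<mu>" and Q2: "distr Q \<nu> snd = \<nu>"
    using Q by (auto simp: couplings_def)
  note sm = P1D[OF \<mu>] and sn = P1D[OF \<nu>]
  have [measurable]: "f \<in> borel_measurable borel" by (rule lipschitz_borel_measurable[OF f])
  have Qm: "sets Q = sets (borel \<Otimes>\<^sub>M borel)"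
    unfolding Qs by (intro sets_pair_measure_cong sm sn)
  have [measurable_cong]: "sets Q = sets (borel \<Otimes>\<^sub>M borel)" by (rule Qm)
  have m1: "fst \<in> Q \<rightarrow>\<^sub>M \<mu>" "snd \<in> Q \<rightarrow>\<^sub>M \<nu>"
    unfolding measurable_cong_sets[OF Qs refl] by auto
  have mf: "f \<in> borel_measurable \<mu>" "f \<in> borel_measurable \<nu>" using sm sn by simp_all
  have i1: "integrable Q (\<lambda>z. f (fst z))"
    using lipschitz_integrable[OF \<mu> f] integrable_distr_eq[OF m1(1) mf(1)] Q1 by simp
  have i2: "integrable Q (\<lambda>z. f (snd z))"
    using lipschitz_integrable[OF \<nu> f] integrable_distr_eq[OF m1(2) mf(2)] Q2 by simp
  have e1: "(\<integral>x. f x \<partial>\<mu>) = (\<integral>z. f (fst z) \<partial>Q)"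
    using integral_distr[OF m1(1) mf(1)] Q1 by simp
  have e2: "(\<integral>x. f x \<partial>\<nu>) = (\<integral>z. f (snd z) \<partial>Q)"
    using integral_distr[OF m1(2) mf(2)] Q2 by simp
  have fin: "(\<integral>\<^sup>+z. ennreal (norm (fst z - snd z)) \<partial>Q) < \<infinity>"
    using cost by (rule order.strict_trans) simp
  have i3: "integrable Q (\<lambda>z. norm (fst z - snd z))"
    by (rule integrableI_bounded) (use fin in simp_all)
  have "(\<integral>z. norm (fst z - snd z) \<partial>Q) < w + e / (L + 1)"
    using cost nn_integral_eq_integral[OF i3] e w(2) L
    by (simp add: ennreal_less_iff integral_nonneg_AE del: ennreal_plus)
  moreover have "(\<integral>z. f (fst z) \<partial>Q) - (\<integral>z. f (snd z) \<partial>Q) \<le> L * (\<integral>z. norm (fst z - snd z) \<partial>Q)"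
  proof -
    have "(\<integral>z. f (fst z) \<partial>Q) - (\<integral>z. f (snd z) \<partial>Q) = (\<integral>z. f (fst z) - f (snd z) \<partial>Q)"
      using i1 i2 by simp
    also have "\<dots> \<le> (\<integral>z. L * norm (fst z - snd z) \<partial>Q)"
      using i1 i2 i3 lipschitz_real_abs[OF f] by (intro integral_mono) (auto simp: abs_le_iff)
    finally show ?thesis by simp
  qed
  ultimately have "(\<integral>x. f x \<partial>\<mu>) - (\<integral>x. f x \<partial>\<nu>) \<le> L * (w + e / (L + 1))"
    unfolding e1 e2 using L by (smt (verit) mult_left_mono)
  also have "\<dots> \<le> L * w + e"
    using L e by (simp add: field_simps)
  finally show "(\<integral>x. f x \<partial>\<mu>) - (\<integral>x. f x \<partial>\<nu>) \<le> L * w + e" .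
qed

text \<open>A scaling parameter in the exponent would be redundant, since \<open>L\<close> ranges
  over all Lipschitz constants. Only bounded \<open>f\<close> are tested because their exponential
  tilts have bounded densities; truncation removes the restriction in
  \<open>subgaussian_nn_integral\<close>.\<close>

definition subgaussian :: "real \<Rightarrow> 'a::euclidean_space measure \<Rightarrow> bool" where
  "subgaussian K \<mu> \<longleftrightarrow> (\<forall>L f. L-lipschitz_on UNIV f \<longrightarrow> bounded (range f) \<longrightarrow>
     (\<integral>x. exp (f x) \<partial>\<mu>) \<le> exp ((\<integral>x. f x \<partial>\<mu>) + K * L\<^sup>2))"

text \<open>The log density of the Gibbs measure is \<open>f - ln Z\<close>, which is bounded, so
  the first case of \<open>rel_entropy\<close> applies. The last claim ensures that
  \<open>ennreal\<close> does not truncate this value.\<close>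

lemma rel_entropy_tilt:
  fixes f :: "'a::euclidean_space \<Rightarrow> real"
  assumes \<mu>: "\<mu> \<in> P1" and f[measurable]: "f \<in> borel_measurable borel" and B: "\<And>x. \<bar>f x\<bar> \<le> B"
  defines "Z \<equiv> (\<integral>x. exp (f x) \<partial>\<mu>)"
  defines "\<nu> \<equiv> density \<mu> (\<lambda>x. ennreal (exp (f x) / Z))"
  shows "0 < Z" "\<nu> \<in> P1" "rel_entropy \<nu> \<mu> = ennreal ((\<integral>x. f x \<partial>\<nu>) - ln Z)"
    "0 \<le> (\<integral>x. f x \<partial>\<nu>) - ln Z"
proof -
  interpret prob_space \<mu> using \<mu> by (simp add: P1D)
  note sm = P1D[OF \<mu>]
  have [measurable]: "f \<in> borel_measurable \<mu>" "norm \<in> borel_measurable \<mu>" using sm by simp_all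
  have bnd: "exp (f x) \<le> exp B" "exp (-B) \<le> exp (f x)" for x using B[of x] by (auto simp: abs_le_iff)
  have iexp: "integrable \<mu> (\<lambda>x. exp (f x))"
    by (rule integrable_const_bound[where B="exp B"]) (use bnd in auto)
  have "exp (-B) \<le> Z" unfolding Z_def
    using integral_mono[OF integrable_const iexp, of "exp (-B)"] bnd by (simp add: prob_space)
  then show Z0: "0 < Z" by (rule less_le_trans[rotated]) simp
  define D where "D = (\<lambda>x. exp (f x) / Z)"
  have [measurable]: "D \<in> borel_measurable \<mu>" unfolding D_def by measurable
  have D0: "0 < D x" for x using Z0 by (simp add: D_def)
  have \<nu>: "\<nu> = density \<mu> (\<lambda>x. ennreal (D x))" by (simp add: \<nu>_def D_def)
  have iD: "integrable \<mu> D" unfolding D_def using iexp by simp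
  have "(\<integral>x. D x \<partial>\<mu>) = 1" unfolding D_def using Z0 by (simp add: Z_def)
  then have nD: "(\<integral>\<^sup>+x. ennreal (D x) \<partial>\<mu>) = 1"
    using nn_integral_eq_integral[OF iD] D0 by (simp add: less_imp_le)
  have pn: "prob_space \<nu>" unfolding \<nu>
    by (rule prob_spaceI) (simp add: emeasure_density nD cong: nn_integral_cong)
  interpret N: prob_space \<nu> by fact
  have snu: "sets \<nu> = sets borel" using sm by (simp add: \<nu>)
  have inorm: "integrable \<nu> norm"
  proof -
    have "integrable \<mu> (\<lambda>x. D x * norm x)"
    proof (rule Bochner_Integration.integrable_bound)
      show "integrable \<mu> (\<lambda>x. exp B / Z * norm x)" using sm by simp
      show "AE x in \<mu>. norm (D x * norm x) \<le> norm (exp B / Z * norm x)"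
        using bnd Z0 by (intro AE_I2) (simp add: D_def abs_mult divide_right_mono mult_right_mono)
    qed measurable
    then show ?thesis unfolding \<nu> using D0 by (subst integrable_density) (auto simp: less_imp_le)
  qed
  show nP: "\<nu> \<in> P1" using pn snu inorm by (simp add: P1_def)
  have ac: "absolutely_continuous \<mu> \<nu>" unfolding \<nu> by (rule absolutely_continuousI_density) measurable
  interpret information_space \<mu> "exp 1" by standard simp
  have lnD: "log (exp 1) (D x) = f x - ln Z" for x
    using Z0 by (simp add: D_def log_def ln_div)
  have iDl: "integrable \<mu> (\<lambda>x. D x * log (exp 1) (D x))"
    unfolding lnD
  proof (rule Bochner_Integration.integrable_bound)
    show "integrable \<mu> (\<lambda>x. (B + \<bar>ln Z\<bar>) * D x)" using iD by simp
    show "AE x in \<mu>. norm (D x * (f x - ln Z)) \<le> norm ((B + \<bar>ln Z\<bar>) * D x)"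
    proof (rule AE_I2)
      fix x
      have "\<bar>f x - ln Z\<bar> \<le> \<bar>B + \<bar>ln Z\<bar>\<bar>" using B[of x] by linarith
      then show "norm (D x * (f x - ln Z)) \<le> norm ((B + \<bar>ln Z\<bar>) * D x)"
        using D0[of x] by (simp add: abs_mult mult.commute mult_right_mono)
    qed
  qed measurable
  have pnD: "prob_space (density \<mu> (\<lambda>x. ennreal (D x)))" using pn \<nu> by simp
  have fnu: "integrable \<nu> f"
    by (rule N.integrable_const_bound[where B=B]) (use B snu in \<open>auto simp: \<nu>\<close>)
  have KL: "KL_divergence (exp 1) \<mu> \<nu> = (\<integral>x. f x \<partial>\<nu>) - ln Z"
  proof -
    have "KL_divergence (exp 1) \<mu> \<nu> = (\<integral>x. D x * log (exp 1) (D x) \<partial>\<mu>)"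
      unfolding \<nu> by (rule KL_density) (use D0 in \<open>auto simp: less_imp_le\<close>)
    also have "\<dots> = (\<integral>x. log (exp 1) (D x) \<partial>\<nu>)"
      unfolding \<nu> by (subst integral_density) (use D0 in \<open>auto simp: less_imp_le\<close>)
    also have "\<dots> = (\<integral>x. f x - ln Z \<partial>\<nu>)" by (simp add: lnD)
    also have "\<dots> = (\<integral>x. f x \<partial>\<nu>) - ln Z" using fnu by (simp add: N.prob_space)
    finally show ?thesis .
  qed
  have "0 \<le> KL_divergence (exp 1) \<mu> \<nu>"
    unfolding \<nu> by (rule KL_nonneg[OF pnD]) (use D0 iDl in \<open>auto simp: less_imp_le\<close>)
  then show "0 \<le> (\<integral>x. f x \<partial>\<nu>) - ln Z" using KL by simp
  \<comment> \<open>The entropy density is defined through \<open>RN_deriv\<close>, which agrees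
    with \<open>D\<close> only almost everywhere; the identity is transferred from
    \<open>\<mu>\<close> to \<open>\<nu>\<close> by absolute continuity.\<close>
  have "AE x in \<mu>. ennreal (D x) = RN_deriv \<mu> \<nu> x"
    by (rule RN_deriv_unique) (auto simp: \<nu>)
  then have "AE x in \<nu>. ennreal (D x) = RN_deriv \<mu> \<nu> x"
    using absolutely_continuous_AE[OF _ ac] snu sm by simp
  then have eq: "AE x in \<nu>. f x - ln Z = entropy_density (exp 1) \<mu> \<nu> x"
    by eventually_elim (metis lnD D0 enn2real_ennreal entropy_density_def comp_apply less_imp_le)
  have "integrable \<nu> (entropy_density (exp 1) \<mu> \<nu>)"
  proof (rule integrable_cong_AE_imp[OF _ _ ])
    show "integrable \<nu> (\<lambda>x. f x - ln Z)" using fnu by simp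
    show "entropy_density (exp 1) \<mu> \<nu> \<in> borel_measurable \<nu>"
      unfolding \<nu> entropy_density_def by (simp add: comp_def)
    show "AE x in \<nu>. f x - ln Z = entropy_density (exp 1) \<mu> \<nu> x" by (rule eq)
  qed
  then show "rel_entropy \<nu> \<mu> = ennreal ((\<integral>x. f x \<partial>\<nu>) - ln Z)"
    using ac by (simp add: rel_entropy_def KL)
qed

text \<open>The easy half of the Bobkov--Goetze theorem, via the Gibbs variational formula:
  tilt \<open>\<mu>\<close> by \<open>exp f\<close>.\<close>

lemma T1_imp_subgaussian:
  assumes T: "T1 C \<mu>" and C: "0 \<le> C"
  shows "subgaussian (C / 4) \<mu>"
  unfolding subgaussian_def
proof (intro allI impI)
  fix L and f :: "'a \<Rightarrow> real"
  assume f: "L-lipschitz_on UNIV f" and "bounded (range f)"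
  then obtain B where B: "\<And>x. \<bar>f x\<bar> \<le> B" by (auto simp: bounded_iff)
  have \<mu>: "\<mu> \<in> P1" using T by (simp add: T1_def)
  have L: "0 \<le> L" using f by (rule lipschitz_on_nonneg)
  define Z where "Z = (\<integral>x. exp (f x) \<partial>\<mu>)"
  define \<nu> where "\<nu> = density \<mu> (\<lambda>x. ennreal (exp (f x) / Z))"
  define h where "h = (\<integral>x. f x \<partial>\<nu>) - ln Z"
  note tilt = rel_entropy_tilt[OF \<mu> lipschitz_borel_measurable[OF f] B,
      folded Z_def, folded \<nu>_def, folded h_def]
  have "W1 \<mu> \<nu> \<le> ennreal_sqrt (ennreal C * ennreal h)"
    using T tilt by (auto simp: T1_def)
  also have "\<dots> = ennreal (sqrt (C * h))"
    using C tilt by (simp add: ennreal_sqrt_def ennreal_mult[symmetric])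
  finally have W: "W1 \<mu> \<nu> \<le> ennreal (sqrt (C * h))" .
  have "L-lipschitz_on UNIV (\<lambda>x. - f x)" using f by (simp add: lipschitz_on_def dist_real_def abs_minus_commute)
  from integral_diff_le_W1[OF \<mu> tilt(2) this W] C tilt
  have "(\<integral>x. f x \<partial>\<nu>) - (\<integral>x. f x \<partial>\<mu>) \<le> L * sqrt (C * h)" by simp
  then have "ln Z \<le> (\<integral>x. f x \<partial>\<mu>) + (L * sqrt (C * h) - h)" by (simp add: h_def)
  \<comment> \<open>Maximising over \<open>h\<close>: the worst case is
    \<open>sqrt h = L * sqrt C / 2\<close>, the origin of \<open>C / 4\<close>.\<close>
  also have "L * sqrt (C * h) - h \<le> C / 4 * L\<^sup>2"
  proof -
    have "0 \<le> (L * sqrt C / 2 - sqrt h)\<^sup>2" by simp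
    also have "\<dots> = C / 4 * L\<^sup>2 - L * sqrt (C * h) + h"
      using C tilt by (simp add: power2_diff power_mult_distrib power_divide real_sqrt_mult algebra_simps)
    finally show ?thesis by simp
  qed
  finally have "ln Z \<le> (\<integral>x. f x \<partial>\<mu>) + C / 4 * L\<^sup>2" by simp
  then show "(\<integral>x. exp (f x) \<partial>\<mu>) \<le> exp ((\<integral>x. f x \<partial>\<mu>) + C / 4 * L\<^sup>2)"
    using tilt(1) by (simp add: Z_def[symmetric] ln_le_cancel_iff[symmetric] del: ln_le_cancel_iff)
qed

lemma lipschitz_truncate:
  fixes f :: "'a::euclidean_space \<Rightarrow> real"
  assumes "L-lipschitz_on UNIV f"
  shows "L-lipschitz_on UNIV (\<lambda>x. max (-B) (min B (f x)))"
proof (rule lipschitz_realI)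
  show "0 \<le> L" using assms by (rule lipschitz_on_nonneg)
  then have n: "0 \<le> L * norm (x - y)" for x y :: 'a by simp
  fix x y
  show "max (- B) (min B (f x)) - max (- B) (min B (f y)) \<le> L * norm (x - y)"
    using lipschitz_real_abs[OF assms, of x y] n[of x y] by (auto simp: max_def min_def)
qed

text \<open>Truncation at level \<open>n\<close> reduces to bounded \<open>f\<close>: Fatou handles
  the exponential and dominated convergence the mean. The \<open>ennreal\<close> form makes
  integrability of \<open>exp f\<close> a conclusion.\<close>

lemma subgaussian_nn_integral:
  fixes f :: "'a::euclidean_space \<Rightarrow> real"
  assumes \<mu>: "\<mu> \<in> P1" and S: "subgaussian K \<mu>" and f: "L-lipschitz_on UNIV f"
  shows "(\<integral>\<^sup>+x. ennreal (exp (f x)) \<partial>\<mu>) \<le> ennreal (exp ((\<integral>x. f x \<partial>\<mu>) + K * L\<^sup>2))"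
proof -
  interpret prob_space \<mu> using \<mu> by (simp add: P1D)
  define g where "g = (\<lambda>n::nat. \<lambda>x. max (- real n) (min (real n) (f x)))"
  have gL: "L-lipschitz_on UNIV (g n)" for n unfolding g_def by (rule lipschitz_truncate[OF f])
  have [measurable]: "f \<in> borel_measurable \<mu>" "g n \<in> borel_measurable \<mu>" for n
    using lipschitz_borel_measurable[OF f] lipschitz_borel_measurable[OF gL] P1D[OF \<mu>] by auto
  have gB: "\<bar>g n x\<bar> \<le> real n" for n x unfolding g_def by auto
  have lim: "(\<lambda>n. g n x) \<longlonglongrightarrow> f x" for x
  proof (rule tendsto_eventually)
    have "\<forall>\<^sub>F n in sequentially. \<bar>f x\<bar> \<le> real n"
      using eventually_ge_at_top[of "nat \<lceil>\<bar>f x\<bar>\<rceil>"] by eventually_elim linarith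
    then show "\<forall>\<^sub>F n in sequentially. g n x = f x"
      by eventually_elim (auto simp: g_def)
  qed
  have iexp: "integrable \<mu> (\<lambda>x. exp (g n x))" for n
    by (rule integrable_const_bound[where B="exp (real n)"]) (use gB in \<open>auto simp: abs_le_iff\<close>)
  have le: "(\<integral>\<^sup>+x. ennreal (exp (g n x)) \<partial>\<mu>) \<le> ennreal (exp ((\<integral>x. g n x \<partial>\<mu>) + K * L\<^sup>2))" for n
  proof -
    have "bounded (range (g n))" using gB by (auto simp: bounded_iff)
    then have "(\<integral>x. exp (g n x) \<partial>\<mu>) \<le> exp ((\<integral>x. g n x \<partial>\<mu>) + K * L\<^sup>2)"
      using S gL by (auto simp: subgaussian_def)
    then show ?thesis using nn_integral_eq_integral[OF iexp[of n]] by (simp add: ennreal_leI)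
  qed
  have "(\<integral>\<^sup>+x. ennreal (exp (f x)) \<partial>\<mu>) = (\<integral>\<^sup>+x. liminf (\<lambda>n. ennreal (exp (g n x))) \<partial>\<mu>)"
  proof (rule nn_integral_cong)
    fix x
    have "(\<lambda>n. ennreal (exp (g n x))) \<longlonglongrightarrow> ennreal (exp (f x))"
      by (intro tendsto_ennrealI tendsto_exp lim)
    then show "ennreal (exp (f x)) = liminf (\<lambda>n. ennreal (exp (g n x)))"
      by (intro lim_imp_Liminf[symmetric]) auto
  qed
  also have "\<dots> \<le> liminf (\<lambda>n. \<integral>\<^sup>+x. ennreal (exp (g n x)) \<partial>\<mu>)"
    by (rule nn_integral_liminf) measurable
  also have "\<dots> \<le> liminf (\<lambda>n. ennreal (exp ((\<integral>x. g n x \<partial>\<mu>) + K * L\<^sup>2)))"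
    using le by (intro Liminf_mono) auto
  also have "\<dots> = ennreal (exp ((\<integral>x. f x \<partial>\<mu>) + K * L\<^sup>2))"
  proof (rule lim_imp_Liminf)
    have "(\<lambda>n. \<integral>x. g n x \<partial>\<mu>) \<longlonglongrightarrow> (\<integral>x. f x \<partial>\<mu>)"
    proof (rule integral_dominated_convergence)
      show "integrable \<mu> (\<lambda>x. \<bar>f x\<bar>)" using lipschitz_integrable[OF \<mu> f] by simp
      show "AE x in \<mu>. norm (g n x) \<le> \<bar>f x\<bar>" for n unfolding g_def by auto
      show "AE x in \<mu>. (\<lambda>n. g n x) \<longlonglongrightarrow> f x" using lim by simp
    qed measurable
    then show "(\<lambda>n. ennreal (exp ((\<integral>x. g n x \<partial>\<mu>) + K * L\<^sup>2))) \<longlonglongrightarrow> ennreal (exp ((\<integral>x. f x \<partial>\<mu>) + K * L\<^sup>2))"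
      by (intro tendsto_ennrealI tendsto_intros)
  qed simp
  finally show ?thesis .
qed

lemma subgaussian_integral:
  fixes f :: "'a::euclidean_space \<Rightarrow> real"
  assumes \<mu>: "\<mu> \<in> P1" and S: "subgaussian K \<mu>" and f: "L-lipschitz_on UNIV f"
  shows "integrable \<mu> (\<lambda>x. exp (f x))"
    "(\<integral>x. exp (f x) \<partial>\<mu>) \<le> exp ((\<integral>x. f x \<partial>\<mu>) + K * L\<^sup>2)"
proof -
  note le = subgaussian_nn_integral[OF assms]
  have [measurable]: "f \<in> borel_measurable \<mu>"
    using lipschitz_borel_measurable[OF f] P1D[OF \<mu>] by auto
  show i: "integrable \<mu> (\<lambda>x. exp (f x))"
    by (rule integrableI_nonneg) (auto intro: le_less_trans[OF le])
  show "(\<integral>x. exp (f x) \<partial>\<mu>) \<le> exp ((\<integral>x. f x \<partial>\<mu>) + K * L\<^sup>2)"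
    using le nn_integral_eq_integral[OF i] by simp
qed

lemma exp_plus_exp_minus_ge: "2 + x\<^sup>2 / 2 \<le> exp x + exp (- x)" for x :: real
proof -
  have "2 + x\<^sup>2 / 2 \<le> exp x + exp (- x)" if "0 \<le> x" for x :: real
    using exp_lower_Taylor_quadratic[OF that] exp_ge_add_one_self[of "-x"] by simp
  from this[of x] this[of "-x"] show ?thesis by (cases "0 \<le> x") auto
qed

text \<open>At the scale \<open>l = 1 / sqrt K\<close> the exponential moments of both signs of the
  centred \<open>f\<close> are at most \<open>exp 1\<close>, and
  \<open>exp_plus_exp_minus_ge\<close> converts their sum into a second moment. With
  \<open>exp 1 <= 3\<close> the result is \<open>(3 + 3 - 2) * 2 K = 8 K\<close>.\<close>

lemma subgaussian_variance:
  fixes f :: "'a::euclidean_space \<Rightarrow> real"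
  assumes \<mu>: "\<mu> \<in> P1" and S: "subgaussian K \<mu>" and K: "0 < K" and f: "1-lipschitz_on UNIV f"
  shows "integrable \<mu> (\<lambda>x. (f x - (\<integral>y. f y \<partial>\<mu>))\<^sup>2)"
    "(\<integral>x. (f x - (\<integral>y. f y \<partial>\<mu>))\<^sup>2 \<partial>\<mu>) \<le> 8 * K"
proof -
  interpret prob_space \<mu> using \<mu> by (simp add: P1D)
  define m where "m = (\<integral>y. f y \<partial>\<mu>)"
  define l where "l = 1 / sqrt K"
  have l: "0 < l" "l\<^sup>2 = 1 / K" using K by (auto simp: l_def power_divide)
  have [measurable]: "f \<in> borel_measurable \<mu>"
    using lipschitz_borel_measurable[OF f] P1D[OF \<mu>] by auto
  have if': "integrable \<mu> f" by (rule lipschitz_integrable[OF \<mu> f])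
  have L: "l-lipschitz_on UNIV (\<lambda>x. s * l * (f x - m))" if "\<bar>s\<bar> = 1" for s
    by (rule lipschitz_onI)
      (use lipschitz_onD[OF f] l that in \<open>auto simp: dist_real_def abs_mult right_diff_distrib[symmetric]\<close>)
  have e: "integrable \<mu> (\<lambda>x. exp (s * l * (f x - m)))" "(\<integral>x. exp (s * l * (f x - m)) \<partial>\<mu>) \<le> exp 1"
    if "\<bar>s\<bar> = 1" for s
    using subgaussian_integral[OF \<mu> S L[OF that]] l K if' prob_space by (auto simp: m_def)
  have i: "integrable \<mu> (\<lambda>x. (exp (l * (f x - m)) + exp (- (l * (f x - m))) - 2) * (2 * K))"
    using e[of 1] e[of "-1"] by simp
  have pt: "(f x - m)\<^sup>2 \<le> (exp (l * (f x - m)) + exp (- (l * (f x - m))) - 2) * (2 * K)" for x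
  proof -
    have "(f x - m)\<^sup>2 = (l * (f x - m))\<^sup>2 / 2 * (2 * K)" using l K by (simp add: power_mult_distrib)
    also have "\<dots> \<le> (exp (l * (f x - m)) + exp (- (l * (f x - m))) - 2) * (2 * K)"
      using exp_plus_exp_minus_ge[of "l * (f x - m)"] K by (intro mult_right_mono) auto
    finally show ?thesis .
  qed
  show i2: "integrable \<mu> (\<lambda>x. (f x - (\<integral>y. f y \<partial>\<mu>))\<^sup>2)"
    unfolding m_def[symmetric]
  proof (rule Bochner_Integration.integrable_bound[OF i])
    have "norm ((f x - m)\<^sup>2) \<le> norm ((exp (l * (f x - m)) + exp (- (l * (f x - m))) - 2) * (2 * K))" for x
      using pt[of x] by (metis abs_ge_self abs_of_nonneg order_trans real_norm_def zero_le_power2)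
    then show "AE x in \<mu>. norm ((f x - m)\<^sup>2) \<le> norm ((exp (l * (f x - m)) + exp (- (l * (f x - m))) - 2) * (2 * K))"
      by simp
  qed measurable
  have "(\<integral>x. (f x - m)\<^sup>2 \<partial>\<mu>) \<le> (\<integral>x. (exp (l * (f x - m)) + exp (- (l * (f x - m))) - 2) * (2 * K) \<partial>\<mu>)"
    using i i2 pt by (intro integral_mono) (auto simp: m_def)
  also have "\<dots> = ((\<integral>x. exp (1 * l * (f x - m)) \<partial>\<mu>) + (\<integral>x. exp ((-1) * l * (f x - m)) \<partial>\<mu>) - 2) * (2 * K)"
    using e[of 1] e[of "-1"] by (simp add: prob_space)
  also have "\<dots> \<le> 4 * (2 * K)"
    using e(2)[of 1] e(2)[of "-1"] exp_le K by (intro mult_right_mono) auto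
  also have "\<dots> = 8 * K" by simp
  finally show "(\<integral>x. (f x - (\<integral>y. f y \<partial>\<mu>))\<^sup>2 \<partial>\<mu>) \<le> 8 * K" by (simp add: m_def)
qed

section \<open>Contractive Markov kernels and their invariant measures\<close>

locale contractive_kernel =
  fixes P :: "'a::euclidean_space \<Rightarrow> 'a measure" and C r :: real
  assumes kernel: "markov_kernel P"
    and T1: "\<And>x. T1 C (P x)"
    and contraction: "\<And>x y. W1 (P x) (P y) \<le> ennreal (r * norm (x - y))"
    and C_pos: "0 < C" and r_nonneg: "0 \<le> r" and r_less_1: "r < 1"
begin

text \<open>The Markov operator of the kernel: \<open>(avg ^^ k) f x\<close> is the mean of
  \<open>f\<close> at time \<open>k\<close> for the chain started at \<open>x\<close>.\<close>

definition avg :: "('a \<Rightarrow> real) \<Rightarrow> 'a \<Rightarrow> real" where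
  "avg f x = (\<integral>y. f y \<partial>P x)"

lemma P_P1: "P x \<in> P1" using T1[of x] by (simp add: T1_def)

lemma prob_P: "prob_space (P x)" using P1D(1)[OF P_P1] .

lemma subgaussian_P: "subgaussian (C / 4) (P x)"
  using T1_imp_subgaussian[OF T1] C_pos by simp

lemma kernel_measurable[measurable]: "P \<in> borel \<rightarrow>\<^sub>M prob_algebra borel"
  using kernel by (simp add: markov_kernel_def)

lemma kernel_measurable_subprob[measurable]: "P \<in> borel \<rightarrow>\<^sub>M subprob_algebra borel"
  by (rule measurable_prob_algebraD) (rule kernel_measurable)

text \<open>The dual form of the Wasserstein contraction, and the form in which it is used from here
  on.\<close>

lemma avg_lipschitz:
  assumes "L-lipschitz_on UNIV f"
  shows "(r * L)-lipschitz_on UNIV (avg f)"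
proof (rule lipschitz_realI)
  show "0 \<le> r * L" using r_nonneg lipschitz_on_nonneg[OF assms] by simp
  fix x y
  show "avg f x - avg f y \<le> r * L * norm (x - y)"
    using integral_diff_le_W1[OF P_P1 P_P1 assms contraction, of x y] r_nonneg
    by (simp add: avg_def mult_ac)
qed

lemma avg_pow_lipschitz:
  assumes "L-lipschitz_on UNIV f"
  shows "(r ^ k * L)-lipschitz_on UNIV ((avg ^^ k) f)"
  using assms avg_lipschitz by (induction k) (auto simp: mult.assoc)

lemma avg_mono:
  assumes "L-lipschitz_on UNIV f" "L'-lipschitz_on UNIV g" "\<And>x. f x \<le> g x"
  shows "avg f x \<le> avg g x"
  unfolding avg_def
  by (intro integral_mono lipschitz_integrable[OF P_P1 assms(1)] lipschitz_integrable[OF P_P1 assms(2)] assms)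

lemma avg_const: "avg (\<lambda>_. c) x = c"
  using prob_space.prob_space[OF prob_P] by (simp add: avg_def)

lemma avg_bounded:
  assumes "L-lipschitz_on UNIV f" "\<And>x. \<bar>f x\<bar> \<le> B"
  shows "\<bar>avg f x\<bar> \<le> B"
proof -
  have c: "0-lipschitz_on UNIV (\<lambda>_::'a. c)" for c :: real by (simp add: lipschitz_on_def)
  have "avg f x \<le> B" using avg_mono[OF assms(1) c[of B], of x] assms(2) by (simp add: avg_const abs_le_iff)
  moreover have "-B \<le> avg f x" using avg_mono[OF c[of "-B"] assms(1), of x] assms(2)
    by (simp add: avg_const abs_le_iff) (smt (verit))
  ultimately show ?thesis by simp
qed

lemma avg_pow_bounded:
  assumes "L-lipschitz_on UNIV f" "\<And>x. \<bar>f x\<bar> \<le> B"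
  shows "\<bar>(avg ^^ k) f x\<bar> \<le> B"
  using assms(2) by (induction k arbitrary: x) (auto intro!: avg_bounded avg_pow_lipschitz[OF assms(1)])

lemma avg_pow_nonneg:
  assumes "\<And>x. 0 \<le> f x"
  shows "0 \<le> (avg ^^ k) f x"
  using assms by (induction k arbitrary: x) (auto simp: avg_def)

lemma geometric_sum_le: "(\<Sum>i<k. r ^ i) \<le> 1 / (1 - r)"
proof -
  have "(\<Sum>i<k. r ^ i) = (1 - r ^ k) / (1 - r)"
    using r_less_1 by (simp add: sum_gp_strict)
  also have "\<dots> \<le> 1 / (1 - r)"
    using r_less_1 r_nonneg by (intro divide_right_mono) auto
  finally show ?thesis .
qed

text \<open>Consecutive iterates differ at 0 by at most \<open>r ^ k\<close> times the mean
  displacement from 0. The bound is uniform in \<open>k\<close>, which is what gives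
  \<open>\<pi>\<close> a first moment.\<close>

lemma avg_pow_at_0:
  assumes f: "1-lipschitz_on UNIV f"
  shows "(avg ^^ k) f 0 \<le> f 0 + (\<integral>y. norm y \<partial>P 0) / (1 - r)"
proof -
  define b where "b = (\<integral>y. norm y \<partial>P 0)"
  have "(avg ^^ k) f 0 \<le> f 0 + (\<Sum>i<k. r ^ i) * b"
  proof (induction k)
    case (Suc k)
    have L: "(r ^ k)-lipschitz_on UNIV ((avg ^^ k) f)" using avg_pow_lipschitz[OF f, of k] by simp
    interpret prob_space "P 0" by (rule prob_P)
    have "avg ((avg ^^ k) f) 0 \<le> (\<integral>y. (avg ^^ k) f 0 + r ^ k * norm y \<partial>P 0)"
      unfolding avg_def[of "(avg ^^ k) f" 0]
    proof (rule integral_mono)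
      show "integrable (P 0) ((avg ^^ k) f)" by (rule lipschitz_integrable[OF P_P1 L])
      show "integrable (P 0) (\<lambda>y. (avg ^^ k) f 0 + r ^ k * norm y)" using P1D(3)[OF P_P1] by simp
      show "(avg ^^ k) f y \<le> (avg ^^ k) f 0 + r ^ k * norm y" for y
        using lipschitz_real_abs[OF L, of y 0] by (simp add: abs_le_iff)
    qed
    also have "\<dots> = (avg ^^ k) f 0 + r ^ k * b" using P1D(3)[OF P_P1] by (simp add: b_def prob_space)
    finally show ?case using Suc by (simp add: algebra_simps)
  qed simp
  also have "(\<Sum>i<k. r ^ i) * b \<le> 1 / (1 - r) * b"
    using geometric_sum_le by (intro mult_right_mono) (auto simp: b_def)
  finally show ?thesis by (simp add: b_def)
qed

end

locale contractive_kernel_invariant = contractive_kernel P C r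
  for P :: "'a::euclidean_space \<Rightarrow> 'a measure" and C r :: real +
  fixes \<pi> :: "'a measure"
  assumes invariant: "invariant_prob P \<pi>"
begin

lemma prob_pi: "prob_space \<pi>" and sets_pi[measurable_cong]: "sets \<pi> = sets borel"
  and bind_pi: "\<pi> \<bind> P = \<pi>"
  using invariant by (auto simp: invariant_prob_def)

sublocale pi: prob_space \<pi> by (rule prob_pi)

lemma integral_avg_bounded:
  assumes f: "f \<in> borel_measurable borel" "\<And>x. \<bar>f x\<bar> \<le> B"
  shows "(\<integral>x. avg f x \<partial>\<pi>) = (\<integral>x. f x \<partial>\<pi>)"
proof -
  have "(\<integral>x. f x \<partial>(\<pi> \<bind> P)) = (\<integral>x. \<integral>y. f y \<partial>P x \<partial>\<pi>)"
  proof (rule integral_bind[where K=borel and B=B and B'=1])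
    show "f \<in> borel_measurable borel" by fact
    show "P \<in> \<pi> \<rightarrow>\<^sub>M subprob_algebra borel" by measurable
    show "finite_measure \<pi>" by unfold_locales
    show "\<And>x. x \<in> space borel \<Longrightarrow> \<bar>f x\<bar> \<le> B" using f by simp
    show "AE x in \<pi>. emeasure (P x) (space (P x)) \<le> ennreal 1"
      using prob_space.emeasure_space_1[OF prob_P] by simp
  qed
  then show ?thesis by (simp add: bind_pi avg_def)
qed

lemma integral_avg_pow_bounded:
  assumes f: "L-lipschitz_on UNIV f" "\<And>x. \<bar>f x\<bar> \<le> B"
  shows "(\<integral>x. (avg ^^ k) f x \<partial>\<pi>) = (\<integral>x. f x \<partial>\<pi>)"
proof (induction k)
  case (Suc k)
  have "(\<integral>x. avg ((avg ^^ k) f) x \<partial>\<pi>) = (\<integral>x. (avg ^^ k) f x \<partial>\<pi>)"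
    by (rule integral_avg_bounded[where B=B])
      (auto intro!: lipschitz_borel_measurable[OF avg_pow_lipschitz[OF f(1)]] avg_pow_bounded[OF f])
  then show ?case using Suc by simp
qed simp

lemma bounded_integrable_pi:
  assumes "f \<in> borel_measurable borel" "\<And>x. \<bar>f x\<bar> \<le> (B::real)"
  shows "integrable \<pi> f"
  by (rule pi.integrable_const_bound[where B=B]) (use assms in \<open>auto simp: measurable_cong_sets[OF sets_pi]\<close>)

text \<open>Invariance alone does not include a finite first moment. The truncated norm is bounded,
  so its \<open>\<pi>\<close>-integral is that of its \<open>k\<close>-th average, which is at most
  \<open>min M (b + r ^ k * norm x)\<close>. Letting \<open>k\<close> grow leaves \<open>b\<close>,
  and Fatou removes the truncation \<open>M\<close>.\<close>

lemma pi_P1: "\<pi> \<in> P1"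
proof -
  define b where "b = (\<integral>y. norm y \<partial>P 0) / (1 - r)"
  have b: "0 \<le> b" using r_less_1 by (simp add: b_def)
  have bd: "(\<integral>x. min M (norm x) \<partial>\<pi>) \<le> b" if M: "0 \<le> M" for M
  proof -
    define f where "f = (\<lambda>x::'a. min M (norm x))"
    have "1-lipschitz_on UNIV (\<lambda>x::'a. norm x)"
      by (rule lipschitz_realI) (auto intro: norm_triangle_ineq2)
    from lipschitz_truncate[OF this, of M]
    have f: "1-lipschitz_on UNIV f" using M
      by (simp add: f_def max_absorb2 order.trans[of "- M" 0])
    have fB: "\<bar>f x\<bar> \<le> M" for x using M by (auto simp: f_def)
    have le: "(avg ^^ k) f x \<le> min M (b + r ^ k * norm x)" for k x
    proof -
      have "(avg ^^ k) f x \<le> (avg ^^ k) f 0 + r ^ k * norm x"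
        using lipschitz_real_abs[OF avg_pow_lipschitz[OF f, of k], of x 0] by (simp add: abs_le_iff)
      moreover have "(avg ^^ k) f 0 \<le> b" using avg_pow_at_0[OF f, of k] M by (simp add: f_def b_def)
      ultimately show ?thesis using avg_pow_bounded[OF f fB, of k x] by (simp add: abs_le_iff)
    qed
    have [measurable]: "(\<lambda>x::'a. min M (b + r ^ k * norm x)) \<in> borel_measurable \<pi>" for k by measurable
    have le2: "(\<integral>x. f x \<partial>\<pi>) \<le> (\<integral>x. min M (b + r ^ k * norm x) \<partial>\<pi>)" for k
    proof -
      have "(\<integral>x. f x \<partial>\<pi>) = (\<integral>x. (avg ^^ k) f x \<partial>\<pi>)" using integral_avg_pow_bounded[OF f fB] by simp
      also have "\<dots> \<le> (\<integral>x. min M (b + r ^ k * norm x) \<partial>\<pi>)"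
      proof (rule integral_mono)
        show "integrable \<pi> ((avg ^^ k) f)"
          by (rule bounded_integrable_pi[where B=M])
            (auto intro!: lipschitz_borel_measurable[OF avg_pow_lipschitz[OF f]] avg_pow_bounded[OF f] fB)
        show "integrable \<pi> (\<lambda>x. min M (b + r ^ k * norm x))"
          by (rule bounded_integrable_pi[where B=M]) (use M b r_nonneg in auto)
      qed (rule le)
      finally show ?thesis .
    qed
    have "(\<lambda>k. \<integral>x. min M (b + r ^ k * norm x) \<partial>\<pi>) \<longlonglongrightarrow> (\<integral>x. min M (b + 0 * norm x) \<partial>\<pi>)"
    proof (rule integral_dominated_convergence[where w="\<lambda>_. M"])
      show "AE x in \<pi>. (\<lambda>k. min M (b + r ^ k * norm x)) \<longlonglongrightarrow> min M (b + 0 * norm x)"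
        using r_nonneg r_less_1 by (intro AE_I2 tendsto_intros LIMSEQ_realpow_zero)
      show "AE x in \<pi>. norm (min M (b + r ^ k * norm x)) \<le> M" for k
        using M b r_nonneg by auto
    qed (use M in auto)
    then have "(\<integral>x. f x \<partial>\<pi>) \<le> (\<integral>x. min M (b + 0 * norm x) \<partial>\<pi>)"
      by (rule LIMSEQ_le_const) (use le2 in auto)
    also have "\<dots> \<le> b" using pi.prob_space by simp
    finally show ?thesis by (simp add: f_def)
  qed
  have "(\<integral>\<^sup>+x. ennreal (norm x) \<partial>\<pi>) \<le> ennreal b"
  proof -
    have "(\<integral>\<^sup>+x. ennreal (norm x) \<partial>\<pi>) = (\<integral>\<^sup>+x. liminf (\<lambda>n. ennreal (min (real n) (norm x))) \<partial>\<pi>)"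
    proof (rule nn_integral_cong)
      fix x :: 'a
      have "(\<lambda>n. ennreal (min (real n) (norm x))) \<longlonglongrightarrow> ennreal (norm x)"
      proof (rule tendsto_eventually)
        show "\<forall>\<^sub>F n in sequentially. ennreal (min (real n) (norm x)) = ennreal (norm x)"
          using eventually_ge_at_top[of "nat \<lceil>norm x\<rceil>"]
          by eventually_elim (metis min_absorb2 real_nat_ceiling_ge of_nat_mono order_trans)
      qed
      then show "ennreal (norm x) = liminf (\<lambda>n. ennreal (min (real n) (norm x)))"
        by (intro lim_imp_Liminf[symmetric]) auto
    qed
    also have "\<dots> \<le> liminf (\<lambda>n. \<integral>\<^sup>+x. ennreal (min (real n) (norm x)) \<partial>\<pi>)"
      by (rule nn_integral_liminf) measurable
    also have "\<dots> \<le> liminf (\<lambda>n::nat. ennreal b)"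
    proof (intro Liminf_mono always_eventually allI)
      fix n
      have "integrable \<pi> (\<lambda>x. min (real n) (norm x))"
        by (rule bounded_integrable_pi[where B="real n"]) auto
      from nn_integral_eq_integral[OF this] bd[of "real n"]
      show "(\<integral>\<^sup>+x. ennreal (min (real n) (norm x)) \<partial>\<pi>) \<le> ennreal b" by (simp add: ennreal_leI)
    qed
    also have "\<dots> = ennreal b" by (simp add: Liminf_const)
    finally show ?thesis .
  qed
  then have "integrable \<pi> norm"
    by (intro integrableI_bounded) (auto intro: le_less_trans)
  then show ?thesis using prob_pi sets_pi by (simp add: P1_def)
qed

text \<open>The Wasserstein distance from the point mass at \<open>x\<close> to
  \<open>\<pi>\<close>, that is, the distance of the start \<open>x\<close> from
  equilibrium.\<close>

definition dev :: "'a \<Rightarrow> real" where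
  "dev x = (\<integral>y. norm (x - y) \<partial>\<pi>)"

lemma integrable_norm_diff_pi: "integrable \<pi> (\<lambda>y. norm (x - y))"
  by (rule lipschitz_integrable[OF pi_P1, where L=1], rule lipschitz_realI)
    (auto simp: norm_minus_commute[of x] intro: order_trans[OF norm_triangle_ineq2])

lemma dev_nonneg: "0 \<le> dev x" by (simp add: dev_def)

lemma dev_le: "dev x \<le> norm x + (\<integral>y. norm y \<partial>\<pi>)"
proof -
  have "dev x \<le> (\<integral>y. norm x + norm y \<partial>\<pi>)" unfolding dev_def
    using integrable_norm_diff_pi P1D(3)[OF pi_P1]
    by (intro integral_mono) (auto intro: norm_triangle_ineq4)
  then show ?thesis using P1D(3)[OF pi_P1] pi.prob_space by simp
qed

text \<open>Applied to \<open>(avg ^^ k) f\<close>, whose Lipschitz constant is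
  \<open>r ^ k * L\<close>, this is geometric convergence to equilibrium.\<close>

lemma lipschitz_minus_mean_le:
  assumes f: "L-lipschitz_on UNIV f"
  shows "\<bar>f x - (\<integral>y. f y \<partial>\<pi>)\<bar> \<le> L * dev x"
proof -
  have "\<bar>\<integral>y. f x - f y \<partial>\<pi>\<bar> \<le> (\<integral>y. \<bar>f x - f y\<bar> \<partial>\<pi>)" by (rule integral_abs_bound)
  also have "\<dots> \<le> (\<integral>y. L * norm (x - y) \<partial>\<pi>)"
    using integrable_norm_diff_pi lipschitz_integrable[OF pi_P1 f] lipschitz_real_abs[OF f]
    by (intro integral_mono) auto
  finally show ?thesis using lipschitz_integrable[OF pi_P1 f] pi.prob_space by (simp add: dev_def)
qed

lemma dev_lipschitz: "1-lipschitz_on UNIV dev"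
proof (rule lipschitz_realI)
  fix x y
  have "dev x - dev y = (\<integral>z. norm (x - z) - norm (y - z) \<partial>\<pi>)"
    using integrable_norm_diff_pi by (simp add: dev_def)
  also have "\<dots> \<le> (\<integral>z. norm (x - y) \<partial>\<pi>)"
    using integrable_norm_diff_pi norm_triangle_ineq2[of "x - z" "y - z" for z]
    by (intro integral_mono) auto
  finally show "dev x - dev y \<le> 1 * norm (x - y)" using pi.prob_space by simp
qed simp

text \<open>Averages contract to the mean, so iterating the one-step bound sums a geometric series of
  variance proxies.\<close>

lemma subgaussian_pi: "subgaussian (C / (4 * (1 - r))) \<pi>"
  unfolding subgaussian_def
proof (intro allI impI)
  fix L and f :: "'a \<Rightarrow> real"
  assume f: "L-lipschitz_on UNIV f" and "bounded (range f)"
  then obtain B where B: "\<And>x. \<bar>f x\<bar> \<le> B" by (auto simp: bounded_iff)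
  have L: "0 \<le> L" using f by (rule lipschitz_on_nonneg)
  define g where "g k = (avg ^^ k) f" for k
  have gL: "(r ^ k * L)-lipschitz_on UNIV (g k)" for k unfolding g_def by (rule avg_pow_lipschitz[OF f])
  have gB: "\<bar>g k x\<bar> \<le> B" for k x unfolding g_def by (rule avg_pow_bounded[OF f B])
  have [measurable]: "g k \<in> borel_measurable borel" for k using gL by (rule lipschitz_borel_measurable)
  have eB: "\<bar>exp (g k x)\<bar> \<le> exp B" for k x using gB[of k x] by (simp add: abs_le_iff)
  have ie: "integrable \<pi> (\<lambda>x. exp (g k x))" for k
    by (rule bounded_integrable_pi[OF _ eB]) measurable
  define E where "E k = (\<integral>x. exp (g k x) \<partial>\<pi>)" for k
  define c where "c = C / 4 * L\<^sup>2"
  have c: "0 \<le> c" using C_pos by (simp add: c_def)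
  have step: "E k \<le> exp (c * r ^ k) * E (Suc k)" for k
  proof -
    have "E k = (\<integral>x. avg (\<lambda>y. exp (g k y)) x \<partial>\<pi>)"
      unfolding E_def by (rule integral_avg_bounded[OF _ eB, symmetric]) measurable
    also have "\<dots> \<le> (\<integral>x. exp (c * r ^ k) * exp (g (Suc k) x) \<partial>\<pi>)"
    proof (rule integral_mono)
      show "integrable \<pi> (\<lambda>x. exp (c * r ^ k) * exp (g (Suc k) x))" using ie by simp
      have pt: "0 \<le> avg (\<lambda>y. exp (g k y)) x \<and> avg (\<lambda>y. exp (g k y)) x \<le> exp (c * r ^ k) * exp (g (Suc k) x)" for x
      proof -
        have "avg (\<lambda>y. exp (g k y)) x \<le> exp (g (Suc k) x + C / 4 * (r ^ k * L)\<^sup>2)"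
          using subgaussian_integral(2)[OF P_P1 subgaussian_P gL, of x k] by (simp add: avg_def g_def)
        also have "C / 4 * (r ^ k * L)\<^sup>2 = c * (r ^ k)\<^sup>2" by (simp add: c_def power_mult_distrib)
        \<comment> \<open>Weakening the square to a single power makes the variance proxies sum to
          at most \<open>c / (1 - r)\<close>.\<close>
        also have "(r ^ k)\<^sup>2 \<le> r ^ k"
          using r_nonneg r_less_1 by (simp add: power2_eq_square mult_left_le power_le_one)
        finally show ?thesis using c by (simp add: exp_add[symmetric] avg_def add.commute mult_left_mono)
      qed
      then show "avg (\<lambda>y. exp (g k y)) x \<le> exp (c * r ^ k) * exp (g (Suc k) x)" for x by blast
      show "integrable \<pi> (avg (\<lambda>y. exp (g k y)))"
      proof (rule Bochner_Integration.integrable_bound)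
        show "integrable \<pi> (\<lambda>x. exp (c * r ^ k) * exp (g (Suc k) x))" using ie by simp
        show "AE x in \<pi>. norm (avg (\<lambda>y. exp (g k y)) x) \<le> norm (exp (c * r ^ k) * exp (g (Suc k) x))"
          using pt by (intro AE_I2) (simp add: abs_of_nonneg)
        have "(\<lambda>x. \<integral>y. exp (g k y) \<partial>P x) \<in> borel_measurable borel"
          by (rule measurable_compose[OF kernel_measurable_subprob integral_measurable_subprob_algebra]) measurable
        then show "avg (\<lambda>y. exp (g k y)) \<in> borel_measurable \<pi>"
          by (simp add: avg_def[abs_def])
      qed
    qed
    finally show ?thesis by (simp add: E_def)
  qed
  have "E 0 \<le> exp (c * (\<Sum>i<k. r ^ i)) * E k" for k
  proof (induction k)
    case (Suc k)
    have "E 0 \<le> exp (c * (\<Sum>i<k. r ^ i)) * E k" by fact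
    also have "\<dots> \<le> exp (c * (\<Sum>i<k. r ^ i)) * (exp (c * r ^ k) * E (Suc k))"
      using step by (intro mult_left_mono) auto
    finally show ?case by (simp add: distrib_left exp_add mult_ac)
  qed simp
  also have "exp (c * (\<Sum>i<k. r ^ i)) * E k \<le> exp (c / (1 - r)) * E k" for k
    using geometric_sum_le[of k] c by (intro mult_right_mono) (auto simp: E_def mult_left_mono divide_inverse)
  finally have le: "E 0 \<le> exp (c / (1 - r)) * E k" for k by this
  have "E \<longlonglongrightarrow> (\<integral>x. exp (\<integral>y. f y \<partial>\<pi>) \<partial>\<pi>)"
    unfolding E_def
  proof (rule integral_dominated_convergence[where w="\<lambda>_. exp B"])
    show "AE x in \<pi>. (\<lambda>k. exp (g k x)) \<longlonglongrightarrow> exp (\<integral>y. f y \<partial>\<pi>)"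
    proof (intro AE_I2 tendsto_exp)
      fix x
      have "(\<lambda>k. g k x - (\<integral>y. f y \<partial>\<pi>)) \<longlonglongrightarrow> 0"
      proof (rule Lim_null_comparison)
        show "\<forall>\<^sub>F k in sequentially. norm (g k x - (\<integral>y. f y \<partial>\<pi>)) \<le> r ^ k * (L * dev x)"
          using lipschitz_minus_mean_le[OF gL, of _ x] integral_avg_pow_bounded[OF f B]
          by (intro always_eventually) (auto simp: g_def mult.assoc)
        show "(\<lambda>k. r ^ k * (L * dev x)) \<longlonglongrightarrow> 0"
          using r_nonneg r_less_1 by (intro tendsto_mult_left_zero LIMSEQ_realpow_zero)
      qed
      then show "(\<lambda>k. g k x) \<longlonglongrightarrow> (\<integral>y. f y \<partial>\<pi>)" by (simp add: LIM_zero_iff)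
    qed
    show "AE x in \<pi>. norm (exp (g k x)) \<le> exp B" for k using eB by simp
  qed simp_all
  then have "(\<lambda>k. exp (c / (1 - r)) * E k) \<longlonglongrightarrow> exp (c / (1 - r)) * exp (\<integral>y. f y \<partial>\<pi>)"
    using pi.prob_space by (intro tendsto_mult_left) simp
  then have "E 0 \<le> exp (c / (1 - r)) * exp (\<integral>y. f y \<partial>\<pi>)"
    by (rule LIMSEQ_le_const) (use le in auto)
  then show "(\<integral>x. exp (f x) \<partial>\<pi>) \<le> exp ((\<integral>x. f x \<partial>\<pi>) + C / (4 * (1 - r)) * L\<^sup>2)"
    by (simp add: E_def g_def c_def exp_add[symmetric] add.commute)
qed

end

section \<open>Kantorovich duality for empirical measures\<close>

text \<open>Continuity for the product topology: it supplies the maximiser of the entropic dual and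
  the measurability of path functionals.\<close>

lemma continuous_on_coordinate_lipschitz:
  fixes G :: "('i \<Rightarrow> 'b::real_normed_vector) \<Rightarrow> real"
  assumes G: "\<And>f f'. \<bar>G f - G f'\<bar> \<le> (\<Sum>i\<in>I. L i * norm (f i - f' i))"
  shows "continuous_on UNIV G"
  unfolding continuous_on_def
proof (intro ballI)
  fix f :: "'i \<Rightarrow> 'b"
  have "continuous_on UNIV (\<lambda>f'. \<Sum>i\<in>I. L i * norm (f' i - f i))"
    by (intro continuous_intros continuous_on_product_coordinates)
  then have lim: "((\<lambda>f'. \<Sum>i\<in>I. L i * norm (f' i - f i)) \<longlongrightarrow> 0) (at f within UNIV)"
    unfolding continuous_on_def by (auto dest!: spec[of _ f])
  have "((\<lambda>f'. G f' - G f) \<longlongrightarrow> 0) (at f within UNIV)"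
    by (rule Lim_null_comparison[OF _ lim]) (simp add: G)
  then show "(G \<longlongrightarrow> G f) (at f within UNIV)" by (simp add: LIM_zero_iff)
qed

text \<open>The coupling is built on pairs of an index and a point and then pushed forward by
  \<open>T\<close>, so coinciding points among the \<open>x i\<close> cause no trouble.
  \<open>col\<close> gives each index mass \<open>1 / n\<close>, hence the empirical marginal;
  \<open>row\<close> gives the marginal \<open>\<pi>\<close>.\<close>

lemma W1_empirical_le_density:
  fixes x :: "nat \<Rightarrow> 'a::euclidean_space" and g :: "nat \<Rightarrow> 'a \<Rightarrow> real"
  assumes n: "1 \<le> n" and \<pi>: "\<pi> \<in> P1"
    and gm: "\<And>i. g i \<in> borel_measurable borel" and g0: "\<And>i y. 0 \<le> g i y"
    and row: "\<And>y. (\<Sum>i=1..n. g i y) = real n"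
    and col: "\<And>i. i \<in> {1..n} \<Longrightarrow> (\<integral>\<^sup>+y. ennreal (g i y) \<partial>\<pi>) = 1"
  shows "W1 (empirical_measure n x) \<pi> \<le> (\<Sum>i=1..n. ennreal (1 / n) * (\<integral>\<^sup>+y. ennreal (g i y) * ennreal (norm (x i - y)) \<partial>\<pi>))"
proof -
  interpret prob_space \<pi> using \<pi> by (simp add: P1D)
  note sp = P1D[OF \<pi>]
  have [measurable_cong]: "sets \<pi> = sets borel" using sp by simp
  let ?U = "uniform_count_measure {1..n}"
  let ?D = "density (?U \<Otimes>\<^sub>M \<pi>) (\<lambda>z. ennreal (g (fst z) (snd z)))"
  define T where "T = (\<lambda>z :: nat \<times> 'a. (x (fst z), snd z))"
  define Q where "Q = distr ?D (borel \<Otimes>\<^sub>M borel) T"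
  have sU: "sets (?U \<Otimes>\<^sub>M \<pi>) = sets (count_space {1..n} \<Otimes>\<^sub>M borel)"
    by (intro sets_pair_measure_cong sp) (simp add: sets_uniform_count_measure)
  have meas: "h \<in> ?U \<Otimes>\<^sub>M \<pi> \<rightarrow>\<^sub>M K" if "\<And>i. (\<lambda>y. h (i, y)) \<in> borel \<rightarrow>\<^sub>M K" for h :: "nat \<times> 'a \<Rightarrow> 'c" and K
    unfolding measurable_cong_sets[OF sU refl]
    by (rule measurable_pair_measure_countable1) (use that in auto)
  have gM[measurable]: "(\<lambda>z. ennreal (g (fst z) (snd z))) \<in> borel_measurable (?U \<Otimes>\<^sub>M \<pi>)"
    using gm by (intro meas) simp
  have TM[measurable]: "T \<in> ?U \<Otimes>\<^sub>M \<pi> \<rightarrow>\<^sub>M borel \<Otimes>\<^sub>M borel"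
    by (rule meas) (simp add: T_def)
  have int: "(\<integral>\<^sup>+z. h z \<partial>Q) = (\<Sum>i=1..n. ennreal (1 / n) * (\<integral>\<^sup>+y. ennreal (g i y) * h (x i, y) \<partial>\<pi>))"
    if [measurable]: "h \<in> borel_measurable (borel \<Otimes>\<^sub>M borel)" for h
  proof -
    have [measurable]: "(\<lambda>z. h (T z)) \<in> borel_measurable (?U \<Otimes>\<^sub>M \<pi>)" by measurable
    have "(\<integral>\<^sup>+z. h z \<partial>Q) = (\<integral>\<^sup>+z. ennreal (g (fst z) (snd z)) * h (T z) \<partial>(?U \<Otimes>\<^sub>M \<pi>))"
    proof -
      have "T \<in> ?D \<rightarrow>\<^sub>M borel \<Otimes>\<^sub>M borel" using TM by simp
      from nn_integral_distr[OF this, of h]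
      have "(\<integral>\<^sup>+z. h z \<partial>Q) = (\<integral>\<^sup>+z. h (T z) \<partial>?D)" unfolding Q_def using that by simp
      also have "\<dots> = (\<integral>\<^sup>+z. ennreal (g (fst z) (snd z)) * h (T z) \<partial>(?U \<Otimes>\<^sub>M \<pi>))"
        by (rule nn_integral_density) measurable
      finally show ?thesis .
    qed
    also have "\<dots> = (\<integral>\<^sup>+i. \<integral>\<^sup>+y. ennreal (g i y) * h (x i, y) \<partial>\<pi> \<partial>?U)"
    proof -
      have "(\<lambda>z. ennreal (g (fst z) (snd z)) * h (T z)) \<in> borel_measurable (?U \<Otimes>\<^sub>M \<pi>)" by measurable
      from nn_integral_fst[OF this] show ?thesis by (simp add: T_def)
    qed
    also have "\<dots> = (\<Sum>i=1..n. ennreal (1 / n) * (\<integral>\<^sup>+y. ennreal (g i y) * h (x i, y) \<partial>\<pi>))"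
      unfolding uniform_count_measure_def by (subst nn_integral_point_measure_finite) auto
    finally show ?thesis .
  qed
  have E: "sets (empirical_measure n x) = sets borel" "space (empirical_measure n x) = UNIV"
    by (auto simp: empirical_measure_def)
  have sQ: "sets Q = sets (borel \<Otimes>\<^sub>M borel)" by (simp add: Q_def)
  have spQ: "space Q = UNIV" by (simp add: Q_def space_pair_measure)
  have em: "emeasure Q A = (\<Sum>i=1..n. ennreal (1 / n) * (\<integral>\<^sup>+y. ennreal (g i y) * indicator A (x i, y) \<partial>\<pi>))"
    if "A \<in> sets (borel \<Otimes>\<^sub>M borel)" for A
    using int[of "indicator A"] that by (simp add: nn_integral_indicator sQ)
  have [measurable]: "g i \<in> borel_measurable borel" for i by (rule gm)
  have rowe: "(\<Sum>i=1..n. ennreal (g i y)) = ennreal (real n)" for y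
    using row[of y] g0 by (subst sum_ennreal) auto
  have n1: "ennreal (1 / real n) * ennreal (real n) = 1"
    using n by (subst ennreal_mult[symmetric]) auto
  have Q1: "distr Q (empirical_measure n x) fst = empirical_measure n x"
  proof (rule measure_eqI)
    fix A assume "A \<in> sets (distr Q (empirical_measure n x) fst)"
    then have A[measurable]: "A \<in> sets borel" using E by simp
    have fm: "fst \<in> Q \<rightarrow>\<^sub>M empirical_measure n x"
      unfolding measurable_cong_sets[OF sQ E(1)] by simp
    have "emeasure (distr Q (empirical_measure n x) fst) A = emeasure Q (A \<times> UNIV)"
      using A E fm by (subst emeasure_distr) (auto simp: spQ intro!: arg_cong[where f="emeasure Q"])
    also have "\<dots> = (\<Sum>i=1..n. ennreal (1 / n) * indicator A (x i))"
    proof (subst em)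
      show "(\<Sum>i=1..n. ennreal (1 / n) * (\<integral>\<^sup>+y. ennreal (g i y) * indicator (A \<times> UNIV) (x i, y) \<partial>\<pi>)) =
        (\<Sum>i=1..n. ennreal (1 / n) * indicator A (x i))"
      proof (rule sum.cong[OF refl])
        fix i assume "i \<in> {1..n}"
        then have "(\<integral>\<^sup>+y. ennreal (g i y) * indicator (A \<times> UNIV) (x i, y) \<partial>\<pi>) = indicator A (x i)"
          using col[of i] by (auto split: split_indicator)
        then show "ennreal (1 / n) * (\<integral>\<^sup>+y. ennreal (g i y) * indicator (A \<times> UNIV) (x i, y) \<partial>\<pi>) =
            ennreal (1 / n) * indicator A (x i)" by simp
      qed
    qed simp
    also have "\<dots> = emeasure (empirical_measure n x) A"
      using emeasure_empirical_measure[OF n A, of x] by (simp add: sum_distrib_left)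
    finally show "emeasure (distr Q (empirical_measure n x) fst) A = emeasure (empirical_measure n x) A" .
  qed (simp add: E)
  have Q2: "distr Q \<pi> snd = \<pi>"
  proof (rule measure_eqI)
    fix A assume "A \<in> sets (distr Q \<pi> snd)"
    then have A[measurable]: "A \<in> sets borel" using sp by simp
    have fm: "snd \<in> Q \<rightarrow>\<^sub>M \<pi>"
      unfolding measurable_cong_sets[OF sQ sp(2)] by simp
    have "emeasure (distr Q \<pi> snd) A = emeasure Q (UNIV \<times> A)"
      using A fm sp by (subst emeasure_distr) (auto simp: spQ intro!: arg_cong[where f="emeasure Q"])
    also have "\<dots> = (\<Sum>i=1..n. ennreal (1 / n) * (\<integral>\<^sup>+y. ennreal (g i y) * indicator A y \<partial>\<pi>))"
      by (subst em) (auto simp: indicator_def intro!: sum.cong)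
    also have "\<dots> = (\<integral>\<^sup>+y. (\<Sum>i=1..n. ennreal (1 / n) * (ennreal (g i y) * indicator A y)) \<partial>\<pi>)"
      by (subst nn_integral_sum) (auto simp: nn_integral_cmult)
    also have "\<dots> = (\<integral>\<^sup>+y. indicator A y \<partial>\<pi>)"
    proof (rule nn_integral_cong)
      fix y
      have "(\<Sum>i=1..n. ennreal (1 / n) * (ennreal (g i y) * indicator A y)) = ennreal (1 / n) * (\<Sum>i=1..n. ennreal (g i y)) * indicator A y"
        by (simp add: sum_distrib_left sum_distrib_right mult.assoc)
      then show "(\<Sum>i=1..n. ennreal (1 / n) * (ennreal (g i y) * indicator A y)) = indicator A y"
        by (simp only: rowe n1 mult_1_left)
    qed
    also have "\<dots> = emeasure \<pi> A" using A sp by simp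
    finally show "emeasure (distr Q \<pi> snd) A = emeasure \<pi> A" .
  qed simp
  have "emeasure Q (space Q) = 1"
  proof -
    have "emeasure Q (space Q) = emeasure (distr Q \<pi> snd) (space \<pi>)"
      using sp sQ by (subst emeasure_distr) (auto simp: spQ measurable_cong_sets[OF sQ sp(2)])
    then show ?thesis by (simp add: Q2 emeasure_space_1)
  qed
  then have "prob_space Q" by (rule prob_spaceI)
  then have "Q \<in> couplings (empirical_measure n x) \<pi>"
    using Q1 Q2 E sp by (auto simp: couplings_def sQ intro!: sets_pair_measure_cong)
  then have "W1 (empirical_measure n x) \<pi> \<le> (\<integral>\<^sup>+z. ennreal (norm (fst z - snd z)) \<partial>Q)"
    unfolding W1_def by (rule INF_lower)
  then show ?thesis by (subst (asm) int) auto
qed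

lemma ln_sum_exp_le:
  fixes a b :: "'i \<Rightarrow> real"
  assumes "finite I" "I \<noteq> {}" "\<And>i. i \<in> I \<Longrightarrow> a i \<le> b i + \<delta>"
  shows "ln (\<Sum>i\<in>I. exp (a i)) \<le> ln (\<Sum>i\<in>I. exp (b i)) + \<delta>"
proof -
  have pos: "0 < (\<Sum>i\<in>I. exp (a i))" "0 < (\<Sum>i\<in>I. exp (b i))"
    using assms by (auto intro!: sum_pos)
  have "(\<Sum>i\<in>I. exp (a i)) \<le> (\<Sum>i\<in>I. exp (b i) * exp \<delta>)"
    using assms by (intro sum_mono) (auto simp: exp_add[symmetric])
  then have "(\<Sum>i\<in>I. exp (a i)) \<le> (\<Sum>i\<in>I. exp (b i)) * exp \<delta>" by (simp add: sum_distrib_right)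
  then have "ln (\<Sum>i\<in>I. exp (a i)) \<le> ln ((\<Sum>i\<in>I. exp (b i)) * exp \<delta>)"
    using pos by (subst ln_le_cancel_iff) auto
  then show ?thesis using pos by (simp add: ln_mult)
qed

text \<open>A first-order condition in finite-difference form: divide by \<open>k\<close> and let
  \<open>k\<close> tend to 0 from either side. It replaces differentiation under the
  integral.\<close>

lemma eq_1_if_exp_minus_1_bound:
  fixes A :: real
  assumes "\<And>k. k \<le> (exp k - 1) * A"
  shows "A = 1"
proof (rule antisym)
  have d: "((\<lambda>k. (exp k - 1) / k) \<longlongrightarrow> 1) (at (0::real))"
    using DERIV_exp[of "0::real"] by (simp add: DERIV_def)
  have l: "((\<lambda>k. (exp k - 1) / k * A) \<longlongrightarrow> 1 * A) (at (0::real))" by (intro tendsto_intros d)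
  show "1 \<le> A"
  proof (rule tendsto_lowerbound)
    show "((\<lambda>k. (exp k - 1) / k * A) \<longlongrightarrow> A) (at_right (0::real))"
      using l by (auto intro: filterlim_mono[OF _ order_refl at_le])
    show "\<forall>\<^sub>F k in at_right (0::real). 1 \<le> (exp k - 1) / k * A"
      using eventually_at_right_less[of 0] by eventually_elim (use assms in \<open>simp add: field_simps\<close>)
  qed simp
  show "A \<le> 1"
  proof (rule tendsto_upperbound)
    show "((\<lambda>k. (exp k - 1) / k * A) \<longlongrightarrow> A) (at_left (0::real))"
      using l by (auto intro: filterlim_mono[OF _ order_refl at_le])
    show "\<forall>\<^sub>F k in at_left (0::real). (exp k - 1) / k * A \<le> 1"
      unfolding eventually_at_filter
      by (intro always_eventually) (use assms in \<open>auto simp: field_simps\<close>)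
  qed simp
qed

text \<open>The Kantorovich dual value. For \<open>n >= 1\<close> constants cancel, so
  \<open>f 0 = 0\<close> is a normalisation. It yields the bound \<open>norm y\<close> for
  \<open>f y\<close>, and it makes the interpolant above the top level vanish in the multiscale
  scheme.\<close>

definition kr_dual :: "'a::euclidean_space measure \<Rightarrow> nat \<Rightarrow> (nat \<Rightarrow> 'a) \<Rightarrow> real" where
  "kr_dual \<pi> n x = (SUP f\<in>{f. 1-lipschitz_on UNIV f \<and> f 0 = 0}. (\<Sum>i=1..n. f (x i)) / n - (\<integral>y. f y \<partial>\<pi>))"

lemma kr_dual_bdd:
  fixes x :: "nat \<Rightarrow> 'a::euclidean_space"
  assumes \<pi>: "\<pi> \<in> P1"
  shows "bdd_above ((\<lambda>f. (\<Sum>i=1..n. f (x i)) / n - (\<integral>y. f y \<partial>\<pi>)) ` {f :: 'a \<Rightarrow> real. 1-lipschitz_on UNIV f \<and> f 0 = 0})"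
proof (rule bdd_aboveI2)
  fix f :: "'a \<Rightarrow> real" assume "f \<in> {f. 1-lipschitz_on UNIV f \<and> f 0 = 0}"
  then have f: "1-lipschitz_on UNIV f" "f 0 = 0" by auto
  have b: "\<bar>f y\<bar> \<le> norm y" for y using lipschitz_real_abs[OF f(1), of y 0] f(2) by simp
  have "(\<Sum>i=1..n. f (x i)) \<le> (\<Sum>i=1..n. norm (x i))"
    using b by (intro sum_mono) (auto simp: abs_le_iff)
  moreover have "- (\<integral>y. norm y \<partial>\<pi>) \<le> (\<integral>y. f y \<partial>\<pi>)"
  proof -
    have "(\<integral>y. - norm y \<partial>\<pi>) \<le> (\<integral>y. f y \<partial>\<pi>)"
      using b lipschitz_integrable[OF \<pi> f(1)] P1D(3)[OF \<pi>] by (intro integral_mono) (auto simp: abs_le_iff minus_le_iff)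
    then show ?thesis by simp
  qed
  ultimately show "(\<Sum>i=1..n. f (x i)) / n - (\<integral>y. f y \<partial>\<pi>) \<le> (\<Sum>i=1..n. norm (x i)) / n + (\<integral>y. norm y \<partial>\<pi>)"
    by (intro diff_le_eq[THEN iffD2]) (simp add: divide_right_mono add.assoc add_increasing2 add_mono)
qed

lemma kr_dual_upper:
  assumes \<pi>: "\<pi> \<in> P1" and f: "1-lipschitz_on UNIV f" and n: "1 \<le> n"
  shows "(\<Sum>i=1..n. f (x i)) / n - (\<integral>y. f y \<partial>\<pi>) \<le> kr_dual \<pi> n x"
proof -
  interpret prob_space \<pi> using \<pi> by (simp add: P1D)
  define g where "g = (\<lambda>y. f y - f 0)"
  have g: "1-lipschitz_on UNIV g" "g 0 = 0" using f by (auto simp: g_def lipschitz_on_def dist_real_def)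
  have "(\<Sum>i=1..n. f (x i)) / n - (\<integral>y. f y \<partial>\<pi>) = (\<Sum>i=1..n. g (x i)) / n - (\<integral>y. g y \<partial>\<pi>)"
    using n lipschitz_integrable[OF \<pi> f] by (simp add: g_def sum_subtractf prob_space field_simps)
  also have "\<dots> \<le> kr_dual \<pi> n x"
    unfolding kr_dual_def using g by (intro cSUP_upper kr_dual_bdd[OF \<pi>]) auto
  finally show ?thesis .
qed

lemma kr_dual_least:
  assumes "\<And>f. 1-lipschitz_on UNIV f \<Longrightarrow> f 0 = 0 \<Longrightarrow> (\<Sum>i=1..n. f (x i)) / n - (\<integral>y. f y \<partial>\<pi>) \<le> b"
  shows "kr_dual \<pi> n x \<le> b"
  unfolding kr_dual_def
proof (rule cSUP_least)
  have "1-lipschitz_on UNIV (\<lambda>_::'a. 0::real)" by (simp add: lipschitz_on_def)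
  then show "{f::'a \<Rightarrow> real. 1-lipschitz_on UNIV f \<and> f 0 = 0} \<noteq> {}" by auto
qed (use assms in auto)

lemma kr_dual_nonneg:
  assumes "\<pi> \<in> P1" "1 \<le> n"
  shows "0 \<le> kr_dual \<pi> n x"
  using kr_dual_upper[OF assms(1) _ assms(2), of "\<lambda>_. 0" x] by (simp add: lipschitz_on_def)

text \<open>A supremum of functionals with a common modulus keeps that modulus. The weight
  \<open>1 / n\<close> per coordinate is the source of the variance proxy of order
  \<open>1 / n\<close>.\<close>

lemma kr_dual_lipschitz:
  assumes \<pi>: "\<pi> \<in> P1" and n: "1 \<le> n"
  shows "\<bar>kr_dual \<pi> n x - kr_dual \<pi> n y\<bar> \<le> (\<Sum>i=1..n. 1 / n * norm (x i - y i))"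
proof -
  have "kr_dual \<pi> n x \<le> kr_dual \<pi> n y + (\<Sum>i=1..n. 1 / n * norm (x i - y i))" for x y
  proof (rule kr_dual_least)
    fix f :: "'a \<Rightarrow> real" assume f: "1-lipschitz_on UNIV f"
    have "(\<Sum>i=1..n. f (x i)) / n \<le> (\<Sum>i=1..n. f (y i) + norm (x i - y i)) / n"
      using lipschitz_real_abs[OF f] by (intro divide_right_mono sum_mono) (auto simp: abs_le_iff algebra_simps)
    also have "\<dots> = (\<Sum>i=1..n. f (y i)) / n + (\<Sum>i=1..n. 1 / n * norm (x i - y i))"
      by (simp add: sum.distrib add_divide_distrib sum_divide_distrib)
    finally show "(\<Sum>i=1..n. f (x i)) / n - (\<integral>y. f y \<partial>\<pi>) \<le> kr_dual \<pi> n y + (\<Sum>i=1..n. 1 / n * norm (x i - y i))"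
      using kr_dual_upper[OF \<pi> f n, of y] by simp
  qed
  from this[of x y] this[of y x] show ?thesis by (simp add: abs_le_iff norm_minus_commute)
qed

text \<open>Kantorovich duality for an empirical first marginal by entropic regularisation. The dual
  functional \<open>G\<close> below has a maximiser \<open>f\<close>; stationarity of \<open>G\<close> at \<open>f\<close> says exactly that the Gibbs
  weights \<open>p i y\<close> are the density of a coupling, whose cost exceeds the dual value by at most
  \<open>\<epsilon> ln n\<close>.\<close>

lemma W1_empirical_le_kr_dual_eps:
  fixes x :: "nat \<Rightarrow> 'a::euclidean_space"
  assumes n: "1 \<le> n" and \<pi>: "\<pi> \<in> P1" and \<epsilon>: "0 < \<epsilon>"
  shows "W1 (empirical_measure n x) \<pi> \<le> ennreal (kr_dual \<pi> n x + \<epsilon> * ln n)"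
proof -
  interpret prob_space \<pi> using \<pi> by (simp add: P1D)
  define I where "I = {1..n}"
  have I: "finite I" "I \<noteq> {}" "card I = n" using n by (auto simp: I_def)
  define c where "c i y = norm (x i - y)" for i y
  \<comment> \<open>\<open>\<epsilon> * lZ f y\<close> is a soft maximum of
    \<open>f i - c i y\<close> over \<open>i\<close>, lying above the true maximum, which appears
    below as \<open>\<phi> y\<close>.\<close>
  define lZ where "lZ f y = ln (\<Sum>i\<in>I. exp ((f i - c i y) / \<epsilon>))" for f y
  define G where "G f = (\<Sum>i\<in>I. f i) / n - \<epsilon> * (\<integral>y. lZ f y \<partial>\<pi>)" for f
  have cL: "1-lipschitz_on UNIV (c i)" for i
    unfolding c_def
    by (rule lipschitz_realI) (auto simp: norm_minus_commute[of "x i"] intro: order_trans[OF norm_triangle_ineq2])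
  have c0: "0 \<le> c i y" for i y by (simp add: c_def)
  have lZL: "(1 / \<epsilon>)-lipschitz_on UNIV (lZ f)" for f
  proof (rule lipschitz_realI)
    fix y z
    have "lZ f y \<le> lZ f z + 1 / \<epsilon> * norm (y - z)"
      unfolding lZ_def
    proof (rule ln_sum_exp_le[OF I(1,2)])
      fix i
      have "f i - c i y \<le> f i - c i z + norm (y - z)"
        using lipschitz_real_abs[OF cL, of i y z] by (simp add: abs_le_iff)
      then have "(f i - c i y) / \<epsilon> \<le> (f i - c i z + norm (y - z)) / \<epsilon>"
        using \<epsilon> by (intro divide_right_mono) auto
      then show "(f i - c i y) / \<epsilon> \<le> (f i - c i z) / \<epsilon> + 1 / \<epsilon> * norm (y - z)"
        by (simp add: add_divide_distrib)
    qed
    then show "lZ f y - lZ f z \<le> 1 / \<epsilon> * norm (y - z)" by simp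
  qed (use \<epsilon> in simp)
  have lZi: "integrable \<pi> (lZ f)" for f by (rule lipschitz_integrable[OF \<pi> lZL])
  have Gdiff: "\<bar>G f - G f'\<bar> \<le> (\<Sum>i\<in>I. 2 * norm (f i - f' i))" for f f'
  proof -
    have "G f - G f' \<le> (\<Sum>i\<in>I. 2 * norm (f i - f' i))" for f f'
    proof -
      define \<delta> where "\<delta> = (\<Sum>i\<in>I. norm (f i - f' i))"
      have \<delta>: "\<bar>f i - f' i\<bar> \<le> \<delta>" if "i \<in> I" for i
        unfolding \<delta>_def real_norm_def using that I by (intro member_le_sum) auto
      have "lZ f' y \<le> lZ f y + \<delta> / \<epsilon>" for y
        unfolding lZ_def
      proof (rule ln_sum_exp_le[OF I(1,2)])
        fix i assume "i \<in> I"
        then have "(f' i - c i y) / \<epsilon> \<le> (f i - c i y + \<delta>) / \<epsilon>"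
          using \<delta>[of i] \<epsilon> by (intro divide_right_mono) auto
        then show "(f' i - c i y) / \<epsilon> \<le> (f i - c i y) / \<epsilon> + \<delta> / \<epsilon>" by (simp add: add_divide_distrib)
      qed
      then have "(\<integral>y. lZ f' y \<partial>\<pi>) \<le> (\<integral>y. lZ f y + \<delta> / \<epsilon> \<partial>\<pi>)"
        using lZi by (intro integral_mono) auto
      also have "\<dots> = (\<integral>y. lZ f y \<partial>\<pi>) + \<delta> / \<epsilon>" using lZi by (simp add: prob_space)
      finally have "\<epsilon> * (\<integral>y. lZ f' y \<partial>\<pi>) \<le> \<epsilon> * (\<integral>y. lZ f y \<partial>\<pi>) + \<delta>"
        using \<epsilon> by (simp add: field_simps)
      moreover have "(\<Sum>i\<in>I. f i) / n \<le> (\<Sum>i\<in>I. f' i) / n + \<delta>"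
      proof -
        have "(\<Sum>i\<in>I. f i) - (\<Sum>i\<in>I. f' i) \<le> \<delta>"
          unfolding \<delta>_def sum_subtractf[symmetric] by (intro sum_mono) auto
        moreover have "0 \<le> \<delta>" by (simp add: \<delta>_def sum_nonneg)
        then have "\<delta> \<le> \<delta> * n" using n by (simp add: mult_le_cancel_left1)
        ultimately show ?thesis using n by (simp add: field_simps)
      qed
      moreover have "(\<Sum>i\<in>I. 2 * norm (f i - f' i)) = 2 * \<delta>" by (simp add: \<delta>_def sum_distrib_left)
      ultimately show ?thesis by (simp add: G_def)
    qed
    from this[of f f'] this[of f' f] show ?thesis
      by (simp add: abs_le_iff abs_minus_commute)
  qed
  have Gcont: "continuous_on UNIV G" by (rule continuous_on_coordinate_lipschitz[OF Gdiff])
  define cm where "cm = (\<Sum>i\<in>I. \<integral>y. c i y \<partial>\<pi>)"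
  have cm: "(\<integral>y. c i y \<partial>\<pi>) \<le> cm" if "i \<in> I" for i
    unfolding cm_def using that I c0 by (intro member_le_sum) auto
  have lZ_ge: "(f i - c i y) / \<epsilon> \<le> lZ f y" if "i \<in> I" for f i y
  proof -
    have "exp ((f i - c i y) / \<epsilon>) \<le> (\<Sum>i\<in>I. exp ((f i - c i y) / \<epsilon>))"
      using that I by (intro member_le_sum) auto
    then have "ln (exp ((f i - c i y) / \<epsilon>)) \<le> lZ f y"
      unfolding lZ_def using that I by (subst ln_le_cancel_iff) (auto intro!: sum_pos)
    then show ?thesis by simp
  qed
  \<comment> \<open>Coercivity: \<open>G\<close> falls linearly in the spread of \<open>f\<close>
    over \<open>I\<close>. Together with the shift invariance \<open>Gshift\<close> this confines
    the search for a maximiser to a compact box.\<close>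
  have G_le: "G f \<le> - (f j - f k) / n + cm" if j: "j \<in> I" and k: "k \<in> I" and max: "\<And>i. i \<in> I \<Longrightarrow> f i \<le> f j" for f j k
  proof -
    have "(\<integral>y. (f j - c j y) / \<epsilon> \<partial>\<pi>) \<le> (\<integral>y. lZ f y \<partial>\<pi>)"
      using lZi lZ_ge[OF j] lipschitz_integrable[OF \<pi> cL] by (intro integral_mono) auto
    then have "f j - (\<integral>y. c j y \<partial>\<pi>) \<le> \<epsilon> * (\<integral>y. lZ f y \<partial>\<pi>)"
      using \<epsilon> lipschitz_integrable[OF \<pi> cL] by (simp add: prob_space field_simps)
    moreover have "(\<Sum>i\<in>I. f i) / n \<le> f j - (f j - f k) / n"
    proof -
      have "(\<Sum>i\<in>I. f i) = f k + (\<Sum>i\<in>I-{k}. f i)" using k I by (simp add: sum.remove)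
      also have "(\<Sum>i\<in>I-{k}. f i) \<le> of_nat (card (I - {k})) * f j"
        using max by (intro sum_bounded_above) auto
      also have "card (I - {k}) = n - 1" using I k by simp
      finally show ?thesis using n by (simp add: field_simps of_nat_diff)
    qed
    ultimately show ?thesis using cm[OF j] unfolding G_def minus_divide_left[symmetric] by linarith
  qed
  have G0: "- \<epsilon> * ln n \<le> G (\<lambda>_. 0)"
  proof -
    have "lZ (\<lambda>_. 0) y \<le> ln n" for y
    proof -
      have "(\<Sum>i\<in>I. exp ((0 - c i y) / \<epsilon>)) \<le> (\<Sum>i\<in>I. 1)"
        using \<epsilon> c0 by (intro sum_mono) (auto simp: divide_le_0_iff)
      then show ?thesis unfolding lZ_def using I by (subst ln_le_cancel_iff) (auto intro!: sum_pos)
    qed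
    then have "(\<integral>y. lZ (\<lambda>_. 0) y \<partial>\<pi>) \<le> (\<integral>y. ln n \<partial>\<pi>)" using lZi by (intro integral_mono) auto
    then show ?thesis using \<epsilon> by (simp add: G_def prob_space)
  qed
  have Gshift: "G (\<lambda>i. f i - m) = G f" for f m
  proof -
    have "lZ (\<lambda>i. f i - m) y = lZ f y - m / \<epsilon>" for y
    proof -
      have "(\<Sum>i\<in>I. exp ((f i - m - c i y) / \<epsilon>)) = (\<Sum>i\<in>I. exp ((f i - c i y) / \<epsilon>)) * exp (- (m / \<epsilon>))"
        unfolding sum_distrib_right exp_add[symmetric] by (simp add: diff_divide_distrib add_divide_distrib algebra_simps)
      moreover have "0 < (\<Sum>i\<in>I. exp ((f i - c i y) / \<epsilon>))" using I by (intro sum_pos) auto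
      ultimately show ?thesis by (simp add: lZ_def ln_mult)
    qed
    then have "(\<integral>y. lZ (\<lambda>i. f i - m) y \<partial>\<pi>) = (\<integral>y. lZ f y \<partial>\<pi>) - m / \<epsilon>"
      using lZi by (simp add: prob_space)
    then show ?thesis using n I \<epsilon>
      by (simp add: G_def sum_subtractf diff_divide_distrib right_diff_distrib)
  qed
  \<comment> \<open>The spread at which the bound \<open>G_le\<close> drops to
    \<open>- \<epsilon> * ln n\<close>, a value that \<open>G0\<close> guarantees at the zero
    function.\<close>
  define B where "B = n * (cm + \<epsilon> * ln n)"
  have B0: "0 \<le> B" using n \<epsilon> c0 by (auto simp: B_def cm_def intro!: mult_nonneg_nonneg add_nonneg_nonneg sum_nonneg)
  define S where "S = (\<Pi>\<^sub>E i\<in>UNIV. if i \<in> I then {0..B} else {0::real})"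
  have "compactin (product_topology (\<lambda>_. euclidean) UNIV) S"
    unfolding S_def compactin_PiE by (auto simp: compactin_euclidean_iff)
  then have "compact S" by (simp add: euclidean_product_topology compactin_euclidean_iff)
  moreover have "(\<lambda>_. 0) \<in> S" using B0 by (auto simp: S_def)
  ultimately obtain f where fS: "f \<in> S" and fmax: "\<And>f'. f' \<in> S \<Longrightarrow> G f' \<le> G f"
    using continuous_attains_sup[of S G] Gcont by (metis continuous_on_subset empty_iff subset_UNIV)
  have Gcong: "G f = G f'" if "\<And>i. i \<in> I \<Longrightarrow> f i = f' i" for f f'
    using Gdiff[of f f'] that by simp
  have opt: "G f' \<le> G f" for f'
  proof -
    have "Max (f' ` I) \<in> f' ` I" "Min (f' ` I) \<in> f' ` I" using I by auto
    then obtain j k where "j \<in> I" "f' j = Max (f' ` I)" "k \<in> I" "f' k = Min (f' ` I)" by (metis imageE)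
    then have j: "j \<in> I" "\<And>i. i \<in> I \<Longrightarrow> f' i \<le> f' j"
      and k: "k \<in> I" "\<And>i. i \<in> I \<Longrightarrow> f' k \<le> f' i" using I by auto
    show ?thesis
    proof (cases "f' j - f' k \<le> B")
      case True
      define h where "h = (\<lambda>i. if i \<in> I then f' i - f' k else 0)"
      have "f' i - f' k \<le> B" if "i \<in> I" for i using j(2)[OF that] True by linarith
      then have "h \<in> S" using k by (auto simp: S_def h_def)
      moreover have "G h = G f'" using Gshift[of f' "f' k"] Gcong[of h "\<lambda>i. f' i - f' k"] by (simp add: h_def)
      ultimately show ?thesis using fmax by metis
    next
      case False
      then have "cm + \<epsilon> * ln n < (f' j - f' k) / n" using n by (simp add: B_def field_simps)
      then have "G f' \<le> - \<epsilon> * ln n" using G_le[of j k f', OF j(1) k(1) j(2)] unfolding minus_divide_left[symmetric] by linarith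
      also have "\<dots> \<le> G (\<lambda>_. 0)" by (rule G0)
      also have "\<dots> \<le> G f" by (rule fmax) fact
      finally show ?thesis .
    qed
  qed
  define p where "p i y = exp ((f i - c i y) / \<epsilon> - lZ f y)" for i y
  have Zpos: "0 < (\<Sum>i\<in>I. exp ((f i - c i y) / \<epsilon>))" for y using I by (intro sum_pos) auto
  have p_sum: "(\<Sum>i\<in>I. p i y) = 1" for y
    using Zpos[of y] by (simp add: p_def exp_diff sum_divide_distrib[symmetric] lZ_def)
  have p_pos: "0 < p i y" for i y by (simp add: p_def)
  have [measurable]: "c i \<in> borel_measurable borel" "lZ f \<in> borel_measurable borel" for i
    using lipschitz_borel_measurable[OF cL] lipschitz_borel_measurable[OF lZL] by auto
  have pm[measurable]: "p i \<in> borel_measurable borel" for i unfolding p_def by measurable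
  have pm'[measurable]: "p i \<in> borel_measurable \<pi>" for i using pm P1D[OF \<pi>] by simp
  have p_le: "p i y \<le> 1" if "i \<in> I" for i y
    using p_sum[of y] member_le_sum[OF that, of "\<lambda>i. p i y"] p_pos I by (simp add: less_imp_le)
  have pint: "integrable \<pi> (p i)" if "i \<in> I" for i
    by (rule integrable_const_bound[where B=1]) (use p_le[OF that] p_pos in \<open>auto simp: less_imp_le\<close>)
  \<comment> \<open>Raising \<open>f i\<close> by \<open>k * \<epsilon>\<close> multiplies the i-th
    exponential by \<open>exp k\<close>. Optimality of \<open>f\<close> and
    \<open>ln (1 + z) <= z\<close> then give the finite-difference form of stationarity.\<close>
  have stat: "n * (\<integral>y. p i y \<partial>\<pi>) = 1" if i: "i \<in> I" for i
  proof (rule eq_1_if_exp_minus_1_bound)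
    fix k :: real
    define f' where "f' = f(i := f i + k * \<epsilon>)"
    have "lZ f' y - lZ f y \<le> (exp k - 1) * p i y" for y
    proof -
      have "(\<Sum>j\<in>I. exp ((f' j - c j y) / \<epsilon>)) = exp ((f i - c i y) / \<epsilon> + k) + (\<Sum>j\<in>I-{i}. exp ((f j - c j y) / \<epsilon>))"
        using i I \<epsilon> by (simp add: sum.remove[of I i] f'_def add_divide_distrib diff_divide_distrib algebra_simps)
      also have "\<dots> = (\<Sum>j\<in>I. exp ((f j - c j y) / \<epsilon>)) + (exp k - 1) * exp ((f i - c i y) / \<epsilon>)"
        using i I by (simp add: sum.remove[of I i] exp_add algebra_simps)
      also have "\<dots> = (\<Sum>j\<in>I. exp ((f j - c j y) / \<epsilon>)) * (1 + (exp k - 1) * p i y)"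
        using Zpos[of y] by (simp add: p_def exp_diff lZ_def distrib_left)
      finally have e: "(\<Sum>j\<in>I. exp ((f' j - c j y) / \<epsilon>)) = (\<Sum>j\<in>I. exp ((f j - c j y) / \<epsilon>)) * (1 + (exp k - 1) * p i y)" .
      have "0 < (\<Sum>j\<in>I. exp ((f' j - c j y) / \<epsilon>))" using I by (intro sum_pos) auto
      then have pos: "0 < 1 + (exp k - 1) * p i y" using e Zpos[of y] by (simp add: zero_less_mult_iff)
      have "lZ f' y = lZ f y + ln (1 + (exp k - 1) * p i y)"
        using e Zpos[of y] pos by (simp add: lZ_def ln_mult)
      then show ?thesis using ln_le_minus_one[OF pos] by simp
    qed
    then have "(\<integral>y. lZ f' y - lZ f y \<partial>\<pi>) \<le> (\<integral>y. (exp k - 1) * p i y \<partial>\<pi>)"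
      using lZi pint[OF i] by (intro integral_mono) auto
    then have le: "(\<integral>y. lZ f' y \<partial>\<pi>) - (\<integral>y. lZ f y \<partial>\<pi>) \<le> (exp k - 1) * (\<integral>y. p i y \<partial>\<pi>)"
      using lZi by simp
    have "(\<Sum>j\<in>I. f' j) = (\<Sum>j\<in>I. f j) + k * \<epsilon>"
      using i I by (simp add: sum.remove[of I i] f'_def)
    then have "G f' - G f = \<epsilon> * (k / n - ((\<integral>y. lZ f' y \<partial>\<pi>) - (\<integral>y. lZ f y \<partial>\<pi>)))"
      by (simp add: G_def add_divide_distrib algebra_simps)
    then have "\<epsilon> * (k / n - ((\<integral>y. lZ f' y \<partial>\<pi>) - (\<integral>y. lZ f y \<partial>\<pi>))) \<le> 0" using opt[of f'] by simp
    then have "k / n \<le> (\<integral>y. lZ f' y \<partial>\<pi>) - (\<integral>y. lZ f y \<partial>\<pi>)" using \<epsilon> by (simp add: mult_le_0_iff)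
    also note le
    finally show "k \<le> (exp k - 1) * (n * (\<integral>y. p i y \<partial>\<pi>))" using n by (simp add: field_simps)
  qed
  have W: "W1 (empirical_measure n x) \<pi> \<le>
      (\<Sum>i=1..n. ennreal (1 / n) * (\<integral>\<^sup>+y. ennreal (if i \<in> I then n * p i y else 0) * ennreal (norm (x i - y)) \<partial>\<pi>))"
  proof (rule W1_empirical_le_density[OF n \<pi>])
    show "(\<lambda>y. if i \<in> I then n * p i y else 0) \<in> borel_measurable borel" for i by measurable
    show "(\<Sum>i=1..n. if i \<in> I then n * p i y else 0) = n" for y
      using p_sum[of y] by (simp add: I_def sum_distrib_left[symmetric])
    show "(\<integral>\<^sup>+y. ennreal (if i \<in> I then n * p i y else 0) \<partial>\<pi>) = 1" if "i \<in> {1..n}" for i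
    proof -
      have i: "i \<in> I" using that by (simp add: I_def)
      have "(\<integral>\<^sup>+y. ennreal (n * p i y) \<partial>\<pi>) = ennreal (\<integral>y. n * p i y \<partial>\<pi>)"
        using pint[OF i] p_pos by (intro nn_integral_eq_integral) (auto simp: less_imp_le)
      then show ?thesis using stat[OF i] i by simp
    qed
  qed (use p_pos in \<open>auto simp: less_imp_le\<close>)
  have pcint: "integrable \<pi> (\<lambda>y. p i y * c i y)" if "i \<in> I" for i
  proof (rule Bochner_Integration.integrable_bound)
    show "integrable \<pi> (c i)" by (rule lipschitz_integrable[OF \<pi> cL])
    show "AE y in \<pi>. norm (p i y * c i y) \<le> norm (c i y)"
      using p_le[OF that] p_pos[of i] c0 by (intro AE_I2) (auto simp: abs_mult less_imp_le intro!: mult_left_le_one_le)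
    have "c i \<in> borel_measurable \<pi>" using P1D[OF \<pi>] by simp
    then show "(\<lambda>y. p i y * c i y) \<in> borel_measurable \<pi>" by measurable
  qed
  have "(\<Sum>i=1..n. ennreal (1 / n) * (\<integral>\<^sup>+y. ennreal (if i \<in> I then n * p i y else 0) * ennreal (norm (x i - y)) \<partial>\<pi>))
     = (\<Sum>i\<in>I. ennreal (\<integral>y. p i y * c i y \<partial>\<pi>))"
    unfolding I_def[symmetric]
  proof (rule sum.cong[OF refl])
    fix i assume i: "i \<in> I"
    have "ennreal (if i \<in> I then n * p i y else 0) * ennreal (norm (x i - y)) = ennreal n * ennreal (p i y * c i y)" for y
      using i p_pos[of i y] by (simp add: c_def ennreal_mult[symmetric] less_imp_le mult.assoc)
    then have "(\<integral>\<^sup>+y. ennreal (if i \<in> I then n * p i y else 0) * ennreal (norm (x i - y)) \<partial>\<pi>)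
        = ennreal n * (\<integral>\<^sup>+y. ennreal (p i y * c i y) \<partial>\<pi>)"
      using pcint[OF i] by (simp add: nn_integral_cmult)
    also have "(\<integral>\<^sup>+y. ennreal (p i y * c i y) \<partial>\<pi>) = ennreal (\<integral>y. p i y * c i y \<partial>\<pi>)"
      using pcint[OF i] p_pos c0 by (intro nn_integral_eq_integral) (auto simp: less_imp_le)
    finally show "ennreal (1 / n) * (\<integral>\<^sup>+y. ennreal (if i \<in> I then n * p i y else 0) * ennreal (norm (x i - y)) \<partial>\<pi>)
        = ennreal (\<integral>y. p i y * c i y \<partial>\<pi>)"
      using n by (simp add: mult.assoc[symmetric] ennreal_mult[symmetric])
  qed
  also have "\<dots> = ennreal (\<integral>y. (\<Sum>i\<in>I. p i y * c i y) \<partial>\<pi>)"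
    using pcint c0 p_pos by (subst sum_ennreal) (auto simp: less_imp_le)
  finally have W': "W1 (empirical_measure n x) \<pi> \<le> ennreal (\<integral>y. (\<Sum>i\<in>I. p i y * c i y) \<partial>\<pi>)" using W by simp
  \<comment> \<open>The c-transform of \<open>f\<close>: a maximum of 1-Lipschitz functions, hence
    an admissible dual potential.\<close>
  define \<phi> where "\<phi> y = Max ((\<lambda>j. f j - c j y) ` I)" for y
  have \<phi>_ge: "f j - c j y \<le> \<phi> y" if "j \<in> I" for j y unfolding \<phi>_def using that I by (intro Max_ge) auto
  have \<phi>_ex: "\<exists>j\<in>I. \<phi> y = f j - c j y" for y
  proof -
    have "\<phi> y \<in> (\<lambda>j. f j - c j y) ` I" unfolding \<phi>_def using I(1,2) by (intro Max_in) auto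
    then show ?thesis by blast
  qed
  have \<phi>L: "1-lipschitz_on UNIV \<phi>"
  proof (rule lipschitz_realI)
    fix y z
    obtain j where "j \<in> I" "\<phi> y = f j - c j y" using \<phi>_ex by blast
    with \<phi>_ge[of j z] lipschitz_real_abs[OF cL, of j y z]
    show "\<phi> y - \<phi> z \<le> 1 * norm (y - z)" by (simp add: abs_le_iff)
  qed simp
  \<comment> \<open>A probability vector on \<open>n\<close> points has entropy at most
    \<open>ln n\<close>; this is the whole price of the regularisation.\<close>
  have entropy: "- (\<Sum>i\<in>I. p i y * ln (p i y)) \<le> ln n" for y
  proof -
    have "p i y * (- ln (p i y) - ln n) \<le> 1 / n - p i y" for i
    proof -
      have "- ln (p i y) - ln n = ln (1 / (n * p i y))"
        using p_pos[of i y] n by (simp add: ln_div ln_mult)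
      also have "\<dots> \<le> 1 / (n * p i y) - 1" using p_pos[of i y] n by (intro ln_le_minus_one) auto
      finally have "p i y * (- ln (p i y) - ln n) \<le> p i y * (1 / (n * p i y) - 1)"
        using p_pos[of i y] by (intro mult_left_mono) auto
      then show ?thesis using p_pos[of i y] by (simp add: algebra_simps)
    qed
    then have "(\<Sum>i\<in>I. p i y * (- ln (p i y) - ln n)) \<le> (\<Sum>i\<in>I. 1 / n - p i y)" by (intro sum_mono)
    also have "\<dots> = 0" using I n p_sum[of y] by (simp add: sum_subtractf)
    finally show ?thesis
      using p_sum[of y] by (simp add: algebra_simps sum_subtractf sum_negf sum_distrib_left[symmetric])
  qed
  have pt: "(\<Sum>i\<in>I. p i y * c i y) \<le> (\<Sum>i\<in>I. p i y * f i) - \<phi> y + \<epsilon> * ln n" for y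
  proof -
    have ci: "c i y = f i - \<epsilon> * lZ f y - \<epsilon> * ln (p i y)" for i
      using \<epsilon> by (simp add: p_def field_simps)
    have "p i y * c i y = p i y * f i - \<epsilon> * lZ f y * p i y - \<epsilon> * (p i y * ln (p i y))" for i
      by (subst ci) (simp add: algebra_simps)
    then have "(\<Sum>i\<in>I. p i y * c i y) = (\<Sum>i\<in>I. p i y * f i) - \<epsilon> * lZ f y * (\<Sum>i\<in>I. p i y) + \<epsilon> * (- (\<Sum>i\<in>I. p i y * ln (p i y)))"
      by (simp only: sum_subtractf sum_distrib_left) (simp add: sum_distrib_left)
    moreover have "\<epsilon> * (- (\<Sum>i\<in>I. p i y * ln (p i y))) \<le> \<epsilon> * ln n"
      using entropy \<epsilon> by (intro mult_left_mono) auto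
    moreover have "\<phi> y \<le> \<epsilon> * lZ f y"
    proof -
      obtain j where "j \<in> I" "\<phi> y = f j - c j y" using \<phi>_ex by blast
      with lZ_ge[of j f y] \<epsilon> show ?thesis by (simp add: field_simps)
    qed
    ultimately show ?thesis using p_sum[of y] by simp
  qed
  have \<phi>i: "integrable \<pi> \<phi>" by (rule lipschitz_integrable[OF \<pi> \<phi>L])
  have "(\<integral>y. (\<Sum>i\<in>I. p i y * c i y) \<partial>\<pi>) \<le> (\<integral>y. (\<Sum>i\<in>I. p i y * f i) - \<phi> y + \<epsilon> * ln n \<partial>\<pi>)"
    using pcint pint \<phi>i pt by (intro integral_mono) auto
  also have "\<dots> = (\<Sum>i\<in>I. (\<integral>y. p i y \<partial>\<pi>) * f i) - (\<integral>y. \<phi> y \<partial>\<pi>) + \<epsilon> * ln n"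
    using pint \<phi>i by (simp add: prob_space)
  also have "(\<Sum>i\<in>I. (\<integral>y. p i y \<partial>\<pi>) * f i) = (\<Sum>i\<in>I. f i) / n"
    unfolding sum_divide_distrib using stat n by (intro sum.cong) (auto simp: field_simps)
  \<comment> \<open>Taking \<open>y = x i\<close> costs nothing, so
    \<open>f i <= \<phi> (x i)\<close>.\<close>
  also have "\<dots> \<le> (\<Sum>i\<in>I. \<phi> (x i)) / n"
    using \<phi>_ge[of i "x i" for i] by (intro divide_right_mono sum_mono) (auto simp: c_def)
  also have "(\<Sum>i\<in>I. \<phi> (x i)) / n - (\<integral>y. \<phi> y \<partial>\<pi>) \<le> kr_dual \<pi> n x"
    unfolding I_def by (rule kr_dual_upper[OF \<pi> \<phi>L n])
  finally show ?thesis by (intro order_trans[OF W']) (auto intro!: ennreal_leI)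
qed

lemma W1_empirical_le_kr_dual:
  assumes n: "1 \<le> n" and \<pi>: "\<pi> \<in> P1"
  shows "W1 (empirical_measure n x) \<pi> \<le> ennreal (kr_dual \<pi> n x)"
proof (rule ennreal_le_epsilon)
  fix e :: real assume e: "0 < e"
  have l: "0 \<le> ln (real n)" using n by simp
  have "W1 (empirical_measure n x) \<pi> \<le> ennreal (kr_dual \<pi> n x + e / (ln n + 1) * ln n)"
    using e l by (intro W1_empirical_le_kr_dual_eps[OF n \<pi>]) (auto intro!: divide_pos_pos add_nonneg_pos)
  also have "\<dots> \<le> ennreal (kr_dual \<pi> n x + e)"
    using e l by (intro ennreal_leI) (simp add: field_simps)
  finally show "W1 (empirical_measure n x) \<pi> \<le> ennreal (kr_dual \<pi> n x) + ennreal e"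
    using e kr_dual_nonneg[OF \<pi> n] by (simp add: ennreal_plus[symmetric] del: ennreal_plus)
qed

section \<open>Lipschitz partitions of unity on grids\<close>

definition tent :: "real \<Rightarrow> real" where "tent z = max 0 (1 - \<bar>z\<bar>)"

definition clip :: "real \<Rightarrow> real \<Rightarrow> real" where "clip b z = max (- b) (min b z)"

lemma tent_nonneg: "0 \<le> tent z" and tent_le_1: "tent z \<le> 1"
  by (auto simp: tent_def)

lemma tent_lipschitz: "\<bar>tent z - tent w\<bar> \<le> \<bar>z - w\<bar>"
  by (auto simp: tent_def max_def abs_le_iff)

lemma tent_nonzeroD: "tent z \<noteq> 0 \<Longrightarrow> \<bar>z\<bar> < 1"
  by (auto simp: tent_def max_def split: if_splits)

lemma clip_lipschitz: "\<bar>clip b z - clip b w\<bar> \<le> \<bar>z - w\<bar>"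
  by (auto simp: clip_def max_def min_def)

lemma clip_id: "\<bar>z\<bar> \<le> b \<Longrightarrow> clip b z = z"
  by (auto simp: clip_def)

lemma clip_bound: "0 \<le> b \<Longrightarrow> \<bar>clip b z\<bar> \<le> b"
  by (auto simp: clip_def)

lemma clip_scale:
  assumes "0 < s"
  shows "clip b (z / s) = clip (s * b) z / s"
proof -
  have 1: "z / s \<le> b \<longleftrightarrow> z \<le> s * b" using assms by (simp add: field_simps)
  have 2: "- b \<le> z / s \<longleftrightarrow> - (s * b) \<le> z" using assms by (simp add: field_simps)
  have 3: "- b \<le> b \<longleftrightarrow> - (s * b) \<le> s * b" using assms by (simp add: zero_le_mult_iff)
  show ?thesis
    using assms 1 2 3 by (auto simp: clip_def max_def min_def)
qed

lemma tent_support: "{m. tent (z - real_of_int m) \<noteq> 0} \<subseteq> {\<lfloor>z\<rfloor>, \<lfloor>z\<rfloor> + 1}"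
proof
  fix m assume "m \<in> {m. tent (z - real_of_int m) \<noteq> 0}"
  then have "\<bar>z - real_of_int m\<bar> < 1" by (auto dest: tent_nonzeroD)
  then show "m \<in> {\<lfloor>z\<rfloor>, \<lfloor>z\<rfloor> + 1}" by (auto; linarith)
qed

lemma sum_tent:
  assumes "\<bar>z\<bar> \<le> real M"
  shows "(\<Sum>m\<in>{- int M..int M}. tent (z - real_of_int m)) = 1"
\<comment> \<open>At the right end \<open>z = M\<close> the neighbour
  \<open>\<lfloor>z\<rfloor> + 1\<close> leaves the index range, but its tent vanishes
  there.\<close>
proof (cases "\<lfloor>z\<rfloor> = int M")
  case True
  then have z: "z = real M" using assms by linarith
  have "(\<Sum>m\<in>{- int M..int M}. tent (z - real_of_int m)) = (\<Sum>m\<in>{int M}. tent (z - real_of_int m))"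
    by (rule sum.mono_neutral_right) (use tent_support[of z] True in auto)
  then show ?thesis by (simp add: z tent_def)
next
  case False
  have k: "- int M \<le> \<lfloor>z\<rfloor>" "\<lfloor>z\<rfloor> < int M" using assms False by linarith+
  have "(\<Sum>m\<in>{- int M..int M}. tent (z - real_of_int m)) = (\<Sum>m\<in>{\<lfloor>z\<rfloor>, \<lfloor>z\<rfloor> + 1}. tent (z - real_of_int m))"
    by (rule sum.mono_neutral_right) (use tent_support[of z] k in auto)
  also have "\<dots> = tent (z - \<lfloor>z\<rfloor>) + tent (z - \<lfloor>z\<rfloor> - 1)" by (simp add: diff_diff_eq)
  also have "\<dots> = 1"
  proof -
    have "0 \<le> z - \<lfloor>z\<rfloor>" "z - \<lfloor>z\<rfloor> < 1" by linarith+
    then show ?thesis by (auto simp: tent_def)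
  qed
  finally show ?thesis .
qed

text \<open>Only the two integers next to \<open>z\<close> and the two next to \<open>w\<close>
  contribute, so the total variation does not grow with the index set.\<close>

lemma sum_tent_diff_le:
  assumes "finite A"
  shows "(\<Sum>m\<in>A. \<bar>tent (z - real_of_int m) - tent (w - real_of_int m)\<bar>) \<le> 4 * \<bar>z - w\<bar>"
proof -
  define B where "B = {\<lfloor>z\<rfloor>, \<lfloor>z\<rfloor> + 1, \<lfloor>w\<rfloor>, \<lfloor>w\<rfloor> + 1}"
  have "(\<Sum>m\<in>A. \<bar>tent (z - real_of_int m) - tent (w - real_of_int m)\<bar>)
      = (\<Sum>m\<in>A \<inter> B. \<bar>tent (z - real_of_int m) - tent (w - real_of_int m)\<bar>)"
  proof (rule sum.mono_neutral_right)
    have "tent (z - real_of_int m) = 0 \<and> tent (w - real_of_int m) = 0" if "m \<notin> B" for m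
      using tent_support[of z] tent_support[of w] that by (auto simp: B_def)
    then show "\<forall>m\<in>A - A \<inter> B. \<bar>tent (z - real_of_int m) - tent (w - real_of_int m)\<bar> = 0" by auto
  qed (use assms in auto)
  also have "\<dots> \<le> (\<Sum>m\<in>A \<inter> B. \<bar>z - w\<bar>)"
    by (intro sum_mono order_trans[OF tent_lipschitz]) simp
  also have "\<dots> = card (A \<inter> B) * \<bar>z - w\<bar>" by simp
  also have "card (A \<inter> B) \<le> 4"
  proof -
    have "card (A \<inter> B) \<le> card B" by (intro card_mono) (auto simp: B_def)
    also have "\<dots> \<le> 4"
      using card_length[of "[\<lfloor>z\<rfloor>, \<lfloor>z\<rfloor> + 1, \<lfloor>w\<rfloor>, \<lfloor>w\<rfloor> + 1]"] by (simp add: B_def)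
    finally show ?thesis .
  qed
  finally show ?thesis by (simp add: mult_right_mono)
qed

text \<open>Subadditivity of total variation for product measures, with \<open>p i\<close> and
  \<open>q i\<close> read as probability vectors: factors are exchanged one coordinate at a time,
  and the remaining factors sum to 1.\<close>

lemma sum_abs_prod_diff_le:
  fixes p q :: "'i \<Rightarrow> 'b \<Rightarrow> real"
  assumes "finite I" "\<And>i. i \<in> I \<Longrightarrow> finite (A i)"
    and "\<And>i m. 0 \<le> p i m" "\<And>i. i \<in> I \<Longrightarrow> (\<Sum>m\<in>A i. p i m) = 1"
    and "\<And>i m. 0 \<le> q i m" "\<And>i. i \<in> I \<Longrightarrow> (\<Sum>m\<in>A i. q i m) = 1"
  shows "(\<Sum>v\<in>PiE I A. \<bar>(\<Prod>i\<in>I. p i (v i)) - (\<Prod>i\<in>I. q i (v i))\<bar>) \<le> (\<Sum>i\<in>I. \<Sum>m\<in>A i. \<bar>p i m - q i m\<bar>)"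
  using assms(1,2,4,6)
proof (induction I rule: finite_induct)
  case (insert k I)
  define Pp where "Pp v = (\<Prod>i\<in>I. p i (v i))" for v
  define Pq where "Pq v = (\<Prod>i\<in>I. q i (v i))" for v
  have Pp0: "0 \<le> Pp v" for v unfolding Pp_def using assms(3) by (simp add: prod_nonneg)
  have "(\<Sum>v\<in>PiE I A. Pp v) = (\<Prod>i\<in>I. \<Sum>m\<in>A i. p i m)"
    unfolding Pp_def using insert by (subst prod_sum_PiE) auto
  then have Pp1: "(\<Sum>v\<in>PiE I A. Pp v) = 1" using insert by simp
  have upd: "(\<Prod>i\<in>I. h i (if i = k then m else v i)) = (\<Prod>i\<in>I. h i (v i))" for h :: "'i \<Rightarrow> 'b \<Rightarrow> real" and v m
    using insert.hyps by (intro prod.cong) auto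
  have "(\<Sum>v\<in>PiE (insert k I) A. \<bar>(\<Prod>i\<in>insert k I. p i (v i)) - (\<Prod>i\<in>insert k I. q i (v i))\<bar>)
      = (\<Sum>(m, v)\<in>A k \<times> PiE I A. \<bar>p k m * Pp v - q k m * Pq v\<bar>)"
    unfolding PiE_insert_eq
    by (subst sum.reindex[OF inj_combinator])
      (use insert.hyps in \<open>auto simp: Pp_def Pq_def upd intro!: sum.cong\<close>)
  also have "\<dots> = (\<Sum>m\<in>A k. \<Sum>v\<in>PiE I A. \<bar>p k m * Pp v - q k m * Pq v\<bar>)"
    by (simp add: sum.cartesian_product)
  also have "\<dots> \<le> (\<Sum>m\<in>A k. \<Sum>v\<in>PiE I A. \<bar>p k m - q k m\<bar> * Pp v + q k m * \<bar>Pp v - Pq v\<bar>)"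
  proof (intro sum_mono)
    fix m v
    have "p k m * Pp v - q k m * Pq v = (p k m - q k m) * Pp v + q k m * (Pp v - Pq v)" by (simp add: algebra_simps)
    also have "\<bar>\<dots>\<bar> \<le> \<bar>p k m - q k m\<bar> * Pp v + q k m * \<bar>Pp v - Pq v\<bar>"
      using Pp0[of v] assms(5)[of k m] by (intro order_trans[OF abs_triangle_ineq]) (simp add: abs_mult)
    finally show "\<bar>p k m * Pp v - q k m * Pq v\<bar> \<le> \<bar>p k m - q k m\<bar> * Pp v + q k m * \<bar>Pp v - Pq v\<bar>" .
  qed
  also have "\<dots> = (\<Sum>m\<in>A k. \<bar>p k m - q k m\<bar>) * (\<Sum>v\<in>PiE I A. Pp v)
      + (\<Sum>m\<in>A k. q k m) * (\<Sum>v\<in>PiE I A. \<bar>Pp v - Pq v\<bar>)"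
    by (simp add: sum.distrib sum_product)
  also have "\<dots> \<le> (\<Sum>m\<in>A k. \<bar>p k m - q k m\<bar>) + (\<Sum>i\<in>I. \<Sum>m\<in>A i. \<bar>p i m - q i m\<bar>)"
    using insert by (simp add: Pp1 Pp_def[symmetric] Pq_def[symmetric])
  finally show ?case using insert.hyps by simp
qed simp

definition grid :: "nat \<Rightarrow> ('d \<Rightarrow> int) set" where
  "grid M = (\<Pi>\<^sub>E i\<in>UNIV. {- int M..int M})"

definition gpt :: "real \<Rightarrow> ('d \<Rightarrow> int) \<Rightarrow> real ^ 'd" where
  "gpt s v = (\<chi> i. s * real_of_int (v i))"

definition clipv :: "real \<Rightarrow> real ^ 'd \<Rightarrow> real ^ 'd" where
  "clipv b x = (\<chi> i. clip b (x $ i))"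

text \<open>Tensor products of hat functions. Clipping to the box of radius \<open>s * M\<close>
  keeps them a partition of unity on the whole space and not just on the box.\<close>

definition bump :: "real \<Rightarrow> nat \<Rightarrow> ('d::finite \<Rightarrow> int) \<Rightarrow> real ^ 'd \<Rightarrow> real" where
  "bump s M v x = (\<Prod>i\<in>UNIV. tent (clip (real M) (x $ i / s) - real_of_int (v i)))"

lemma finite_grid: "finite (grid M :: ('d::finite \<Rightarrow> int) set)"
  unfolding grid_def by (intro finite_PiE) auto

lemma card_grid: "card (grid M :: ('d::finite \<Rightarrow> int) set) = (2 * M + 1) ^ CARD('d)"
proof -
  have "nat (2 * int M + 1) = 2 * M + 1" by linarith
  then show ?thesis unfolding grid_def by (subst card_PiE) auto
qed

lemma bump_nonneg: "0 \<le> bump s M v x"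
  unfolding bump_def by (intro prod_nonneg) (simp add: tent_nonneg)

lemma sum_bump: "(\<Sum>v\<in>grid M. bump s M v x) = 1"
  unfolding bump_def grid_def
  by (subst prod_sum_PiE[symmetric]) (auto simp: sum_tent clip_bound)

lemma bump_le_1: "bump s M v x \<le> 1"
  unfolding bump_def by (intro prod_le_1) (simp add: tent_nonneg tent_le_1)

lemma sum_abs_bump_diff_le:
  fixes x y :: "real ^ 'd"
  assumes s: "0 < s"
  shows "(\<Sum>v\<in>grid M. \<bar>bump s M v x - bump s M v y\<bar>) \<le> 4 * CARD('d) / s * norm (x - y)"
proof -
  have "(\<Sum>v\<in>grid M. \<bar>bump s M v x - bump s M v y\<bar>)
     \<le> (\<Sum>i\<in>UNIV. \<Sum>m\<in>{- int M..int M}. \<bar>tent (clip (real M) (x $ i / s) - real_of_int m) - tent (clip (real M) (y $ i / s) - real_of_int m)\<bar>)"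
    unfolding bump_def grid_def
    by (rule sum_abs_prod_diff_le) (auto simp: tent_nonneg sum_tent clip_bound)
  also have "\<dots> \<le> (\<Sum>i\<in>(UNIV::'d set). 4 / s * norm (x - y))"
  proof (rule sum_mono)
    fix i :: 'd
    have "(\<Sum>m\<in>{- int M..int M}. \<bar>tent (clip (real M) (x $ i / s) - real_of_int m) - tent (clip (real M) (y $ i / s) - real_of_int m)\<bar>)
      \<le> 4 * \<bar>clip (real M) (x $ i / s) - clip (real M) (y $ i / s)\<bar>" by (rule sum_tent_diff_le) simp
    also have "\<dots> \<le> 4 * \<bar>x $ i / s - y $ i / s\<bar>" using clip_lipschitz by simp
    also have "\<dots> = 4 / s * \<bar>(x - y) $ i\<bar>" using s by (simp add: diff_divide_distrib[symmetric])
    also have "\<dots> \<le> 4 / s * norm (x - y)" using s component_le_norm_cart[of "x - y" i] by (intro mult_left_mono) auto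
    finally show "(\<Sum>m\<in>{- int M..int M}. \<bar>tent (clip (real M) (x $ i / s) - real_of_int m) - tent (clip (real M) (y $ i / s) - real_of_int m)\<bar>) \<le> 4 / s * norm (x - y)" .
  qed
  finally show ?thesis by (simp add: mult_ac)
qed

lemma bump_nonzeroD:
  assumes "bump s M v x \<noteq> 0" "0 < s"
  shows "\<bar>clip (s * M) (x $ i) - s * v i\<bar> < s"
proof -
  have "tent (clip (real M) (x $ i / s) - real_of_int (v i)) \<noteq> 0"
    using assms(1) by (auto simp: bump_def)
  then have "\<bar>clip (s * M) (x $ i) / s - v i\<bar> < 1"
    using tent_nonzeroD clip_scale[OF assms(2)] by metis
  then have "\<bar>(clip (s * M) (x $ i) - s * v i) / s\<bar> < 1" using assms(2) by (simp add: diff_divide_distrib)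
  then show ?thesis using assms(2) by (simp add: abs_divide)
qed

section \<open>Interpolants and the differences of successive levels\<close>

definition interp :: "real \<Rightarrow> nat \<Rightarrow> (real ^ 'd::finite \<Rightarrow> real) \<Rightarrow> real ^ 'd \<Rightarrow> real" where
  "interp s M f x = (\<Sum>v\<in>grid M. f (gpt s v) * bump s M v x)"

text \<open>\<open>v\<close> indexes a grid of mesh \<open>s\<close> and \<open>w\<close> one of
  mesh \<open>2 s\<close>, so \<open>v i - 2 * w i\<close> is their offset in units of
  \<open>s\<close>. Keeping only nearby pairs makes their number proportional to the fine grid
  alone.\<close>

definition pairs :: "nat \<Rightarrow> nat \<Rightarrow> (('d \<Rightarrow> int) \<times> ('d \<Rightarrow> int)) set" where
  "pairs M M' = {(v, w). v \<in> grid M \<and> w \<in> grid M' \<and> (\<forall>i. \<bar>v i - 2 * w i\<bar> \<le> 3)}"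

text \<open>The common refinement of two partitions of unity: it turns the difference of two
  successive interpolants into one sum whose coefficients are increments of \<open>f\<close> between
  nearby grid points (\<open>interp_diff_eq\<close>). The coarse factor sees the clipped point, so
  both factors stay close to each other outside the fine box as well.\<close>

definition pbump :: "real \<Rightarrow> nat \<Rightarrow> nat \<Rightarrow> ('d::finite \<Rightarrow> int) \<times> ('d \<Rightarrow> int) \<Rightarrow> real ^ 'd \<Rightarrow> real" where
  "pbump s M M' p x = bump s M (fst p) x * bump (2 * s) M' (snd p) (clipv (s * M) x)"

lemma pairs_subset: "pairs M M' \<subseteq> grid M \<times> grid M'"
  by (auto simp: pairs_def)

lemma finite_pairs: "finite (pairs M M' :: (('d::finite \<Rightarrow> int) \<times> ('d \<Rightarrow> int)) set)"
  by (rule finite_subset[OF pairs_subset]) (simp add: finite_grid)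

text \<open>A pair is determined by \<open>v\<close> and the offset \<open>v - 2 w\<close>, whose
  coordinates lie in \<open>{-3..3}\<close>: seven choices per coordinate.\<close>

lemma card_pairs_le:
  "card (pairs M M' :: (('d::finite \<Rightarrow> int) \<times> ('d \<Rightarrow> int)) set) \<le> (7 * (2 * M + 1)) ^ CARD('d)"
proof -
  let ?h = "\<lambda>(v, w). (v, \<lambda>i. v i - 2 * w i) :: ('d \<Rightarrow> int) \<times> ('d \<Rightarrow> int)"
  have "card (pairs M M' :: (('d \<Rightarrow> int) \<times> ('d \<Rightarrow> int)) set) \<le> card (grid M \<times> grid 3 :: (('d \<Rightarrow> int) \<times> ('d \<Rightarrow> int)) set)"
  proof (rule card_inj_on_le)
    show "inj_on ?h (pairs M M')" by (auto simp: inj_on_def fun_eq_iff)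
    show "?h ` pairs M M' \<subseteq> grid M \<times> grid 3"
    proof safe
      fix v w :: "'d \<Rightarrow> int" assume vw: "(v, w) \<in> pairs M M'"
      then show "v \<in> grid M" by (auto simp: pairs_def)
      have "\<bar>v i - 2 * w i\<bar> \<le> 3" for i using vw by (auto simp: pairs_def)
      then have "- 3 \<le> v i - 2 * w i \<and> v i - 2 * w i \<le> 3" for i by (metis abs_le_iff minus_le_iff)
      then show "(\<lambda>i. v i - 2 * w i) \<in> grid 3" by (auto simp: grid_def PiE_iff)
    qed
  qed (simp add: finite_grid)
  also have "\<dots> = (7 * (2 * M + 1)) ^ CARD('d)"
    unfolding card_cartesian_product card_grid power_mult_distrib by simp
  finally show ?thesis .
qed

lemma pbump_nonneg: "0 \<le> pbump s M M' p x"
  by (simp add: pbump_def bump_nonneg)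

lemma pbump_le_1: "pbump s M M' p x \<le> 1"
  unfolding pbump_def by (intro mult_le_one bump_le_1 bump_nonneg)

text \<open>Clipping to the finer box moves a coordinate of the coarser interpolation point by at most
  \<open>s\<close>, whence the bound \<open>3\<close> for the (integer) index difference.\<close>

lemma pbump_support:
  assumes s: "0 < s" and M: "M \<le> 2 * M' + 1"
    and v: "v \<in> grid M" "w \<in> grid M'" and nz: "pbump s M M' (v, w) x \<noteq> 0"
  shows "(v, w) \<in> pairs M M'"
proof -
  have "\<bar>v i - 2 * w i\<bar> \<le> 3" for i
  proof -
    define z where "z = clip (s * M) (x $ i)"
    have "bump s M v x \<noteq> 0" "bump (2 * s) M' w (clipv (s * M) x) \<noteq> 0"
      using nz by (auto simp: pbump_def)
    then have 1: "\<bar>z - s * v i\<bar> < s" and 2: "\<bar>clip (2 * s * M') z - 2 * s * w i\<bar> < 2 * s"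
      using bump_nonzeroD[of s M v x i] bump_nonzeroD[of "2 * s" M' w "clipv (s * M) x" i] s
      by (auto simp: z_def clipv_def)
    have "\<bar>z\<bar> \<le> s * M" unfolding z_def using s by (intro clip_bound) auto
    also have "\<dots> \<le> s * (2 * real M' + 1)" using s M by (intro mult_left_mono) auto
    finally have "\<bar>z\<bar> \<le> 2 * s * M' + s" by (simp add: algebra_simps)
    then have "\<bar>z - clip (2 * s * M') z\<bar> \<le> s"
      using s by (auto simp: clip_def max_def min_def)
    with 1 2 have "\<bar>s * v i - 2 * s * w i\<bar> < s * 4" by linarith
    also have "s * v i - 2 * s * w i = s * real_of_int (v i - 2 * w i)" by (simp add: algebra_simps)
    finally have "\<bar>real_of_int (v i - 2 * w i)\<bar> < 4" using s by (simp add: abs_mult)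
    then show ?thesis by linarith
  qed
  then show ?thesis using v by (auto simp: pairs_def)
qed

lemma sum_pairs_eq:
  fixes h :: "('d::finite \<Rightarrow> int) \<times> ('d \<Rightarrow> int) \<Rightarrow> real"
  assumes "0 < s" "M \<le> 2 * M' + 1"
  shows "(\<Sum>p\<in>pairs M M'. h p * pbump s M M' p x) = (\<Sum>v\<in>grid M. \<Sum>w\<in>grid M'. h (v, w) * pbump s M M' (v, w) x)"
proof -
  have "(\<Sum>p\<in>pairs M M'. h p * pbump s M M' p x) = (\<Sum>p\<in>grid M \<times> grid M'. h p * pbump s M M' p x)"
  proof (rule sum.mono_neutral_left)
    have "pbump s M M' p x = 0" if "p \<in> grid M \<times> grid M'" "p \<notin> pairs M M'" for p
      using pbump_support[OF assms, of "fst p" "snd p" x] that by (cases p) auto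
    then show "\<forall>p\<in>grid M \<times> grid M' - pairs M M'. h p * pbump s M M' p x = 0" by auto
  qed (auto simp: finite_grid pairs_subset)
  then show ?thesis by (simp add: sum.cartesian_product case_prod_beta)
qed

lemma sum_pbump:
  fixes x :: "real ^ 'd"
  assumes "0 < s" "M \<le> 2 * M' + 1"
  shows "(\<Sum>p\<in>pairs M M'. pbump s M M' p x) = 1"
proof -
  have "(\<Sum>p\<in>pairs M M'. pbump s M M' p x) = (\<Sum>v\<in>grid M. \<Sum>w\<in>grid M'. 1 * pbump s M M' (v, w) x)"
    using sum_pairs_eq[OF assms, of "\<lambda>_. 1" x] by simp
  also have "\<dots> = 1" by (simp add: pbump_def sum_distrib_left[symmetric] sum_bump)
  finally show ?thesis .
qed

lemma interp_diff_eq: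
  fixes x :: "real ^ 'd"
  assumes "0 < s" "M \<le> 2 * M' + 1"
  shows "interp s M f x - interp (2 * s) M' f (clipv (s * M) x)
    = (\<Sum>p\<in>pairs M M'. (f (gpt s (fst p)) - f (gpt (2 * s) (snd p))) * pbump s M M' p x)"
proof -
  have 1: "interp s M f x = (\<Sum>v\<in>grid M. \<Sum>w\<in>grid M'. f (gpt s v) * pbump s M M' (v, w) x)"
    by (simp add: interp_def pbump_def sum_distrib_left[symmetric] sum_bump)
  have 2: "interp (2 * s) M' f (clipv (s * M) x) = (\<Sum>v\<in>grid M. \<Sum>w\<in>grid M'. f (gpt (2 * s) w) * pbump s M M' (v, w) x)"
    by (subst sum.swap)
      (simp add: interp_def pbump_def mult.left_commute[of "f _"] sum_distrib_right[symmetric] sum_bump)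
  show ?thesis
    unfolding 1 2 sum_pairs_eq[OF assms, of "\<lambda>p. f (gpt s (fst p)) - f (gpt (2 * s) (snd p))" x]
    by (simp add: sum_subtractf left_diff_distrib)
qed

lemma clipv_contraction: "norm (clipv b x - clipv b y) \<le> norm (x - y)"
  unfolding clipv_def by (rule norm_le_componentwise_cart) (simp add: clip_lipschitz)

text \<open>The two factors contribute one total variation bound each, the coarse one after a
  contraction by \<open>clipv\<close>. The constant is independent of the number of pairs, which is
  the input that \<open>second_moment\<close> requires.\<close>

lemma sum_abs_pbump_diff_le:
  fixes x y :: "real ^ 'd"
  assumes s: "0 < s"
  shows "(\<Sum>p\<in>pairs M M'. \<bar>pbump s M M' p x - pbump s M M' p y\<bar>) \<le> 8 * CARD('d) / s * norm (x - y)"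
proof -
  let ?x = "clipv (s * M) x" and ?y = "clipv (s * M) y"
  have "(\<Sum>p\<in>pairs M M'. \<bar>pbump s M M' p x - pbump s M M' p y\<bar>)
      \<le> (\<Sum>p\<in>grid M \<times> grid M'. \<bar>pbump s M M' p x - pbump s M M' p y\<bar>)"
    using pairs_subset by (intro sum_mono2) (auto simp: finite_grid)
  also have "\<dots> = (\<Sum>v\<in>grid M. \<Sum>w\<in>grid M'. \<bar>pbump s M M' (v, w) x - pbump s M M' (v, w) y\<bar>)"
    by (simp add: sum.cartesian_product case_prod_beta)
  also have "\<dots> \<le> (\<Sum>v\<in>grid M. \<Sum>w\<in>grid M'. \<bar>bump s M v x - bump s M v y\<bar> * bump (2 * s) M' w ?x
      + bump s M v y * \<bar>bump (2 * s) M' w ?x - bump (2 * s) M' w ?y\<bar>)"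
  proof (intro sum_mono)
    fix v w
    have "pbump s M M' (v, w) x - pbump s M M' (v, w) y = (bump s M v x - bump s M v y) * bump (2 * s) M' w ?x
      + bump s M v y * (bump (2 * s) M' w ?x - bump (2 * s) M' w ?y)"
      by (simp add: pbump_def algebra_simps)
    also have "\<bar>\<dots>\<bar> \<le> \<bar>bump s M v x - bump s M v y\<bar> * bump (2 * s) M' w ?x
      + bump s M v y * \<bar>bump (2 * s) M' w ?x - bump (2 * s) M' w ?y\<bar>"
      by (intro order_trans[OF abs_triangle_ineq]) (simp add: abs_mult bump_nonneg)
    finally show "\<bar>pbump s M M' (v, w) x - pbump s M M' (v, w) y\<bar> \<le> \<bar>bump s M v x - bump s M v y\<bar> * bump (2 * s) M' w ?x
      + bump s M v y * \<bar>bump (2 * s) M' w ?x - bump (2 * s) M' w ?y\<bar>" .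
  qed
  also have "\<dots> = (\<Sum>v\<in>grid M. \<bar>bump s M v x - bump s M v y\<bar>) + (\<Sum>w\<in>grid M'. \<bar>bump (2 * s) M' w ?x - bump (2 * s) M' w ?y\<bar>)"
    by (simp add: sum.distrib sum_product[symmetric] sum_bump)
  also have "\<dots> \<le> 4 * CARD('d) / s * norm (x - y) + 4 * CARD('d) / (2 * s) * norm (?x - ?y)"
    using s by (intro add_mono sum_abs_bump_diff_le) auto
  also have "4 * CARD('d) / (2 * s) * norm (?x - ?y) \<le> 4 * CARD('d) / s * norm (x - y)"
    using s clipv_contraction[of "s * M" x y] by (intro mult_mono divide_left_mono) auto
  finally show ?thesis by (simp add: algebra_simps)
qed

lemma gpt_diff_le:
  fixes f :: "real ^ 'd \<Rightarrow> real" and s :: real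
  assumes f: "1-lipschitz_on UNIV f" and s: "0 < s" and p: "p \<in> pairs M M'"
  shows "\<bar>f (gpt s (fst p)) - f (gpt (2 * s) (snd p))\<bar> \<le> 3 * CARD('d) * s"
proof -
  have "\<bar>f (gpt s (fst p)) - f (gpt (2 * s) (snd p))\<bar> \<le> norm (gpt s (fst p) - gpt (2 * s) (snd p))"
    using lipschitz_real_abs[OF f] by (metis mult_1)
  also have "\<dots> \<le> (\<Sum>i\<in>UNIV. \<bar>(gpt s (fst p) - gpt (2 * s) (snd p)) $ i\<bar>)" by (rule norm_le_l1_cart)
  also have "\<dots> \<le> (\<Sum>i\<in>(UNIV::'d set). s * 3)"
  proof (rule sum_mono)
    fix i :: 'd
    have "(gpt s (fst p) - gpt (2 * s) (snd p)) $ i = s * real_of_int (fst p i - 2 * snd p i)"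
      by (simp add: gpt_def algebra_simps)
    moreover have "\<bar>fst p i - 2 * snd p i\<bar> \<le> 3" using p by (auto simp: pairs_def)
    ultimately show "\<bar>(gpt s (fst p) - gpt (2 * s) (snd p)) $ i\<bar> \<le> s * 3"
      using s by (simp add: abs_mult del: of_int_diff)
  qed
  finally show ?thesis by (simp add: mult_ac)
qed

lemma interp_error_le:
  fixes f :: "real ^ 'd \<Rightarrow> real" and s :: real
  assumes f: "1-lipschitz_on UNIV f" and s: "0 < s" and x: "\<And>i. \<bar>x $ i\<bar> \<le> s * M"
  shows "\<bar>f x - interp s M f x\<bar> \<le> CARD('d) * s"
proof -
  have "f x - interp s M f x = (\<Sum>v\<in>grid M. (f x - f (gpt s v)) * bump s M v x)"
    by (simp add: interp_def left_diff_distrib sum_subtractf sum_distrib_left[symmetric] sum_bump)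
  also have "\<bar>\<dots>\<bar> \<le> (\<Sum>v\<in>grid M. \<bar>(f x - f (gpt s v)) * bump s M v x\<bar>)" by (rule sum_abs)
  also have "\<dots> \<le> (\<Sum>v\<in>grid M. CARD('d) * s * bump s M v x)"
  proof (rule sum_mono)
    fix v
    show "\<bar>(f x - f (gpt s v)) * bump s M v x\<bar> \<le> CARD('d) * s * bump s M v x"
    proof (cases "bump s M v x = 0")
      case False
      have "\<bar>f x - f (gpt s v)\<bar> \<le> norm (x - gpt s v)" using lipschitz_real_abs[OF f] by (metis mult_1)
      also have "\<dots> \<le> (\<Sum>i\<in>UNIV. \<bar>(x - gpt s v) $ i\<bar>)" by (rule norm_le_l1_cart)
      also have "\<dots> \<le> (\<Sum>i\<in>(UNIV::'d set). s)"
        using bump_nonzeroD[OF False s] clip_id[OF x] by (intro sum_mono) (simp add: gpt_def less_imp_le)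
      finally have "\<bar>f x - f (gpt s v)\<bar> \<le> CARD('d) * s" by simp
      then show ?thesis using bump_nonneg[of s M v x] by (simp add: abs_mult mult_right_mono)
    qed simp
  qed
  also have "\<dots> = CARD('d) * s" by (simp add: sum_distrib_left[symmetric] sum_bump)
  finally show ?thesis .
qed

section \<open>Multiscale approximation of Lipschitz functions\<close>

text \<open>Box radii in units of the mesh \<open>2^j s0\<close>: the radius at level
  \<open>j\<close> is \<open>min (2^j s0 N) (2^J s0)\<close>, so the mesh is about
  \<open>1 / N\<close> of the distance from the origin, up to an outer radius \<open>2^J s0\<close>.
  Above \<open>J\<close> only the origin is left as a grid point.\<close>

definition boxes :: "nat \<Rightarrow> nat \<Rightarrow> nat \<Rightarrow> nat" where
  "boxes N J j = (if j \<le> J then min N (2 ^ (J - j)) else 0)"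

text \<open>The condition under which \<open>pairs\<close> captures every active pair. The
  \<open>+ 1\<close> serves the top level, where the box passes from 1 to 0.\<close>

lemma boxes_step: "1 \<le> N \<Longrightarrow> j \<le> J \<Longrightarrow> boxes N J j \<le> 2 * boxes N J (Suc j) + 1"
proof (cases "j = J")
  case False
  assume "j \<le> J"
  with False have "2 ^ (J - j) = (2::nat) * 2 ^ (J - Suc j)"
    by (metis Suc_diff_Suc le_neq_implies_less power_Suc)
  then show ?thesis using False \<open>j \<le> J\<close> by (auto simp: boxes_def)
qed (auto simp: boxes_def)

lemma boxes_le: "boxes N J j \<le> N" "j \<le> J \<Longrightarrow> boxes N J j \<le> 2 ^ (J - j)"
  by (auto simp: boxes_def)

lemma boxes_ge_1: "1 \<le> N \<Longrightarrow> j \<le> J \<Longrightarrow> 1 \<le> boxes N J j"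
  by (auto simp: boxes_def)

text \<open>Inside the outer box the mesh used at \<open>x\<close> is at most
  \<open>s0 + 2 * norm x / N\<close>. Outside it all accuracy is lost; subtracting only half the
  outer radius gives a Lipschitz term that still dominates a multiple of \<open>norm x\<close>
  there.\<close>

definition multiscale_error :: "nat \<Rightarrow> real \<Rightarrow> nat \<Rightarrow> nat \<Rightarrow> 'a::real_normed_vector \<Rightarrow> real" where
  "multiscale_error d s0 N J x = 4 * d * (s0 + 2 * norm x / N) + 14 * d * max 0 (norm x - 2 ^ J * s0 / 2)"

text \<open>At level \<open>j\<close> the finer interpolant is evaluated only after clipping to the box of that level, so
  level \<open>j\<close> contributes \<open>O(2^j s0)\<close> everywhere and the sum telescopes to the interpolant
  of the first level whose box contains \<open>x\<close>. The topmost level is compared to \<open>f 0 = 0\<close>.\<close>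

lemma multiscale_approximation:
  fixes f :: "real ^ 'd \<Rightarrow> real" and N J :: nat and s0 :: real and s :: "nat \<Rightarrow> real"
  assumes f: "1-lipschitz_on UNIV f" and f0: "f 0 = 0" and s0: "0 < s0" and N: "1 \<le> N"
  defines "s \<equiv> \<lambda>j. 2 ^ j * s0" and "M \<equiv> boxes N J"
  shows "\<bar>f x - (\<Sum>j\<le>J. \<Sum>p\<in>pairs (M j) (M (Suc j)). (f (gpt (s j) (fst p)) - f (gpt (2 * s j) (snd p)))
      * pbump (s j) (M j) (M (Suc j)) p x)\<bar> \<le> multiscale_error CARD('d) s0 N J x"
proof -
  define d where "d = real CARD('d)"
  have d1: "1 \<le> d" by (simp add: d_def Suc_leI)
  define A where "A j = interp (s j) (M j) f x - interp (s (Suc j)) (M (Suc j)) f (clipv (s j * M j) x)" for j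
  have s: "0 < s j" "s (Suc j) = 2 * s j" for j using s0 by (auto simp: s_def)
  have step: "M j \<le> 2 * M (Suc j) + 1" if "j \<le> J" for j unfolding M_def by (rule boxes_step[OF N that])
  have eq: "(\<Sum>p\<in>pairs (M j) (M (Suc j)). (f (gpt (s j) (fst p)) - f (gpt (2 * s j) (snd p)))
      * pbump (s j) (M j) (M (Suc j)) p x) = A j" if "j \<le> J" for j
    unfolding A_def s(2) by (rule interp_diff_eq[OF s(1) step[OF that], symmetric])
  have A_le: "\<bar>A j\<bar> \<le> 3 * d * s j" if j: "j \<le> J" for j
  proof -
    have "\<bar>A j\<bar> \<le> (\<Sum>p\<in>pairs (M j) (M (Suc j)). \<bar>(f (gpt (s j) (fst p)) - f (gpt (2 * s j) (snd p)))
      * pbump (s j) (M j) (M (Suc j)) p x\<bar>)" unfolding eq[OF j, symmetric] by (rule sum_abs)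
    also have "\<dots> \<le> (\<Sum>p\<in>pairs (M j) (M (Suc j)). 3 * d * s j * pbump (s j) (M j) (M (Suc j)) p x)"
      using gpt_diff_le[OF f s(1)] by (intro sum_mono) (simp add: abs_mult pbump_nonneg mult_right_mono d_def)
    also have "\<dots> = 3 * d * s j" by (simp add: sum_distrib_left[symmetric] sum_pbump[OF s(1) step[OF j]])
    finally show ?thesis .
  qed
  have ssum: "(\<Sum>j<k. s j) \<le> s k" for k
    using s0 by (induction k) (auto simp: s_def algebra_simps)
  have Mpos: "1 \<le> M j" if "j \<le> J" for j unfolding M_def by (rule boxes_ge_1[OF N that])
  have MJ: "M J = 1" "M (Suc J) = 0" using N by (auto simp: M_def boxes_def)
  have interp_top: "interp (s (Suc J)) (M (Suc J)) f y = 0" for y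
  proof -
    have "grid 0 = {\<lambda>_::'d. 0::int}" by (auto simp: grid_def PiE_iff)
    moreover have "gpt (s (Suc J)) (\<lambda>_. 0) = (0 :: real ^ 'd)" by (simp add: gpt_def vec_eq_iff)
    ultimately show ?thesis by (simp add: interp_def MJ f0)
  qed
  have "\<bar>f x - (\<Sum>j\<le>J. A j)\<bar> \<le> 4 * d * (s0 + 2 * norm x / N) + 14 * d * max 0 (norm x - 2 ^ J * s0 / 2)"
  proof (cases "\<forall>i. \<bar>x $ i\<bar> \<le> s J * M J")
    case True
    define k where "k = (LEAST j. \<forall>i. \<bar>x $ i\<bar> \<le> s j * M j)"
    have k: "\<bar>x $ i\<bar> \<le> s k * M k" for i
      using LeastI[of "\<lambda>j. \<forall>i. \<bar>x $ i\<bar> \<le> s j * M j" J] True by (auto simp: k_def)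
    have kJ: "k \<le> J" unfolding k_def using True by (intro Least_le) auto
    \<comment> \<open>The radii increase with the level, so from level \<open>k\<close> on clipping
      does not move \<open>x\<close> and the differences telescope.\<close>
    have rho_mono: "s i * M i \<le> s j * M j" if "i \<le> j" "j \<le> J" for i j
    proof -
      have "s i * min (real N) (2 ^ (J - i)) \<le> s j * min (real N) (2 ^ (J - j))"
      proof -
        have a: "s i * 2 ^ (J - i) = s0 * 2 ^ J" "s j * 2 ^ (J - j) = s0 * 2 ^ J"
          using that by (auto simp: s_def power_add[symmetric] mult.commute mult.left_commute)
        have b: "s i * N \<le> s j * N" using that s0 by (intro mult_right_mono) (auto simp: s_def)
        have c: "0 \<le> s i" "0 \<le> s j" using s by (auto intro: less_imp_le)
        have "s i * min (real N) (2 ^ (J - i)) = min (s i * N) (s0 * 2 ^ J)"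
          "s j * min (real N) (2 ^ (J - j)) = min (s j * N) (s0 * 2 ^ J)"
          using c by (auto simp: min_mult_distrib_left a)
        then show ?thesis using b by (simp add: min.coboundedI1)
      qed
      moreover have "real (M i) = min (real N) (2 ^ (J - i))" "real (M j) = min (real N) (2 ^ (J - j))"
        using that by (auto simp: M_def boxes_def of_nat_min)
      ultimately show ?thesis by simp
    qed
    have clip_id': "clipv (s j * M j) x = x" if "k \<le> j" "j \<le> J" for j
    proof -
      have "\<bar>x $ i\<bar> \<le> s j * M j" for i using k[of i] rho_mono[OF that] by linarith
      then show ?thesis by (simp add: clipv_def clip_id vec_eq_iff)
    qed
    have "(\<Sum>j\<le>J. A j) = (\<Sum>j<k. A j) + (\<Sum>j=k..J. A j)"
    proof -
      have "{..J} = {..<k} \<union> {k..J}" using kJ by auto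
      then show ?thesis by (simp add: sum.union_disjoint ivl_disj_int)
    qed
    also have "(\<Sum>j=k..J. A j) = (\<Sum>j=k..J. interp (s j) (M j) f x - interp (s (Suc j)) (M (Suc j)) f x)"
      by (rule sum.cong) (auto simp: A_def clip_id')
    also have "\<dots> = interp (s k) (M k) f x"
    proof -
      have "(\<Sum>j=k..J. interp (s j) (M j) f x - interp (s (Suc j)) (M (Suc j)) f x)
        = - (\<Sum>j=k..J. interp (s (Suc j)) (M (Suc j)) f x - interp (s j) (M j) f x)"
        by (simp add: sum_subtractf)
      also have "\<dots> = interp (s k) (M k) f x - interp (s (Suc J)) (M (Suc J)) f x"
        using kJ by (subst sum_Suc_diff) auto
      finally show ?thesis by (simp add: interp_top)
    qed
    finally have "\<bar>f x - (\<Sum>j\<le>J. A j)\<bar> \<le> \<bar>f x - interp (s k) (M k) f x\<bar> + \<bar>\<Sum>j<k. A j\<bar>" by simp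
    \<comment> \<open>One \<open>d * s k\<close> is the interpolation error at level
      \<open>k\<close>; the finer levels, where \<open>x\<close> is clipped, are bounded termwise
      and sum to at most \<open>3 * d * s k\<close>.\<close>
    also have "\<dots> \<le> d * s k + (\<Sum>j<k. 3 * d * s j)"
      using interp_error_le[OF f s(1) k] A_le kJ
      by (intro add_mono order_trans[OF sum_abs] sum_mono) (auto simp: d_def)
    also have "\<dots> \<le> d * s k + 3 * d * s k"
      using ssum[of k] d1 by (simp add: sum_distrib_left[symmetric])
    also have "\<dots> = 4 * d * s k" by simp
    also have "\<dots> \<le> 4 * d * (s0 + 2 * norm x / N)"
    proof -
      have "s k \<le> s0 + 2 * norm x / N"
      proof (cases k)
        case 0
        then show ?thesis using N by (simp add: s_def)
      next
        case (Suc j)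
        then have "\<not> (\<forall>i. \<bar>x $ i\<bar> \<le> s j * M j)"
          using not_less_Least[of j "\<lambda>j. \<forall>i. \<bar>x $ i\<bar> \<le> s j * M j"] by (simp add: k_def)
        then obtain i where i: "s j * M j < \<bar>x $ i\<bar>" by (auto simp: not_le)
        have jJ: "j \<le> J" using Suc kJ by simp
        \<comment> \<open>Otherwise the box of level \<open>j\<close> would already be the outer
          box, which contains \<open>x\<close>. Hence that box is limited by \<open>N\<close>, and
          \<open>x\<close> outside it means \<open>s j * N < norm x\<close>.\<close>
        have "M j \<noteq> 2 ^ (J - j)"
        proof
          assume "M j = 2 ^ (J - j)"
          then have "s j * M j = s J * M J" using jJ MJ
            by (simp add: s_def power_add[symmetric] mult.commute mult.left_commute)
          then show False using i True by (auto simp: not_le[symmetric])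
        qed
        then have "M j = N" using jJ by (auto simp: M_def boxes_def min_def split: if_splits)
        then have "s j * N < norm x" using i component_le_norm_cart[of x i] by simp
        then have "s k \<le> 2 * norm x / N" using N by (simp add: Suc s(2) field_simps)
        then show ?thesis using s0 by simp
      qed
      then show ?thesis using d1 by (intro mult_left_mono) auto
    qed
    finally show ?thesis using d1 by (simp add: add_increasing2)
  next
    case False
    \<comment> \<open>Outside the outermost box \<open>f\<close> and the level sums are bounded
      separately: by \<open>norm x\<close>, and, the meshes adding up to at most
      \<open>2 * s J\<close>, by \<open>6 * d * norm x\<close>.\<close>
    then obtain i where "s J < \<bar>x $ i\<bar>" by (auto simp: not_le MJ)
    then have R: "s J < norm x" using component_le_norm_cart[of x i] by simp
    have "\<bar>f x\<bar> \<le> norm x" using lipschitz_real_abs[OF f, of x 0] f0 by simp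
    moreover have "\<bar>\<Sum>j\<le>J. A j\<bar> \<le> (\<Sum>j\<le>J. 3 * d * s j)"
      using A_le by (intro order_trans[OF sum_abs] sum_mono) auto
    moreover have "(\<Sum>j\<le>J. 3 * d * s j) \<le> 6 * d * norm x"
    proof -
      have "(\<Sum>j\<le>J. s j) = (\<Sum>j<J. s j) + s J" by (simp add: lessThan_Suc_atMost[symmetric])
      also have "\<dots> \<le> 2 * norm x" using ssum[of J] R by simp
      finally have "3 * d * (\<Sum>j\<le>J. s j) \<le> 3 * d * (2 * norm x)" using d1 by (intro mult_left_mono) auto
      then show ?thesis by (simp add: sum_distrib_left)
    qed
    moreover have "norm x \<le> d * norm x" using d1 by (simp add: mult_le_cancel_right1)
    ultimately have "\<bar>f x - (\<Sum>j\<le>J. A j)\<bar> \<le> 7 * d * norm x" by simp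
    also have "\<dots> \<le> 14 * d * max 0 (norm x - 2 ^ J * s0 / 2)"
    proof -
      have "norm x \<le> 2 * (norm x - 2 ^ J * s0 / 2)" using R by (simp add: s_def)
      also have "\<dots> \<le> 2 * max 0 (norm x - 2 ^ J * s0 / 2)" by (rule mult_left_mono) auto
      finally have "7 * d * norm x \<le> 7 * d * (2 * max 0 (norm x - 2 ^ J * s0 / 2))" using d1 by (intro mult_left_mono) auto
      then show ?thesis by simp
    qed
    also have "\<dots> \<le> 4 * d * (s0 + 2 * norm x / N) + 14 * d * max 0 (norm x - 2 ^ J * s0 / 2)"
      using s0 d1 by simp
    finally show ?thesis .
  qed
  moreover have "(\<Sum>j\<le>J. \<Sum>p\<in>pairs (M j) (M (Suc j)). (f (gpt (s j) (fst p)) - f (gpt (2 * s j) (snd p)))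
      * pbump (s j) (M j) (M (Suc j)) p x) = (\<Sum>j\<le>J. A j)"
    by (rule sum.cong) (auto simp: eq)
  ultimately show ?thesis by (simp add: multiscale_error_def d_def)
qed

lemma multiscale_error_nonneg: "0 < s0 \<Longrightarrow> 0 \<le> multiscale_error d s0 N J x"
  by (simp add: multiscale_error_def)

lemma multiscale_error_lipschitz:
  "(8 * real d / N + 14 * real d)-lipschitz_on UNIV (multiscale_error d s0 N J :: 'a::euclidean_space \<Rightarrow> real)"
proof (rule lipschitz_realI)
  fix x y :: 'a
  have n: "norm x - norm y \<le> norm (x - y)" by (rule norm_triangle_ineq2)
  have mx: "max 0 (a - c) - max 0 (b - c) \<le> z" if "a - b \<le> z" "0 \<le> z" for a b c z :: real
    using that by (auto simp: max_def)
  have "8 * real d / N * (norm x - norm y) \<le> 8 * real d / N * norm (x - y)"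
    using n by (intro mult_left_mono) auto
  moreover have "14 * real d * (max 0 (norm x - 2 ^ J * s0 / 2) - max 0 (norm y - 2 ^ J * s0 / 2)) \<le> 14 * real d * norm (x - y)"
    by (rule mult_left_mono[OF mx[OF n]]) auto
  moreover have "multiscale_error d s0 N J x - multiscale_error d s0 N J y = 8 * real d / N * (norm x - norm y)
     + 14 * real d * (max 0 (norm x - 2 ^ J * s0 / 2) - max 0 (norm y - 2 ^ J * s0 / 2))"
    by (simp add: multiscale_error_def algebra_simps diff_divide_distrib add_divide_distrib)
  ultimately show "multiscale_error d s0 N J x - multiscale_error d s0 N J y \<le> (8 * real d / N + 14 * real d) * norm (x - y)"
    by (simp add: distrib_right)
qed simp

lemma pbump_lipschitz:
  fixes p :: "('d::finite \<Rightarrow> int) \<times> ('d \<Rightarrow> int)"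
  assumes "0 < s" "p \<in> pairs M M'"
  shows "(8 * CARD('d) / s)-lipschitz_on UNIV (pbump s M M' p)"
proof (rule lipschitz_realI)
  fix x y
  have "\<bar>pbump s M M' p x - pbump s M M' p y\<bar> \<le> (\<Sum>p\<in>pairs M M'. \<bar>pbump s M M' p x - pbump s M M' p y\<bar>)"
    using assms by (intro member_le_sum) (auto simp: finite_pairs)
  also have "\<dots> \<le> 8 * CARD('d) / s * norm (x - y)" by (rule sum_abs_pbump_diff_le[OF assms(1)])
  finally show "pbump s M M' p x - pbump s M M' p y \<le> 8 * CARD('d) / s * norm (x - y)" by simp
qed (use assms in simp)

text \<open>The supremum over \<open>f\<close> disappears: \<open>f\<close> enters only through
  coefficients bounded uniformly by \<open>gpt_diff_le\<close>, and what remains are the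
  fluctuations of finitely many fixed functions.\<close>

lemma kr_dual_le_multiscale:
  fixes \<pi> :: "(real ^ 'd) measure" and N J :: nat and s0 :: real and s :: "nat \<Rightarrow> real"
  assumes \<pi>: "\<pi> \<in> P1" and n: "1 \<le> n" and s0: "0 < s0" and N: "1 \<le> N"
  defines "s \<equiv> \<lambda>j. 2 ^ j * s0" and "M \<equiv> boxes N J" and "e \<equiv> multiscale_error CARD('d) s0 N J"
  shows "kr_dual \<pi> n x \<le> (\<Sum>i=1..n. e (x i)) / n + (\<integral>y. e y \<partial>\<pi>)
    + (\<Sum>j\<le>J. 3 * CARD('d) * s j * (\<Sum>p\<in>pairs (M j) (M (Suc j)).
        \<bar>(\<Sum>i=1..n. pbump (s j) (M j) (M (Suc j)) p (x i)) / n - (\<integral>y. pbump (s j) (M j) (M (Suc j)) p y \<partial>\<pi>)\<bar>))"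
proof (rule kr_dual_least)
  fix f :: "real ^ 'd \<Rightarrow> real" assume f: "1-lipschitz_on UNIV f" "f 0 = 0"
  interpret prob_space \<pi> using \<pi> by (simp add: P1D)
  define D where "D g = (\<Sum>i=1..n. g (x i)) / n - (\<integral>y. g y \<partial>\<pi>)" for g :: "real ^ 'd \<Rightarrow> real"
  define c where "c j p = f (gpt (s j) (fst p)) - f (gpt (2 * s j) (snd p))" for j p
  define \<psi> where "\<psi> j p = pbump (s j) (M j) (M (Suc j)) p" for j and p :: "('d \<Rightarrow> int) \<times> ('d \<Rightarrow> int)"
  define h where "h y = (\<Sum>j\<le>J. \<Sum>p\<in>pairs (M j) (M (Suc j)). c j p * \<psi> j p y)" for y
  have s: "0 < s j" for j using s0 by (simp add: s_def)
  have \<psi>i: "integrable \<pi> (\<psi> j p)" if "p \<in> pairs (M j) (M (Suc j))" for j p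
    unfolding \<psi>_def by (rule lipschitz_integrable[OF \<pi> pbump_lipschitz[OF s that]])
  have hi: "integrable \<pi> h" unfolding h_def using \<psi>i by auto
  have ei: "integrable \<pi> e" unfolding e_def by (rule lipschitz_integrable[OF \<pi> multiscale_error_lipschitz])
  have fi: "integrable \<pi> f" by (rule lipschitz_integrable[OF \<pi> f(1)])
  have fh: "\<bar>f y - h y\<bar> \<le> e y" for y
    unfolding h_def c_def \<psi>_def e_def s_def M_def
    by (rule multiscale_approximation[OF f s0 N])
  have "D f - D h = (\<Sum>i=1..n. f (x i) - h (x i)) / n + (\<integral>y. h y - f y \<partial>\<pi>)"
    using fi hi by (simp add: D_def sum_subtractf diff_divide_distrib)
  also have "\<dots> \<le> (\<Sum>i=1..n. e (x i)) / n + (\<integral>y. e y \<partial>\<pi>)"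
    using fh fi hi ei by (intro add_mono divide_right_mono sum_mono integral_mono) (auto simp: abs_le_iff)
  finally have 1: "D f - D h \<le> (\<Sum>i=1..n. e (x i)) / n + (\<integral>y. e y \<partial>\<pi>)" .
  have "D h = (\<Sum>j\<le>J. \<Sum>p\<in>pairs (M j) (M (Suc j)). c j p * D (\<psi> j p))"
  proof -
    have "(\<Sum>i=1..n. h (x i)) = (\<Sum>j\<le>J. \<Sum>p\<in>pairs (M j) (M (Suc j)). c j p * (\<Sum>i=1..n. \<psi> j p (x i)))"
      unfolding h_def sum_distrib_left
      by (subst sum.swap, rule sum.cong[OF refl], subst sum.swap, rule refl)
    moreover have "(\<integral>y. h y \<partial>\<pi>) = (\<Sum>j\<le>J. \<Sum>p\<in>pairs (M j) (M (Suc j)). c j p * (\<integral>y. \<psi> j p y \<partial>\<pi>))"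
      unfolding h_def using \<psi>i by (simp add: Bochner_Integration.integral_sum Bochner_Integration.integrable_sum)
    ultimately show ?thesis
      by (simp add: D_def right_diff_distrib sum_subtractf sum_divide_distrib[symmetric])
  qed
  also have "\<dots> \<le> (\<Sum>j\<le>J. \<Sum>p\<in>pairs (M j) (M (Suc j)). 3 * CARD('d) * s j * \<bar>D (\<psi> j p)\<bar>)"
  proof (intro sum_mono)
    fix j and p :: "('d \<Rightarrow> int) \<times> ('d \<Rightarrow> int)" assume "p \<in> pairs (M j) (M (Suc j))"
    then have "\<bar>c j p\<bar> \<le> 3 * CARD('d) * s j" unfolding c_def by (rule gpt_diff_le[OF f(1) s])
    then have "\<bar>c j p * D (\<psi> j p)\<bar> \<le> 3 * CARD('d) * s j * \<bar>D (\<psi> j p)\<bar>"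
      unfolding abs_mult by (rule mult_right_mono) simp
    then show "c j p * D (\<psi> j p) \<le> 3 * CARD('d) * s j * \<bar>D (\<psi> j p)\<bar>" by simp
  qed
  also have "\<dots> = (\<Sum>j\<le>J. 3 * CARD('d) * s j * (\<Sum>p\<in>pairs (M j) (M (Suc j)). \<bar>D (\<psi> j p)\<bar>))"
    by (simp add: sum_distrib_left)
  finally have "D f \<le> (\<Sum>i=1..n. e (x i)) / n + (\<integral>y. e y \<partial>\<pi>)
    + (\<Sum>j\<le>J. 3 * CARD('d) * s j * (\<Sum>p\<in>pairs (M j) (M (Suc j)). \<bar>D (\<psi> j p)\<bar>))"
    using 1 by simp
  then show "(\<Sum>i=1..n. f (x i)) / n - (\<integral>y. f y \<partial>\<pi>) \<le> (\<Sum>i=1..n. e (x i)) / n + (\<integral>y. e y \<partial>\<pi>)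
    + (\<Sum>j\<le>J. 3 * CARD('d) * s j * (\<Sum>p\<in>pairs (M j) (M (Suc j)).
        \<bar>(\<Sum>i=1..n. pbump (s j) (M j) (M (Suc j)) p (x i)) / n - (\<integral>y. pbump (s j) (M j) (M (Suc j)) p y \<partial>\<pi>)\<bar>))"
    by (simp add: D_def \<psi>_def)
qed

section \<open>Concentration for functionals of the chain\<close>

context contractive_kernel
begin

abbreviation path_space :: "(nat \<Rightarrow> 'a) measure" where
  "path_space \<equiv> \<Pi>\<^sub>M i\<in>UNIV. borel"

abbreviation Q :: "'a \<Rightarrow> (nat \<Rightarrow> 'a) measure" where
  "Q x \<equiv> chain_law P x"

lemma sets_Q[measurable_cong]: "sets (Q x) = sets path_space"
  by (rule sets_chain_law[OF kernel])

lemma prob_Q: "prob_space (Q x)"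
  by (rule prob_space_chain_law[OF kernel])

lemma space_Q: "space (Q x) = UNIV"
  using sets_eq_imp_space_eq[OF sets_Q] by (simp add: space_PiM)

text \<open>The Markov property is available on rectangles (\<open>chain_law_markov\<close>). They
  form a generator stable under intersection, which identifies the joint law of the past and the
  next state with \<open>Q x \<bind> \<kappa>\<close>; integration then covers every nonnegative
  \<open>H\<close>.\<close>

lemma markov_nn:
  fixes H :: "(nat \<Rightarrow> 'a) \<Rightarrow> ennreal"
  assumes H[measurable]: "H \<in> borel_measurable path_space"
    and dep: "\<And>\<omega> \<omega>'. (\<And>i. i \<le> Suc k \<Longrightarrow> \<omega> i = \<omega>' i) \<Longrightarrow> H \<omega> = H \<omega>'"
  shows "(\<integral>\<^sup>+\<omega>. H \<omega> \<partial>Q x) = (\<integral>\<^sup>+\<omega>. \<integral>\<^sup>+y. H (fun_upd \<omega> (Suc k) y) \<partial>P (\<omega> k) \<partial>Q x)"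
proof -
  interpret Q: prob_space "Q x" by (rule prob_Q)
  define N where "N = (\<Pi>\<^sub>M i\<in>{0..<Suc k}. borel :: 'a measure)"
  define R where "R \<omega> = restrict \<omega> {0..<Suc k}" for \<omega> :: "nat \<Rightarrow> 'a"
  define \<kappa> where "\<kappa> \<omega> = distr (P (\<omega> k)) (N \<Otimes>\<^sub>M borel) (\<lambda>y. (R \<omega>, y))" for \<omega>
  \<comment> \<open>The coordinates beyond \<open>Suc k\<close> are filled with the default 0, which
    by \<open>dep\<close> leaves the value of \<open>H\<close> unchanged.\<close>
  define H' where "H' z = H (\<lambda>i. if i = Suc k then snd z else if i \<le> k then fst z i else 0)" for z :: "(nat \<Rightarrow> 'a) \<times> 'a"
  have R[measurable]: "R \<in> path_space \<rightarrow>\<^sub>M N" unfolding R_def N_def by (rule measurable_restrict_subset) simp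
  have \<kappa>[measurable]: "\<kappa> \<in> path_space \<rightarrow>\<^sub>M subprob_algebra (N \<Otimes>\<^sub>M borel)"
    unfolding \<kappa>_def by (rule measurable_distr2[where M=borel]) measurable
  have \<kappa>'[measurable]: "\<kappa> \<in> Q x \<rightarrow>\<^sub>M subprob_algebra (N \<Otimes>\<^sub>M borel)" by measurable
  have [measurable]: "H' \<in> borel_measurable (N \<Otimes>\<^sub>M borel)"
  proof -
    have "(\<lambda>z. (\<lambda>i. if i = Suc k then snd z else if i \<le> k then fst z i else 0)) \<in> N \<Otimes>\<^sub>M borel \<rightarrow>\<^sub>M path_space"
    proof (rule measurable_PiM_single')
      fix i :: nat
      show "(\<lambda>z. if i = Suc k then snd z else if i \<le> k then fst z i else 0) \<in> borel_measurable (N \<Otimes>\<^sub>M borel)"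
      proof (cases "i \<le> k")
        case True
        then have "(\<lambda>f. f i) \<in> N \<rightarrow>\<^sub>M borel" unfolding N_def by (intro measurable_component_singleton) simp
        then show ?thesis using True by simp
      next
        case False
        then show ?thesis by (cases "i = Suc k") auto
      qed
    qed simp
    then show ?thesis unfolding H'_def by measurable
  qed
  have Rm: "(\<lambda>\<omega>. (R \<omega>, \<omega> (Suc k))) \<in> Q x \<rightarrow>\<^sub>M N \<Otimes>\<^sub>M borel" by measurable
  have eq: "distr (Q x) (N \<Otimes>\<^sub>M borel) (\<lambda>\<omega>. (R \<omega>, \<omega> (Suc k))) = Q x \<bind> \<kappa>" (is "?D = ?B")
  proof (rule measure_eqI_generator_eq[OF Int_stable_pair_measure_generator[of N borel]])
    have sB: "sets ?B = sets (N \<Otimes>\<^sub>M borel)" by (rule sets_bind[OF _ ]) (auto simp: \<kappa>_def space_Q)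
    show "sets ?B = sigma_sets (space N \<times> space borel) {a \<times> b |a b. a \<in> sets N \<and> b \<in> sets (borel :: 'a measure)}"
      unfolding sB by (rule sets_pair_measure)
    show "sets ?D = sigma_sets (space N \<times> space borel) {a \<times> b |a b. a \<in> sets N \<and> b \<in> sets (borel :: 'a measure)}"
      by (simp add: sets_pair_measure)
    show "{a \<times> b |a b. a \<in> sets N \<and> b \<in> sets (borel :: 'a measure)} \<subseteq> Pow (space N \<times> space borel)"
      by (auto dest: sets.sets_into_space)
    show "range (\<lambda>_::nat. space N \<times> space (borel :: 'a measure)) \<subseteq> {a \<times> b |a b. a \<in> sets N \<and> b \<in> sets borel}"
      by (intro image_subsetI CollectI exI[of _ "space N"] exI[of _ "space borel"] conjI refl sets.top)
    show "(\<Union>i::nat. space N \<times> space (borel :: 'a measure)) = space N \<times> space borel" by simp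
    show "emeasure ?D (space N \<times> space borel) \<noteq> \<infinity>" for i :: nat
    proof -
      have "prob_space ?D" by (rule Q.prob_space_distr) measurable
      then show ?thesis by (simp add: finite_measure.emeasure_finite prob_space_def)
    qed
    fix X assume "X \<in> {a \<times> b |a b. a \<in> sets N \<and> b \<in> sets (borel :: 'a measure)}"
    then obtain A B where X: "X = A \<times> B" and A[measurable]: "A \<in> sets N" and B[measurable]: "B \<in> sets borel" by auto
    have "emeasure ?D X = emeasure (Q x) {\<omega>. restrict \<omega> {0..<Suc k} \<in> A \<and> \<omega> (Suc k) \<in> B}"
      unfolding X by (subst emeasure_distr[OF Rm]) (auto simp: R_def space_Q intro!: arg_cong[where f="emeasure (Q x)"])
    also have "\<dots> = (\<integral>\<^sup>+\<omega>. indicator A (restrict \<omega> {0..<Suc k}) * emeasure (P (\<omega> k)) B \<partial>Q x)"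
      by (rule chain_law_markov[OF kernel]) (use A B in \<open>auto simp: N_def\<close>)
    also have "\<dots> = (\<integral>\<^sup>+\<omega>. emeasure (\<kappa> \<omega>) X \<partial>Q x)"
    proof (rule nn_integral_cong)
      fix \<omega>
      have sP: "sets (P (\<omega> k)) = sets borel" by (rule P1D(2)[OF P_P1])
      have RN: "R \<omega> \<in> space N" by (auto simp: R_def N_def space_PiM)
      have m: "(\<lambda>y. (R \<omega>, y)) \<in> P (\<omega> k) \<rightarrow>\<^sub>M N \<Otimes>\<^sub>M borel"
        using RN unfolding measurable_cong_sets[OF sP refl] by measurable
      have "emeasure (\<kappa> \<omega>) X = emeasure (P (\<omega> k)) ((\<lambda>y. (R \<omega>, y)) -` X \<inter> space (P (\<omega> k)))"
        unfolding \<kappa>_def by (rule emeasure_distr[OF m]) (simp add: X)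
      also have "(\<lambda>y. (R \<omega>, y)) -` X \<inter> space (P (\<omega> k)) = (if R \<omega> \<in> A then B else {})"
        using P1D(4)[OF P_P1] by (auto simp: X)
      finally show "indicator A (restrict \<omega> {0..<Suc k}) * emeasure (P (\<omega> k)) B = emeasure (\<kappa> \<omega>) X"
        by (simp add: R_def)
    qed
    also have "\<dots> = emeasure ?B X"
      by (rule emeasure_bind[symmetric, where N="N \<Otimes>\<^sub>M borel"]) (auto simp: space_Q X)
    finally show "emeasure ?D X = emeasure ?B X" .
  qed
  have "(\<integral>\<^sup>+\<omega>. H \<omega> \<partial>Q x) = (\<integral>\<^sup>+\<omega>. H' (R \<omega>, \<omega> (Suc k)) \<partial>Q x)"
    unfolding H'_def by (intro nn_integral_cong dep) (auto simp: R_def)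
  also have "\<dots> = (\<integral>\<^sup>+z. H' z \<partial>?D)" by (subst nn_integral_distr) auto
  also have "\<dots> = (\<integral>\<^sup>+\<omega>. \<integral>\<^sup>+z. H' z \<partial>\<kappa> \<omega> \<partial>Q x)"
    unfolding eq by (rule nn_integral_bind) measurable
  also have "\<dots> = (\<integral>\<^sup>+\<omega>. \<integral>\<^sup>+y. H (fun_upd \<omega> (Suc k) y) \<partial>P (\<omega> k) \<partial>Q x)"
  proof (rule nn_integral_cong)
    fix \<omega>
    have sP: "sets (P (\<omega> k)) = sets borel" by (rule P1D(2)[OF P_P1])
    have RN: "R \<omega> \<in> space N" by (auto simp: R_def N_def space_PiM)
    have m: "(\<lambda>y. (R \<omega>, y)) \<in> P (\<omega> k) \<rightarrow>\<^sub>M N \<Otimes>\<^sub>M borel"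
      using RN unfolding measurable_cong_sets[OF sP refl] by measurable
    have "(\<integral>\<^sup>+z. H' z \<partial>\<kappa> \<omega>) = (\<integral>\<^sup>+y. H' (R \<omega>, y) \<partial>P (\<omega> k))"
      unfolding \<kappa>_def by (subst nn_integral_distr[OF m]) auto
    also have "\<dots> = (\<integral>\<^sup>+y. H (fun_upd \<omega> (Suc k) y) \<partial>P (\<omega> k))"
      unfolding H'_def by (intro nn_integral_cong dep) (auto simp: R_def)
    finally show "(\<integral>\<^sup>+z. H' z \<partial>\<kappa> \<omega>) = (\<integral>\<^sup>+y. H (fun_upd \<omega> (Suc k) y) \<partial>P (\<omega> k))" .
  qed
  finally show ?thesis .
qed

lemma AE_start: "AE \<omega> in Q x. \<omega> 0 = x"
proof -
  have m: "(\<lambda>\<omega>. \<omega> 0) \<in> Q x \<rightarrow>\<^sub>M borel" by measurable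
  have "AE y in return borel x. y = x" by (subst AE_return) auto
  then have "AE y in distr (Q x) borel (\<lambda>\<omega>. \<omega> 0). y = x"
    unfolding chain_law_start[OF kernel] .
  then show ?thesis by (subst (asm) AE_distr_iff[OF m]) auto
qed

text \<open>The last coordinate has its own constant because, once later states are integrated out,
  it also carries their dependence on it. Coordinate 0 counts only for \<open>k = 0\<close>.\<close>

definition path_lip :: "real \<Rightarrow> real \<Rightarrow> nat \<Rightarrow> ((nat \<Rightarrow> 'a) \<Rightarrow> real) \<Rightarrow> bool" where
  "path_lip c l k G \<longleftrightarrow> (\<forall>\<omega> \<omega>'. \<bar>G \<omega> - G \<omega>'\<bar> \<le> c * (\<Sum>i\<in>{1..<k}. norm (\<omega> i - \<omega>' i)) + l * norm (\<omega> k - \<omega>' k))"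

text \<open>The conditional expectation given the states up to time \<open>k\<close>, for
  \<open>G\<close> depending on those up to \<open>Suc k\<close>.\<close>

definition step :: "nat \<Rightarrow> ((nat \<Rightarrow> 'a) \<Rightarrow> real) \<Rightarrow> (nat \<Rightarrow> 'a) \<Rightarrow> real" where
  "step k G \<omega> = (\<integral>y. G (fun_upd \<omega> (Suc k) y) \<partial>P (\<omega> k))"

lemma path_lip_measurable:
  assumes G: "path_lip c l k G" and c: "0 \<le> c" "0 \<le> l"
  shows "G \<in> borel_measurable path_space"
proof -
  have "continuous_on UNIV G"
  proof (rule continuous_on_coordinate_lipschitz[where I="{..k}" and L="\<lambda>_. c + l"])
    fix \<omega> \<omega>'
    have "\<bar>G \<omega> - G \<omega>'\<bar> \<le> c * (\<Sum>i\<in>{1..<k}. norm (\<omega> i - \<omega>' i)) + l * norm (\<omega> k - \<omega>' k)"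
      using G by (simp add: path_lip_def)
    also have "\<dots> \<le> c * (\<Sum>i\<in>{..k}. norm (\<omega> i - \<omega>' i)) + l * (\<Sum>i\<in>{..k}. norm (\<omega> i - \<omega>' i))"
      using c by (intro add_mono mult_left_mono sum_mono2 member_le_sum) auto
    also have "\<dots> = (\<Sum>i\<in>{..k}. (c + l) * norm (\<omega> i - \<omega>' i))"
      by (simp add: sum_distrib_left distrib_right sum.distrib)
    finally show "\<bar>G \<omega> - G \<omega>'\<bar> \<le> (\<Sum>i\<in>{..k}. (c + l) * norm (\<omega> i - \<omega>' i))" .
  qed
  then show ?thesis
    unfolding measurable_cong_sets[OF sets_PiM_equal_borel refl] by (rule borel_measurable_continuous_onI)
qed

lemma path_lip_dep:
  assumes "path_lip c l k G" "\<And>i. i \<le> k \<Longrightarrow> \<omega> i = \<omega>' i"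
  shows "G \<omega> = G \<omega>'"
  using assms(1)[unfolded path_lip_def, rule_format, of \<omega> \<omega>'] assms(2) by simp

lemma path_lip_last:
  assumes "path_lip c l (Suc k) G" "0 \<le> l"
  shows "l-lipschitz_on UNIV (\<lambda>y. G (fun_upd \<omega> (Suc k) y))"
proof (rule lipschitz_realI)
  fix y z
  show "G (fun_upd \<omega> (Suc k) y) - G (fun_upd \<omega> (Suc k) z) \<le> l * norm (y - z)"
    using assms(1)[unfolded path_lip_def, rule_format, of "fun_upd \<omega> (Suc k) y" "fun_upd \<omega> (Suc k) z"] by simp
qed fact

text \<open>Moving the state at time \<open>k\<close> acts on \<open>G\<close> directly, with weight
  \<open>c\<close>, and through the law of the next state, with weight \<open>r * l\<close>. The
  condition \<open>c + r * l <= l\<close> makes \<open>l\<close> reproduce itself; its least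
  solution is \<open>c / (1 - r)\<close>.\<close>

lemma path_lip_step:
  assumes G: "path_lip c l (Suc k) G" and c: "0 \<le> c" "0 \<le> l" "c + r * l \<le> l"
  shows "path_lip c l k (step k G)"
  unfolding path_lip_def
proof (intro allI)
  fix \<omega> \<omega>'
  have "step k G \<omega> - step k G \<omega>' \<le> c * (\<Sum>i\<in>{1..<k}. norm (\<omega> i - \<omega>' i)) + l * norm (\<omega> k - \<omega>' k)" for \<omega> \<omega>'
  proof -
    interpret prob_space "P (\<omega>' k)" by (rule prob_P)
    define S where "S = (\<Sum>i\<in>{1..<Suc k}. norm (\<omega> i - \<omega>' i))"
    note L = path_lip_last[OF G c(2)]
    have i: "integrable (P z) (\<lambda>y. G (fun_upd \<omega> (Suc k) y))" for z \<omega>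
      by (rule lipschitz_integrable[OF P_P1 L])
    have "step k G \<omega> - (\<integral>y. G (fun_upd \<omega> (Suc k) y) \<partial>P (\<omega>' k)) \<le> l * (r * norm (\<omega> k - \<omega>' k))"
      unfolding step_def using r_nonneg by (intro integral_diff_le_W1[OF P_P1 P_P1 L contraction]) simp
    moreover have "(\<integral>y. G (fun_upd \<omega> (Suc k) y) \<partial>P (\<omega>' k)) \<le> step k G \<omega>' + c * S"
    proof -
      have "(\<integral>y. G (fun_upd \<omega> (Suc k) y) \<partial>P (\<omega>' k)) \<le> (\<integral>y. G (fun_upd \<omega>' (Suc k) y) + c * S \<partial>P (\<omega>' k))"
      proof (rule integral_mono)
        fix y
        have "(\<Sum>i\<in>{1..<Suc k}. norm ((fun_upd \<omega> (Suc k) y) i - (fun_upd \<omega>' (Suc k) y) i)) = S"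
          unfolding S_def by (rule sum.cong) auto
        then show "G (fun_upd \<omega> (Suc k) y) \<le> G (fun_upd \<omega>' (Suc k) y) + c * S"
          using G[unfolded path_lip_def, rule_format, of "fun_upd \<omega> (Suc k) y" "fun_upd \<omega>' (Suc k) y"] by simp
      qed (use i in auto)
      then show ?thesis using i by (simp add: step_def prob_space)
    qed
    moreover have "S \<le> (\<Sum>i\<in>{1..<k}. norm (\<omega> i - \<omega>' i)) + norm (\<omega> k - \<omega>' k)"
      unfolding S_def by (cases k) auto
    then have "c * S \<le> c * (\<Sum>i\<in>{1..<k}. norm (\<omega> i - \<omega>' i)) + c * norm (\<omega> k - \<omega>' k)"
      using c by (metis distrib_left mult_left_mono)
    moreover have "(c + r * l) * norm (\<omega> k - \<omega>' k) \<le> l * norm (\<omega> k - \<omega>' k)"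
      using c by (intro mult_right_mono) auto
    ultimately show ?thesis by (simp add: algebra_simps)
  qed
  from this[of \<omega> \<omega>'] this[of \<omega>' \<omega>]
  show "\<bar>step k G \<omega> - step k G \<omega>'\<bar> \<le> c * (\<Sum>i\<in>{1..<k}. norm (\<omega> i - \<omega>' i)) + l * norm (\<omega> k - \<omega>' k)"
    by (simp add: abs_le_iff norm_minus_commute)
qed

text \<open>Backward induction: \<open>g x\<close> is the conditional expectation of \<open>G\<close> given \<open>X\<^sub>0 = x\<close>, and each step of
  the Doob martingale is subgaussian because the conditional expectations stay \<open>l\<close>-Lipschitz in
  the last coordinate.\<close>

lemma path_concentration:
  assumes "path_lip c l k G" and c: "0 \<le> c" "0 \<le> l" "c + r * l \<le> l"
  shows "\<exists>g. l-lipschitz_on UNIV g \<and>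
    (\<forall>x t. (\<integral>\<^sup>+\<omega>. ennreal (exp (t * G \<omega>)) \<partial>Q x) \<le> ennreal (exp (t * g x + k * (C / 4 * (t * l)\<^sup>2)))) \<and>
    ((\<forall>\<omega>. 0 \<le> G \<omega>) \<longrightarrow> (\<forall>x. 0 \<le> g x \<and> (\<integral>\<^sup>+\<omega>. ennreal (G \<omega>) \<partial>Q x) = ennreal (g x)))"
  using assms(1)
proof (induction k arbitrary: G)
  case 0
  define g where "g x = G (\<lambda>_. x)" for x
  have AE: "AE \<omega> in Q x. G \<omega> = g x" for x
    using AE_start[of x]
  proof eventually_elim
    fix \<omega> :: "nat \<Rightarrow> 'a" assume "\<omega> 0 = x"
    then show "G \<omega> = g x" unfolding g_def by (intro path_lip_dep[OF 0]) simp
  qed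
  have "l-lipschitz_on UNIV g"
    using 0[unfolded path_lip_def, rule_format, of "\<lambda>_. x" "\<lambda>_. y" for x y] c
    by (intro lipschitz_realI) (auto simp: g_def abs_le_iff)
  moreover have "(\<integral>\<^sup>+\<omega>. ennreal (exp (t * G \<omega>)) \<partial>Q x) = ennreal (exp (t * g x))" for x t
  proof -
    interpret prob_space "Q x" by (rule prob_Q)
    have "(\<integral>\<^sup>+\<omega>. ennreal (exp (t * G \<omega>)) \<partial>Q x) = (\<integral>\<^sup>+\<omega>. ennreal (exp (t * g x)) \<partial>Q x)"
      using AE[of x] by (intro nn_integral_cong_AE) auto
    then show ?thesis by (simp add: emeasure_space_1)
  qed
  moreover have "(\<integral>\<^sup>+\<omega>. ennreal (G \<omega>) \<partial>Q x) = ennreal (g x)" for x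
  proof -
    interpret prob_space "Q x" by (rule prob_Q)
    have "(\<integral>\<^sup>+\<omega>. ennreal (G \<omega>) \<partial>Q x) = (\<integral>\<^sup>+\<omega>. ennreal (g x) \<partial>Q x)"
      using AE[of x] by (intro nn_integral_cong_AE) auto
    then show ?thesis by (simp add: emeasure_space_1)
  qed
  ultimately show ?case by (intro exI[of _ g]) (auto simp: g_def)
next
  case (Suc k)
  have G[measurable]: "G \<in> borel_measurable path_space" by (rule path_lip_measurable[OF Suc.prems c(1,2)])
  have S: "path_lip c l k (step k G)" by (rule path_lip_step[OF Suc.prems c])
  note L = path_lip_last[OF Suc.prems c(2)]
  from Suc.IH[OF S] obtain g where g: "l-lipschitz_on UNIV g"
    and g1: "\<And>x t. (\<integral>\<^sup>+\<omega>. ennreal (exp (t * step k G \<omega>)) \<partial>Q x) \<le> ennreal (exp (t * g x + k * (C / 4 * (t * l)\<^sup>2)))"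
    and g2: "(\<forall>\<omega>. 0 \<le> step k G \<omega>) \<Longrightarrow> (\<forall>x. 0 \<le> g x \<and> (\<integral>\<^sup>+\<omega>. ennreal (step k G \<omega>) \<partial>Q x) = ennreal (g x))"
    by blast
  have dep: "G \<omega> = G \<omega>'" if "\<And>i. i \<le> Suc k \<Longrightarrow> \<omega> i = \<omega>' i" for \<omega> \<omega>'
    using path_lip_dep[OF Suc.prems that] .
  have "(\<integral>\<^sup>+\<omega>. ennreal (exp (t * G \<omega>)) \<partial>Q x) \<le> ennreal (exp (t * g x + Suc k * (C / 4 * (t * l)\<^sup>2)))" for x t
  proof -
    have "(\<integral>\<^sup>+\<omega>. ennreal (exp (t * G \<omega>)) \<partial>Q x) = (\<integral>\<^sup>+\<omega>. \<integral>\<^sup>+y. ennreal (exp (t * G (fun_upd \<omega> (Suc k) y))) \<partial>P (\<omega> k) \<partial>Q x)"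
      by (rule markov_nn) (auto intro: arg_cong[OF dep])
    also have "\<dots> \<le> (\<integral>\<^sup>+\<omega>. ennreal (exp (C / 4 * (t * l)\<^sup>2)) * ennreal (exp (t * step k G \<omega>)) \<partial>Q x)"
    proof (rule nn_integral_mono)
      fix \<omega>
      have "(\<bar>t\<bar> * l)-lipschitz_on UNIV (\<lambda>y. t * G (fun_upd \<omega> (Suc k) y))"
      proof (rule lipschitz_onI)
        fix y z
        have "dist (t * G (fun_upd \<omega> (Suc k) y)) (t * G (fun_upd \<omega> (Suc k) z))
          = \<bar>t\<bar> * dist (G (fun_upd \<omega> (Suc k) y)) (G (fun_upd \<omega> (Suc k) z))"
          unfolding dist_real_def by (simp only: right_diff_distrib[symmetric] abs_mult)
        also have "\<dots> \<le> \<bar>t\<bar> * (l * dist y z)"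
          by (rule mult_left_mono[OF lipschitz_onD[OF L UNIV_I UNIV_I]]) simp
        finally show "dist (t * G (fun_upd \<omega> (Suc k) y)) (t * G (fun_upd \<omega> (Suc k) z)) \<le> \<bar>t\<bar> * l * dist y z"
          by simp
      qed (use c in simp)
      from subgaussian_nn_integral[OF P_P1 subgaussian_P this, of "\<omega> k"]
      show "(\<integral>\<^sup>+y. ennreal (exp (t * G (fun_upd \<omega> (Suc k) y))) \<partial>P (\<omega> k)) \<le> ennreal (exp (C / 4 * (t * l)\<^sup>2)) * ennreal (exp (t * step k G \<omega>))"
        by (simp add: step_def exp_add ennreal_mult[symmetric] power_mult_distrib mult.commute)
    qed
    also have "\<dots> = ennreal (exp (C / 4 * (t * l)\<^sup>2)) * (\<integral>\<^sup>+\<omega>. ennreal (exp (t * step k G \<omega>)) \<partial>Q x)"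
      using path_lip_measurable[OF S c(1,2)] by (intro nn_integral_cmult) measurable
    also have "\<dots> \<le> ennreal (exp (C / 4 * (t * l)\<^sup>2)) * ennreal (exp (t * g x + k * (C / 4 * (t * l)\<^sup>2)))"
      by (intro mult_left_mono g1) simp
    also have "\<dots> = ennreal (exp (t * g x + Suc k * (C / 4 * (t * l)\<^sup>2)))"
      by (simp add: ennreal_mult[symmetric] exp_add[symmetric] algebra_simps)
    finally show ?thesis .
  qed
  moreover have "0 \<le> g x \<and> (\<integral>\<^sup>+\<omega>. ennreal (G \<omega>) \<partial>Q x) = ennreal (g x)" if G0: "\<forall>\<omega>. 0 \<le> G \<omega>" for x
  proof -
    have "\<forall>\<omega>. 0 \<le> step k G \<omega>" using G0 by (auto simp: step_def)
    note g2 = g2[OF this]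
    have "(\<integral>\<^sup>+\<omega>. ennreal (G \<omega>) \<partial>Q x) = (\<integral>\<^sup>+\<omega>. \<integral>\<^sup>+y. ennreal (G (fun_upd \<omega> (Suc k) y)) \<partial>P (\<omega> k) \<partial>Q x)"
      by (rule markov_nn) (auto intro: arg_cong[OF dep])
    also have "\<dots> = (\<integral>\<^sup>+\<omega>. ennreal (step k G \<omega>) \<partial>Q x)"
      unfolding step_def
      using G0 by (intro nn_integral_cong nn_integral_eq_integral lipschitz_integrable[OF P_P1 L]) auto
    finally show ?thesis using g2 by simp
  qed
  ultimately show ?case using g by blast
qed

end

section \<open>Moments and correlations along the chain\<close>

lemma lipschitz_times:
  fixes f g :: "'a::euclidean_space \<Rightarrow> real"
  assumes f: "L-lipschitz_on UNIV f" "\<And>x. \<bar>f x\<bar> \<le> A" and g: "M-lipschitz_on UNIV g" "\<And>x. \<bar>g x\<bar> \<le> B"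
  shows "(L * B + A * M)-lipschitz_on UNIV (\<lambda>x. f x * g x)"
proof (rule lipschitz_realI)
  have L: "0 \<le> L" "0 \<le> M" using f g by (auto intro: lipschitz_on_nonneg)
  have AB: "0 \<le> A" "0 \<le> B" using f(2)[of 0] g(2)[of 0] by linarith+
  show "0 \<le> L * B + A * M" using L AB by simp
  fix x y
  have "f x * g x - f y * g y = (f x - f y) * g x + f y * (g x - g y)" by (simp add: algebra_simps)
  also have "\<dots> \<le> \<bar>f x - f y\<bar> * \<bar>g x\<bar> + \<bar>f y\<bar> * \<bar>g x - g y\<bar>"
    by (metis abs_ge_self abs_mult add_mono)
  also have "\<dots> \<le> (L * norm (x - y)) * B + A * (M * norm (x - y))"
    using lipschitz_real_abs[OF f(1)] lipschitz_real_abs[OF g(1)] f(2) g(2) L AB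
    by (intro add_mono mult_mono) auto
  finally show "f x * g x - f y * g y \<le> (L * B + A * M) * norm (x - y)" by (simp add: algebra_simps)
qed

text \<open>Only pairs with \<open>i <= j\<close> are kept, since the Markov property averages the
  later factor back to the earlier time. Doubling the diagonal costs a nonnegative term.\<close>

lemma power2_sum_le:
  fixes y :: "nat \<Rightarrow> real"
  shows "(\<Sum>i=1..n. y i)\<^sup>2 \<le> 2 * (\<Sum>j=1..n. \<Sum>i=1..j. y i * y j)"
proof (induction n)
  case (Suc n)
  have "(\<Sum>i=1..Suc n. y i)\<^sup>2 = (\<Sum>i=1..n. y i)\<^sup>2 + 2 * ((\<Sum>i=1..n. y i) * y (Suc n)) + (y (Suc n))\<^sup>2"
    by (simp add: power2_sum)
  also have "\<dots> \<le> 2 * (\<Sum>j=1..n. \<Sum>i=1..j. y i * y j) + 2 * ((\<Sum>i=1..n. y i) * y (Suc n) + y (Suc n) * y (Suc n))"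
  proof -
    have "u + 2 * v + w \<le> 2 * t + 2 * (v + w)" if "u \<le> 2 * t" "0 \<le> w" for u v w t :: real
      using that by simp
    from this[OF Suc[unfolded power2_eq_square] zero_le_square] show ?thesis
      by (simp only: power2_eq_square)
  qed
  also have "(\<Sum>i=1..n. y i) * y (Suc n) + y (Suc n) * y (Suc n) = (\<Sum>i=1..Suc n. y i * y (Suc n))"
    by (simp add: sum_distrib_right)
  finally show ?case by simp
qed simp

context contractive_kernel
begin

lemma coordinate_measurable_Q:
  assumes [measurable]: "f \<in> borel_measurable borel"
  shows "(\<lambda>\<omega>. f (\<omega> i)) \<in> borel_measurable (Q x)"
  by measurable

lemma expectation_coordinate:
  assumes f: "L-lipschitz_on UNIV f" and f0: "\<And>x. 0 \<le> f x"
  shows "(\<integral>\<^sup>+\<omega>. ennreal (f (\<omega> i)) \<partial>Q x) = ennreal ((avg ^^ i) f x)"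
  using f f0
proof (induction i arbitrary: f L)
  case 0
  interpret prob_space "Q x" by (rule prob_Q)
  have "(\<integral>\<^sup>+\<omega>. ennreal (f (\<omega> 0)) \<partial>Q x) = (\<integral>\<^sup>+\<omega>. ennreal (f x) \<partial>Q x)"
    using AE_start[of x] by (intro nn_integral_cong_AE) auto
  then show ?case by (simp add: emeasure_space_1)
next
  case (Suc i)
  have [measurable]: "f \<in> borel_measurable borel" by (rule lipschitz_borel_measurable[OF Suc.prems(1)])
  have "(\<integral>\<^sup>+\<omega>. ennreal (f (\<omega> (Suc i))) \<partial>Q x) = (\<integral>\<^sup>+\<omega>. \<integral>\<^sup>+y. ennreal (f ((fun_upd \<omega> (Suc i) y) (Suc i))) \<partial>P (\<omega> i) \<partial>Q x)"
    by (rule markov_nn) auto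
  also have "\<dots> = (\<integral>\<^sup>+\<omega>. ennreal (avg f (\<omega> i)) \<partial>Q x)"
    unfolding avg_def using Suc.prems(2)
    by (intro nn_integral_cong) (simp add: nn_integral_eq_integral lipschitz_integrable[OF P_P1 Suc.prems(1)])
  also have "\<dots> = ennreal ((avg ^^ i) (avg f) x)"
    by (rule Suc.IH[OF avg_lipschitz[OF Suc.prems(1)]]) (use Suc.prems(2) in \<open>simp add: avg_def\<close>)
  finally show ?case by (simp add: funpow_swap1)
qed

lemma integrable_coordinate:
  assumes f: "L-lipschitz_on UNIV f" and f0: "\<And>x. 0 \<le> f x"
  shows "integrable (Q x) (\<lambda>\<omega>. f (\<omega> i))" "(\<integral>\<omega>. f (\<omega> i) \<partial>Q x) = (avg ^^ i) f x"
proof -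
  note e = expectation_coordinate[OF assms, where i=i and x=x]
  have m: "(\<lambda>\<omega>. f (\<omega> i)) \<in> borel_measurable (Q x)"
    by (rule coordinate_measurable_Q[OF lipschitz_borel_measurable[OF f]])
  show i: "integrable (Q x) (\<lambda>\<omega>. f (\<omega> i))"
    by (rule integrableI_nonneg[OF m]) (use f0 e in auto)
  show "(\<integral>\<omega>. f (\<omega> i) \<partial>Q x) = (avg ^^ i) f x"
    using nn_integral_eq_integral[OF i] e f0 avg_pow_nonneg[of f i x, OF f0] by simp
qed

lemma integrable_bounded_product:
  assumes "f \<in> borel_measurable borel" "\<And>x. \<bar>f x\<bar> \<le> A" "g \<in> borel_measurable borel" "\<And>x. \<bar>g x\<bar> \<le> B"
  shows "integrable (Q x) (\<lambda>\<omega>. f (\<omega> i) * g (\<omega> j) :: real)"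
proof -
  interpret prob_space "Q x" by (rule prob_Q)
  have [measurable]: "f \<in> borel_measurable borel" "g \<in> borel_measurable borel" by fact+
  show ?thesis
  proof (rule integrable_const_bound[where B="A * B"])
    have "0 \<le> A" using assms(2)[of 0] by linarith
    then show "AE \<omega> in Q x. norm (f (\<omega> i) * g (\<omega> j)) \<le> A * B"
      using assms(2,4) by (intro AE_I2) (auto simp: abs_mult intro!: mult_mono)
  qed measurable
qed

lemma expectation_product_step:
  assumes f: "f \<in> borel_measurable borel" "\<And>x. \<bar>f x\<bar> \<le> A"
    and g: "L-lipschitz_on UNIV g" "\<And>x. \<bar>g x\<bar> \<le> B" and ij: "i \<le> j"
  shows "(\<integral>\<omega>. f (\<omega> i) * g (\<omega> (Suc j)) \<partial>Q x) = (\<integral>\<omega>. f (\<omega> i) * avg g (\<omega> j) \<partial>Q x)"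
proof -
  interpret prob_space "Q x" by (rule prob_Q)
  have [measurable]: "f \<in> borel_measurable borel" "g \<in> borel_measurable borel" "avg g \<in> borel_measurable borel"
    using f lipschitz_borel_measurable[OF g(1)] lipschitz_borel_measurable[OF avg_lipschitz[OF g(1)]] by auto
  have AB: "0 \<le> A" "0 \<le> B" using f(2)[of 0] g(2)[of 0] by linarith+
  have agB: "\<bar>avg g y\<bar> \<le> B" for y by (rule avg_bounded[OF g])
  have fg0: "0 \<le> a * b + A * B" if "\<bar>a\<bar> \<le> A" "\<bar>b\<bar> \<le> B" for a b
  proof -
    have "\<bar>a * b\<bar> \<le> A * B" unfolding abs_mult using AB that by (intro mult_mono) auto
    then show ?thesis by linarith
  qed
  note i1 = integrable_bounded_product[OF f _ g(2), OF lipschitz_borel_measurable[OF g(1)], of x i "Suc j"]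
  note i2 = integrable_bounded_product[OF f _ agB, OF lipschitz_borel_measurable[OF avg_lipschitz[OF g(1)]], of x i j]
  \<comment> \<open>The shift by \<open>A * B\<close> makes the integrand nonnegative, so that
    \<open>markov_nn\<close> applies.\<close>
  have "ennreal ((\<integral>\<omega>. f (\<omega> i) * g (\<omega> (Suc j)) \<partial>Q x) + A * B) = (\<integral>\<^sup>+\<omega>. ennreal (f (\<omega> i) * g (\<omega> (Suc j)) + A * B) \<partial>Q x)"
    using i1 fg0[OF f(2) g(2)] by (subst nn_integral_eq_integral) (auto simp: prob_space)
  also have "\<dots> = (\<integral>\<^sup>+\<omega>. \<integral>\<^sup>+y. ennreal (f ((fun_upd \<omega> (Suc j) y) i) * g ((fun_upd \<omega> (Suc j) y) (Suc j)) + A * B) \<partial>P (\<omega> j) \<partial>Q x)"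
    by (rule markov_nn) (use ij in auto)
  also have "\<dots> = (\<integral>\<^sup>+\<omega>. ennreal (f (\<omega> i) * avg g (\<omega> j) + A * B) \<partial>Q x)"
  proof (rule nn_integral_cong)
    fix \<omega>
    interpret Pj: prob_space "P (\<omega> j)" by (rule prob_P)
    have "(\<integral>\<^sup>+y. ennreal (f ((fun_upd \<omega> (Suc j) y) i) * g ((fun_upd \<omega> (Suc j) y) (Suc j)) + A * B) \<partial>P (\<omega> j))
        = (\<integral>\<^sup>+y. ennreal (f (\<omega> i) * g y + A * B) \<partial>P (\<omega> j))" using ij by simp
    also have "\<dots> = ennreal (\<integral>y. f (\<omega> i) * g y + A * B \<partial>P (\<omega> j))"
      using lipschitz_integrable[OF P_P1 g(1)] fg0[OF f(2) g(2)] by (intro nn_integral_eq_integral) auto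
    also have "(\<integral>y. f (\<omega> i) * g y + A * B \<partial>P (\<omega> j)) = f (\<omega> i) * avg g (\<omega> j) + A * B"
      using lipschitz_integrable[OF P_P1 g(1)] by (simp add: avg_def Pj.prob_space)
    finally show "(\<integral>\<^sup>+y. ennreal (f ((fun_upd \<omega> (Suc j) y) i) * g ((fun_upd \<omega> (Suc j) y) (Suc j)) + A * B) \<partial>P (\<omega> j))
        = ennreal (f (\<omega> i) * avg g (\<omega> j) + A * B)" .
  qed
  also have "\<dots> = ennreal ((\<integral>\<omega>. f (\<omega> i) * avg g (\<omega> j) \<partial>Q x) + A * B)"
    using i2 fg0[OF f(2) agB] by (subst nn_integral_eq_integral) (auto simp: prob_space)
  finally have "ennreal ((\<integral>\<omega>. f (\<omega> i) * g (\<omega> (Suc j)) \<partial>Q x) + A * B) = ennreal ((\<integral>\<omega>. f (\<omega> i) * avg g (\<omega> j) \<partial>Q x) + A * B)" .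
  moreover have "0 \<le> (\<integral>\<omega>. f (\<omega> i) * g (\<omega> (Suc j)) \<partial>Q x) + A * B"
  proof -
    have "0 \<le> (\<integral>\<omega>. f (\<omega> i) * g (\<omega> (Suc j)) + A * B \<partial>Q x)" using fg0[OF f(2) g(2)] by (intro integral_nonneg_AE) auto
    then show ?thesis using i1 by (simp add: prob_space)
  qed
  moreover have "0 \<le> (\<integral>\<omega>. f (\<omega> i) * avg g (\<omega> j) \<partial>Q x) + A * B"
  proof -
    have "0 \<le> (\<integral>\<omega>. f (\<omega> i) * avg g (\<omega> j) + A * B \<partial>Q x)" using fg0[OF f(2) agB] by (intro integral_nonneg_AE) auto
    then show ?thesis using i2 by (simp add: prob_space)
  qed
  ultimately show ?thesis by simp
qed

lemma expectation_product_pow: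
  assumes f: "f \<in> borel_measurable borel" "\<And>x. \<bar>f x\<bar> \<le> A"
    and g: "L-lipschitz_on UNIV g" "\<And>x. \<bar>g x\<bar> \<le> B"
  shows "(\<integral>\<omega>. f (\<omega> i) * g (\<omega> (i + k)) \<partial>Q x) = (\<integral>\<omega>. f (\<omega> i) * (avg ^^ k) g (\<omega> i) \<partial>Q x)"
  using g
proof (induction k arbitrary: g L)
  case (Suc k)
  have "(\<integral>\<omega>. f (\<omega> i) * g (\<omega> (i + Suc k)) \<partial>Q x) = (\<integral>\<omega>. f (\<omega> i) * avg g (\<omega> (i + k)) \<partial>Q x)"
    using expectation_product_step[OF f Suc.prems, of i "i + k" x] by simp
  also have "\<dots> = (\<integral>\<omega>. f (\<omega> i) * (avg ^^ k) (avg g) (\<omega> i) \<partial>Q x)"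
    by (rule Suc.IH[OF avg_lipschitz[OF Suc.prems(1)] avg_bounded[OF Suc.prems]])
  finally show ?case by (simp add: funpow_swap1)
qed simp

lemma expectation_bounded_coordinate:
  assumes g: "L-lipschitz_on UNIV g" "\<And>x. \<bar>g x\<bar> \<le> B"
  shows "(\<integral>\<omega>. g (\<omega> i) \<partial>Q x) = (avg ^^ i) g x"
proof -
  interpret prob_space "Q x" by (rule prob_Q)
  have [measurable]: "(avg ^^ i) g \<in> borel_measurable borel"
    by (rule lipschitz_borel_measurable[OF avg_pow_lipschitz[OF g(1)]])
  have "(\<integral>\<omega>. 1 * g (\<omega> (0 + i)) \<partial>Q x) = (\<integral>\<omega>. 1 * (avg ^^ i) g (\<omega> 0) \<partial>Q x)"
    by (rule expectation_product_pow[where A=1, OF _ _ g]) auto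
  also have "\<dots> = (\<integral>\<omega>. (avg ^^ i) g x \<partial>Q x)"
    using AE_start[of x] by (intro integral_cong_AE) auto
  finally show ?thesis by (simp add: prob_space)
qed

lemma avg_sum:
  fixes f :: "'p \<Rightarrow> 'a \<Rightarrow> real" and c L :: "'p \<Rightarrow> real"
  assumes "finite A" "\<And>p. p \<in> A \<Longrightarrow> (L p)-lipschitz_on UNIV (f p)"
  shows "avg (\<lambda>y. \<Sum>p\<in>A. c p * f p y) x = (\<Sum>p\<in>A. c p * avg (f p) x)"
  unfolding avg_def using lipschitz_integrable[OF P_P1 assms(2)]
  by (subst Bochner_Integration.integral_sum) auto

lemma avg_pow_sum:
  fixes f :: "'p \<Rightarrow> 'a \<Rightarrow> real" and c L :: "'p \<Rightarrow> real"
  assumes "finite A" "\<And>p. p \<in> A \<Longrightarrow> (L p)-lipschitz_on UNIV (f p)"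
  shows "(avg ^^ k) (\<lambda>y. \<Sum>p\<in>A. c p * f p y) x = (\<Sum>p\<in>A. c p * (avg ^^ k) (f p) x)"
proof (induction k arbitrary: x)
  case (Suc k)
  have "(avg ^^ Suc k) (\<lambda>y. \<Sum>p\<in>A. c p * f p y) x = avg (\<lambda>y. \<Sum>p\<in>A. c p * (avg ^^ k) (f p) y) x"
  proof -
    have "(avg ^^ k) (\<lambda>y. \<Sum>p\<in>A. c p * f p y) = (\<lambda>y. \<Sum>p\<in>A. c p * (avg ^^ k) (f p) y)"
      by (rule ext) (rule Suc)
    then show ?thesis by simp
  qed
  also have "\<dots> = (\<Sum>p\<in>A. c p * avg ((avg ^^ k) (f p)) x)"
    by (rule avg_sum[OF assms(1) avg_pow_lipschitz[OF assms(2)]])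
  finally show ?case by simp
qed simp

end

section \<open>Second moments of empirical averages\<close>

lemma (in prob_space) expectation_add_const_sum:
  fixes X :: "'a \<Rightarrow> real" and Z :: "'j \<Rightarrow> 'a \<Rightarrow> real"
  assumes "integrable M X" "\<And>j. j \<in> J \<Longrightarrow> integrable M (Z j)"
  shows "(\<integral>\<omega>. X \<omega> + c + (\<Sum>j\<in>J. Z j \<omega>) \<partial>M) = (\<integral>\<omega>. X \<omega> \<partial>M) + c + (\<Sum>j\<in>J. \<integral>\<omega>. Z j \<omega> \<partial>M)"
  using assms by (simp add: prob_space Bochner_Integration.integral_sum Bochner_Integration.integrable_sum)

context contractive_kernel_invariant
begin

lemma integral_avg_pow_nonneg:
  assumes f: "L-lipschitz_on UNIV f" and f0: "\<And>x. 0 \<le> f x"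
  shows "(\<integral>x. (avg ^^ k) f x \<partial>\<pi>) = (\<integral>x. f x \<partial>\<pi>)"
  using f f0
proof (induction k arbitrary: f L)
  case (Suc k)
  note f = Suc.prems
  have af: "(r * L)-lipschitz_on UNIV (avg f)" "\<And>x. 0 \<le> avg f x"
    using avg_lipschitz[OF f(1)] f(2) by (auto simp: avg_def)
  have "ennreal (\<integral>x. f x \<partial>\<pi>) = (\<integral>\<^sup>+x. ennreal (f x) \<partial>(\<pi> \<bind> P))"
    using lipschitz_integrable[OF pi_P1 f(1)] f(2) by (simp add: bind_pi nn_integral_eq_integral)
  also have "\<dots> = (\<integral>\<^sup>+x. \<integral>\<^sup>+y. ennreal (f y) \<partial>P x \<partial>\<pi>)"
  proof (rule nn_integral_bind)
    show "(\<lambda>y. ennreal (f y)) \<in> borel_measurable borel" using lipschitz_borel_measurable[OF f(1)] by simp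
    show "P \<in> \<pi> \<rightarrow>\<^sub>M subprob_algebra borel" by measurable
  qed
  also have "\<dots> = (\<integral>\<^sup>+x. ennreal (avg f x) \<partial>\<pi>)"
    unfolding avg_def using f
    by (intro nn_integral_cong nn_integral_eq_integral lipschitz_integrable[OF P_P1]) auto
  also have "\<dots> = ennreal (\<integral>x. avg f x \<partial>\<pi>)"
    using lipschitz_integrable[OF pi_P1 af(1)] af(2) by (simp add: nn_integral_eq_integral)
  finally have "(\<integral>x. f x \<partial>\<pi>) = (\<integral>x. avg f x \<partial>\<pi>)" using f af by (simp add: integral_nonneg_AE)
  then show ?case using Suc.IH[OF af] by (simp add: funpow_swap1)
qed simp

text \<open>The factor \<open>min 1 (\<Lambda> * dev x)\<close> bounds a centred
  \<open>\<Lambda>\<close>-Lipschitz function with values in an interval of length 1, and the second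
  \<open>dev x\<close> comes from the decay of its averages. Keeping the minimum leaves both regimes
  open: its first argument leads to \<open>m1\<close>, the second to the variance of
  \<open>\<pi>\<close>.\<close>

definition deviation_integral :: "real \<Rightarrow> real" where
  "deviation_integral \<Lambda> = (\<integral>x. min 1 (\<Lambda> * dev x) * dev x \<partial>\<pi>)"

lemma dev_measurable[measurable]: "dev \<in> borel_measurable borel"
  by (rule lipschitz_borel_measurable[OF dev_lipschitz])

lemma integrable_dev: "integrable \<pi> dev"
  by (rule lipschitz_integrable[OF pi_P1 dev_lipschitz])

lemma integrable_min_dev:
  assumes "0 \<le> \<Lambda>"
  shows "integrable \<pi> (\<lambda>x. min 1 (\<Lambda> * dev x) * dev x)"
proof (rule Bochner_Integration.integrable_bound[OF integrable_dev])
  show "AE x in \<pi>. norm (min 1 (\<Lambda> * dev x) * dev x) \<le> norm (dev x)"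
    using assms dev_nonneg by (intro AE_I2) (auto simp: abs_mult intro!: mult_left_le_one_le)
  have [measurable]: "dev \<in> borel_measurable \<pi>" by measurable
  show "(\<lambda>x. min 1 (\<Lambda> * dev x) * dev x) \<in> borel_measurable \<pi>" by measurable
qed

text \<open>Expanding the square, \<open>\<Sum>p. \<phi> p x * (P^k (\<phi> p)) x\<close> equals \<open>(P^k \<Psi>) x\<close> for the single function
  \<open>\<Psi> = (\<Sum>p. \<phi> p x * \<phi> p)\<close>, whose Lipschitz constant does not see the size of the family.\<close>

lemma second_moment:
  fixes \<psi> :: "'p \<Rightarrow> 'a \<Rightarrow> real" and n :: nat
  assumes A: "finite A" and \<psi>01: "\<And>p x. p \<in> A \<Longrightarrow> 0 \<le> \<psi> p x \<and> \<psi> p x \<le> 1"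
    and lip: "\<And>x y. (\<Sum>p\<in>A. \<bar>\<psi> p x - \<psi> p y\<bar>) \<le> \<Lambda> * norm (x - y)" and \<Lambda>: "0 \<le> \<Lambda>" and n: "1 \<le> n"
  defines "\<Delta> \<equiv> \<lambda>p \<omega>. (\<Sum>i=1..n. \<psi> p (\<omega> i)) / n - (\<integral>x. \<psi> p x \<partial>\<pi>)"
  shows "\<exists>U. (\<forall>x. integrable (Q x) (\<lambda>\<omega>. \<Sum>p\<in>A. (\<Delta> p \<omega>)\<^sup>2) \<and> (\<integral>\<omega>. (\<Sum>p\<in>A. (\<Delta> p \<omega>)\<^sup>2) \<partial>Q x) \<le> U x)
    \<and> integrable \<pi> U \<and> (\<integral>x. U x \<partial>\<pi>) \<le> 2 * \<Lambda> / (n * (1 - r)) * deviation_integral \<Lambda>"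
proof -
  define \<phi> where "\<phi> p x = \<psi> p x - (\<integral>x. \<psi> p x \<partial>\<pi>)" for p x
  have \<psi>L: "\<Lambda>-lipschitz_on UNIV (\<psi> p)" if p: "p \<in> A" for p
  proof (rule lipschitz_realI[OF \<Lambda>])
    fix x y
    have "\<bar>\<psi> p x - \<psi> p y\<bar> \<le> (\<Sum>p\<in>A. \<bar>\<psi> p x - \<psi> p y\<bar>)" using p A by (intro member_le_sum) auto
    with lip[of x y] show "\<psi> p x - \<psi> p y \<le> \<Lambda> * norm (x - y)" by linarith
  qed
  have \<phi>L: "\<Lambda>-lipschitz_on UNIV (\<phi> p)" if "p \<in> A" for p
    using \<psi>L[OF that] by (simp add: \<phi>_def lipschitz_on_def dist_real_def)
  have \<phi>B: "\<bar>\<phi> p x\<bar> \<le> 1" if p: "p \<in> A" for p x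
  proof -
    have "0 \<le> (\<integral>x. \<psi> p x \<partial>\<pi>)" using \<psi>01[OF p] by (intro integral_nonneg_AE) auto
    moreover have "(\<integral>x. \<psi> p x \<partial>\<pi>) \<le> (\<integral>x. 1 \<partial>\<pi>)"
      by (rule integral_mono[OF lipschitz_integrable[OF pi_P1 \<psi>L[OF p]]]) (use \<psi>01[OF p] in auto)
    ultimately show ?thesis using \<psi>01[OF p, of x] pi.prob_space by (simp add: \<phi>_def abs_le_iff)
  qed
  have \<phi>m: "\<phi> p \<in> borel_measurable borel" if "p \<in> A" for p by (rule lipschitz_borel_measurable[OF \<phi>L[OF that]])
  have \<phi>0: "(\<integral>x. \<phi> p x \<partial>\<pi>) = 0" if "p \<in> A" for p
    using lipschitz_integrable[OF pi_P1 \<psi>L[OF that]] pi.prob_space by (simp add: \<phi>_def)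
  have \<Delta>: "\<Delta> p \<omega> = (\<Sum>i=1..n. \<phi> p (\<omega> i)) / n" for p \<omega>
    using n by (simp add: \<Delta>_def \<phi>_def sum_subtractf field_simps)
  define F where "F p k x = \<phi> p x * (avg ^^ k) (\<phi> p) x" for p k x
  have FL: "\<exists>L. L-lipschitz_on UNIV (F p k)" if p: "p \<in> A" for p k
    unfolding F_def
    using lipschitz_times[OF \<phi>L[OF p] \<phi>B[OF p] avg_pow_lipschitz[OF \<phi>L[OF p]] avg_pow_bounded[OF \<phi>L[OF p] \<phi>B[OF p]]]
    by blast
  have FB: "\<bar>F p k x\<bar> \<le> 1" if p: "p \<in> A" for p k x
    unfolding F_def abs_mult using \<phi>B[OF p] avg_pow_bounded[OF \<phi>L[OF p] \<phi>B[OF p]] by (intro mult_le_one) auto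
  \<comment> \<open>\<open>U\<close> bounds the second moment for the chain started at
    \<open>x\<close>. Integrated against the invariant \<open>\<pi>\<close>, the outer power
    \<open>avg ^^ i\<close> drops out and only the lag \<open>j - i\<close> remains.\<close>
  define U where "U x = (\<Sum>p\<in>A. 2 / (real n)\<^sup>2 * (\<Sum>j=1..n. \<Sum>i=1..j. (avg ^^ i) (F p (j - i)) x))" for x
  have iprod: "integrable (Q x) (\<lambda>\<omega>. \<phi> p (\<omega> i) * \<phi> p (\<omega> j))" if p: "p \<in> A" for p i j x
    by (rule integrable_bounded_product[OF \<phi>m[OF p] \<phi>B[OF p] \<phi>m[OF p] \<phi>B[OF p]])
  have sq: "(\<Delta> p \<omega>)\<^sup>2 = (\<Sum>i=1..n. \<Sum>j=1..n. \<phi> p (\<omega> i) * \<phi> p (\<omega> j)) / (real n)\<^sup>2" for p \<omega>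
    by (simp add: \<Delta> power_divide power2_eq_square sum_product)
  have i\<Delta>: "integrable (Q x) (\<lambda>\<omega>. (\<Delta> p \<omega>)\<^sup>2)" if p: "p \<in> A" for p x
    unfolding sq using iprod[OF p] by auto
  have E: "(\<integral>\<omega>. \<phi> p (\<omega> i) * \<phi> p (\<omega> j) \<partial>Q x) = (avg ^^ i) (F p (j - i)) x" if p: "p \<in> A" and ij: "i \<le> j" for p i j x
  proof -
    obtain L where L: "L-lipschitz_on UNIV (F p (j - i))" using FL[OF p] by blast
    have "(\<integral>\<omega>. \<phi> p (\<omega> i) * \<phi> p (\<omega> (i + (j - i))) \<partial>Q x) = (\<integral>\<omega>. F p (j - i) (\<omega> i) \<partial>Q x)"
      unfolding F_def by (rule expectation_product_pow[OF \<phi>m[OF p] \<phi>B[OF p] \<phi>L[OF p] \<phi>B[OF p]])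
    also have "\<dots> = (avg ^^ i) (F p (j - i)) x" by (rule expectation_bounded_coordinate[OF L FB[OF p]])
    finally show ?thesis using ij by simp
  qed
  have le: "(\<integral>\<omega>. (\<Delta> p \<omega>)\<^sup>2 \<partial>Q x) \<le> 2 / (real n)\<^sup>2 * (\<Sum>j=1..n. \<Sum>i=1..j. (avg ^^ i) (F p (j - i)) x)" if p: "p \<in> A" for p x
  proof -
    have "(\<integral>\<omega>. (\<Delta> p \<omega>)\<^sup>2 \<partial>Q x) \<le> (\<integral>\<omega>. 2 / (real n)\<^sup>2 * (\<Sum>j=1..n. \<Sum>i=1..j. \<phi> p (\<omega> i) * \<phi> p (\<omega> j)) \<partial>Q x)"
    proof (rule integral_mono[OF i\<Delta>[OF p]])
      show "integrable (Q x) (\<lambda>\<omega>. 2 / (real n)\<^sup>2 * (\<Sum>j=1..n. \<Sum>i=1..j. \<phi> p (\<omega> i) * \<phi> p (\<omega> j)))"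
        using iprod[OF p] by auto
      fix \<omega>
      show "(\<Delta> p \<omega>)\<^sup>2 \<le> 2 / (real n)\<^sup>2 * (\<Sum>j=1..n. \<Sum>i=1..j. \<phi> p (\<omega> i) * \<phi> p (\<omega> j))"
        using power2_sum_le[of "\<lambda>i. \<phi> p (\<omega> i)" n] by (simp add: \<Delta> power_divide divide_right_mono)
    qed
    also have "\<dots> = 2 / (real n)\<^sup>2 * (\<Sum>j=1..n. \<Sum>i=1..j. (\<integral>\<omega>. \<phi> p (\<omega> i) * \<phi> p (\<omega> j) \<partial>Q x))"
      using iprod[OF p] by (simp add: Bochner_Integration.integral_sum Bochner_Integration.integrable_sum)
    also have "(\<Sum>j=1..n. \<Sum>i=1..j. (\<integral>\<omega>. \<phi> p (\<omega> i) * \<phi> p (\<omega> j) \<partial>Q x)) = (\<Sum>j=1..n. \<Sum>i=1..j. (avg ^^ i) (F p (j - i)) x)"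
      by (intro sum.cong refl E[OF p]) auto
    finally show ?thesis .
  qed
  have iF: "integrable \<pi> (\<lambda>x. (avg ^^ i) (F p k) x)" and IF: "(\<integral>x. (avg ^^ i) (F p k) x \<partial>\<pi>) = (\<integral>x. F p k x \<partial>\<pi>)"
    if p: "p \<in> A" for p i k
  proof -
    obtain L where L: "L-lipschitz_on UNIV (F p k)" using FL[OF p] by blast
    show "integrable \<pi> (\<lambda>x. (avg ^^ i) (F p k) x)" by (rule lipschitz_integrable[OF pi_P1 avg_pow_lipschitz[OF L]])
    show "(\<integral>x. (avg ^^ i) (F p k) x \<partial>\<pi>) = (\<integral>x. F p k x \<partial>\<pi>)" by (rule integral_avg_pow_bounded[OF L FB[OF p]])
  qed
  have key: "(\<Sum>p\<in>A. F p k x) \<le> r ^ k * \<Lambda> * (min 1 (\<Lambda> * dev x) * dev x)" for k x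
  proof -
    define \<kappa> where "\<kappa> = min 1 (\<Lambda> * dev x)"
    have \<kappa>: "0 \<le> \<kappa>" using \<Lambda> dev_nonneg by (simp add: \<kappa>_def)
    have \<phi>\<kappa>: "\<bar>\<phi> p x\<bar> \<le> \<kappa>" if "p \<in> A" for p
      using \<phi>B[OF that, of x] lipschitz_minus_mean_le[OF \<psi>L[OF that], of x] by (simp add: \<kappa>_def \<phi>_def)
    define \<Psi> where "\<Psi> y = (\<Sum>p\<in>A. \<phi> p x * \<phi> p y)" for y
    have \<Psi>L: "(\<kappa> * \<Lambda>)-lipschitz_on UNIV \<Psi>"
    proof (rule lipschitz_realI)
      fix y z
      have "\<Psi> y - \<Psi> z = (\<Sum>p\<in>A. \<phi> p x * (\<psi> p y - \<psi> p z))"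
        by (simp add: \<Psi>_def sum_subtractf[symmetric] right_diff_distrib[symmetric] \<phi>_def)
      also have "\<dots> \<le> (\<Sum>p\<in>A. \<kappa> * \<bar>\<psi> p y - \<psi> p z\<bar>)"
      proof (rule sum_mono)
        fix p assume "p \<in> A"
        have "\<phi> p x * (\<psi> p y - \<psi> p z) \<le> \<bar>\<phi> p x\<bar> * \<bar>\<psi> p y - \<psi> p z\<bar>"
          by (metis abs_ge_self abs_mult)
        also have "\<dots> \<le> \<kappa> * \<bar>\<psi> p y - \<psi> p z\<bar>" using \<phi>\<kappa>[OF \<open>p \<in> A\<close>] by (rule mult_right_mono) simp
        finally show "\<phi> p x * (\<psi> p y - \<psi> p z) \<le> \<kappa> * \<bar>\<psi> p y - \<psi> p z\<bar>" .
      qed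
      also have "\<dots> \<le> \<kappa> * (\<Lambda> * norm (y - z))"
        unfolding sum_distrib_left[symmetric] by (intro mult_left_mono lip \<kappa>)
      finally show "\<Psi> y - \<Psi> z \<le> \<kappa> * \<Lambda> * norm (y - z)" by simp
    qed (use \<kappa> \<Lambda> in simp)
    have \<Psi>B: "\<bar>\<Psi> y\<bar> \<le> card A" for y
    proof -
      have "\<bar>\<Psi> y\<bar> \<le> (\<Sum>p\<in>A. \<bar>\<phi> p x * \<phi> p y\<bar>)" unfolding \<Psi>_def by (rule sum_abs)
      also have "\<dots> \<le> (\<Sum>p\<in>A. 1)" unfolding abs_mult using \<phi>B by (intro sum_mono mult_le_one) auto
      finally show ?thesis by simp
    qed
    have "(\<integral>y. \<Psi> y \<partial>\<pi>) = (\<Sum>p\<in>A. \<phi> p x * (\<integral>y. \<phi> p y \<partial>\<pi>))"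
      unfolding \<Psi>_def using lipschitz_integrable[OF pi_P1 \<phi>L] by (subst Bochner_Integration.integral_sum) auto
    then have \<Psi>0: "(\<integral>y. (avg ^^ k) \<Psi> y \<partial>\<pi>) = 0"
      using integral_avg_pow_bounded[OF \<Psi>L \<Psi>B] \<phi>0 by simp
    have "(\<Sum>p\<in>A. F p k x) = (avg ^^ k) \<Psi> x"
      unfolding \<Psi>_def F_def by (rule avg_pow_sum[OF A \<phi>L, symmetric])
    also have "\<dots> \<le> r ^ k * (\<kappa> * \<Lambda>) * dev x"
      using lipschitz_minus_mean_le[OF avg_pow_lipschitz[OF \<Psi>L, of k], of x] \<Psi>0 by simp
    finally show ?thesis by (simp add: \<kappa>_def mult_ac)
  qed
  have W0: "0 \<le> deviation_integral \<Lambda>"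
    unfolding deviation_integral_def using \<Lambda> dev_nonneg by (intro integral_nonneg_AE) auto
  have key': "(\<Sum>p\<in>A. \<integral>x. F p k x \<partial>\<pi>) \<le> r ^ k * (\<Lambda> * deviation_integral \<Lambda>)" for k
  proof -
    have "(\<Sum>p\<in>A. \<integral>x. F p k x \<partial>\<pi>) = (\<integral>x. (\<Sum>p\<in>A. F p k x) \<partial>\<pi>)"
      using iF[of _ 0] by (subst Bochner_Integration.integral_sum) auto
    also have "\<dots> \<le> (\<integral>x. r ^ k * \<Lambda> * (min 1 (\<Lambda> * dev x) * dev x) \<partial>\<pi>)"
      using iF[of _ 0] key integrable_min_dev[OF \<Lambda>] by (intro integral_mono) auto
    also have "\<dots> = r ^ k * \<Lambda> * deviation_integral \<Lambda>"
      unfolding deviation_integral_def by (rule Bochner_Integration.integral_mult_right_zero)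
    finally show ?thesis by (simp only: mult.assoc)
  qed
  have "(\<integral>x. U x \<partial>\<pi>) = (\<Sum>p\<in>A. 2 / (real n)\<^sup>2 * (\<Sum>j=1..n. \<Sum>i=1..j. \<integral>x. F p (j - i) x \<partial>\<pi>))"
  proof -
    have "(\<integral>x. U x \<partial>\<pi>) = (\<Sum>p\<in>A. \<integral>x. 2 / (real n)\<^sup>2 * (\<Sum>j=1..n. \<Sum>i=1..j. (avg ^^ i) (F p (j - i)) x) \<partial>\<pi>)"
      unfolding U_def using iF by (intro Bochner_Integration.integral_sum) auto
    also have "\<dots> = (\<Sum>p\<in>A. 2 / (real n)\<^sup>2 * (\<Sum>j=1..n. \<Sum>i=1..j. \<integral>x. F p (j - i) x \<partial>\<pi>))"
      using iF by (intro sum.cong refl)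
        (simp add: Bochner_Integration.integral_sum Bochner_Integration.integrable_sum IF)
    finally show ?thesis .
  qed
  also have "\<dots> = 2 / (real n)\<^sup>2 * (\<Sum>j=1..n. \<Sum>i=1..j. \<Sum>p\<in>A. \<integral>x. F p (j - i) x \<partial>\<pi>)"
    unfolding sum_distrib_left[symmetric]
    by (subst sum.swap, rule arg_cong[where f="\<lambda>u. _ * u"], rule sum.cong[OF refl], subst sum.swap, rule refl)
  also have "\<dots> \<le> 2 / (real n)\<^sup>2 * (\<Sum>j=1..n. 1 / (1 - r) * (\<Lambda> * deviation_integral \<Lambda>))"
  proof (intro mult_left_mono sum_mono)
    fix j
    have "(\<Sum>i=1..j. \<Sum>p\<in>A. \<integral>x. F p (j - i) x \<partial>\<pi>) \<le> (\<Sum>i=1..j. r ^ (j - i) * (\<Lambda> * deviation_integral \<Lambda>))"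
      by (intro sum_mono key')
    also have "\<dots> = (\<Sum>i=1..j. r ^ (j - i)) * (\<Lambda> * deviation_integral \<Lambda>)" by (simp add: sum_distrib_right)
    also have "(\<Sum>i=1..j. r ^ (j - i)) = (\<Sum>k<j. r ^ k)"
      by (rule sum.reindex_bij_witness[of _ "\<lambda>k. j - k" "\<lambda>i. j - i"]) auto
    also have "\<dots> * (\<Lambda> * deviation_integral \<Lambda>) \<le> 1 / (1 - r) * (\<Lambda> * deviation_integral \<Lambda>)"
      using \<Lambda> W0 by (intro mult_right_mono geometric_sum_le) simp
    finally show "(\<Sum>i=1..j. \<Sum>p\<in>A. \<integral>x. F p (j - i) x \<partial>\<pi>) \<le> 1 / (1 - r) * (\<Lambda> * deviation_integral \<Lambda>)" .
  qed simp
  also have "\<dots> = 2 * \<Lambda> / (n * (1 - r)) * deviation_integral \<Lambda>"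
    using n by (simp add: power2_eq_square)
  finally have IU: "(\<integral>x. U x \<partial>\<pi>) \<le> 2 * \<Lambda> / (n * (1 - r)) * deviation_integral \<Lambda>" .
  have "integrable \<pi> U" unfolding U_def using iF by auto
  moreover have "integrable (Q x) (\<lambda>\<omega>. \<Sum>p\<in>A. (\<Delta> p \<omega>)\<^sup>2)" for x using i\<Delta> by auto
  moreover have "(\<integral>\<omega>. (\<Sum>p\<in>A. (\<Delta> p \<omega>)\<^sup>2) \<partial>Q x) \<le> U x" for x
    unfolding U_def using i\<Delta> le by (subst Bochner_Integration.integral_sum) (auto intro!: sum_mono)
  ultimately show ?thesis using IU by blast
qed

text \<open>The bound on \<open>F\<close> is integrated for every starting point, giving
  \<open>g <= G\<close>; \<open>G\<close> is then integrated against \<open>\<pi>\<close>, where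
  invariance and \<open>second_moment\<close> apply; finally the Lipschitz constant of
  \<open>g\<close> moves the start to 0. The resulting \<open>E\<close> is
  \<open>g 0\<close>.\<close>

lemma concentration_around_mean_bound:
  fixes \<psi> :: "'j \<Rightarrow> 'p \<Rightarrow> 'a \<Rightarrow> real" and n :: nat and w V N \<Lambda> :: "'j \<Rightarrow> real"
  assumes n: "1 \<le> n" and F: "path_lip (1 / n) (1 / (n * (1 - r))) n F" and F0: "\<And>\<omega>. 0 \<le> F \<omega>"
    and e: "Le-lipschitz_on UNIV e" and e0: "\<And>x. 0 \<le> e x"
    and J: "finite J" and A: "\<And>j. j \<in> J \<Longrightarrow> finite (A j)"
    and \<psi>01: "\<And>j p x. j \<in> J \<Longrightarrow> p \<in> A j \<Longrightarrow> 0 \<le> \<psi> j p x \<and> \<psi> j p x \<le> 1"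
    and lip: "\<And>j x y. j \<in> J \<Longrightarrow> (\<Sum>p\<in>A j. \<bar>\<psi> j p x - \<psi> j p y\<bar>) \<le> \<Lambda> j * norm (x - y)"
    and \<Lambda>: "\<And>j. j \<in> J \<Longrightarrow> 0 \<le> \<Lambda> j" and w: "\<And>j. j \<in> J \<Longrightarrow> 0 \<le> w j"
    and V: "\<And>j. j \<in> J \<Longrightarrow> 0 < V j \<and> 2 * \<Lambda> j / (n * (1 - r)) * deviation_integral (\<Lambda> j) \<le> V j"
    and N: "\<And>j. j \<in> J \<Longrightarrow> 0 < N j \<and> real (card (A j)) \<le> N j"
    and F_le: "\<And>\<omega>. F \<omega> \<le> (\<Sum>i=1..n. e (\<omega> i)) / n + (\<integral>x. e x \<partial>\<pi>)
      + (\<Sum>j\<in>J. w j * (\<Sum>p\<in>A j. \<bar>(\<Sum>i=1..n. \<psi> j p (\<omega> i)) / n - (\<integral>x. \<psi> j p x \<partial>\<pi>)\<bar>))"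
  shows "\<exists>E. E \<le> 1 / (n * (1 - r)) * (\<integral>x. norm x \<partial>\<pi>) + 2 * (\<integral>x. e x \<partial>\<pi>) + (\<Sum>j\<in>J. w j * sqrt (N j * V j))
    \<and> (\<forall>t. (\<integral>\<^sup>+\<omega>. ennreal (exp (t * F \<omega>)) \<partial>Q 0) \<le> ennreal (exp (t * E + n * (C / 4 * (t * (1 / (n * (1 - r))))\<^sup>2))))"
proof -
  define l where "l = 1 / (n * (1 - r))"
  have r1: "0 < 1 - r" using r_less_1 by simp
  have l: "0 \<le> l" using n r1 by (simp add: l_def)
  have lr: "1 / n + r * l \<le> l" using n r1 by (simp add: l_def field_simps)
  obtain g where g: "l-lipschitz_on UNIV g"
    and g1: "\<And>x t. (\<integral>\<^sup>+\<omega>. ennreal (exp (t * F \<omega>)) \<partial>Q x) \<le> ennreal (exp (t * g x + n * (C / 4 * (t * l)\<^sup>2)))"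
    and g2: "\<And>x. 0 \<le> g x" "\<And>x. (\<integral>\<^sup>+\<omega>. ennreal (F \<omega>) \<partial>Q x) = ennreal (g x)"
    using path_concentration[OF F[folded l_def] _ l lr] F0 by auto
  define D where "D j p \<omega> = (\<Sum>i=1..n. \<psi> j p (\<omega> i)) / n - (\<integral>x. \<psi> j p x \<partial>\<pi>)" for j p \<omega>
  have "\<forall>j\<in>J. \<exists>U. (\<forall>x. integrable (Q x) (\<lambda>\<omega>. \<Sum>p\<in>A j. (D j p \<omega>)\<^sup>2) \<and> (\<integral>\<omega>. (\<Sum>p\<in>A j. (D j p \<omega>)\<^sup>2) \<partial>Q x) \<le> U x)
    \<and> integrable \<pi> U \<and> (\<integral>x. U x \<partial>\<pi>) \<le> 2 * \<Lambda> j / (n * (1 - r)) * deviation_integral (\<Lambda> j)"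
    unfolding D_def using second_moment[OF A \<psi>01 lip \<Lambda> n] by blast
  then obtain U where U: "\<And>j x. j \<in> J \<Longrightarrow> integrable (Q x) (\<lambda>\<omega>. \<Sum>p\<in>A j. (D j p \<omega>)\<^sup>2)"
      "\<And>j x. j \<in> J \<Longrightarrow> (\<integral>\<omega>. (\<Sum>p\<in>A j. (D j p \<omega>)\<^sup>2) \<partial>Q x) \<le> U j x"
      "\<And>j. j \<in> J \<Longrightarrow> integrable \<pi> (U j)"
      "\<And>j. j \<in> J \<Longrightarrow> (\<integral>x. U j x \<partial>\<pi>) \<le> 2 * \<Lambda> j / (n * (1 - r)) * deviation_integral (\<Lambda> j)"
    by (auto dest!: bchoice)
  \<comment> \<open>The optimal weight in \<open>|d| <= (\<kappa> + d^2 / \<kappa>) / 2\<close>.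
    This stands in for Cauchy-Schwarz: the bound is linear in the second moment, so it can be
    integrated first over the path and then over the start, and it still ends at
    \<open>sqrt (N j * V j)\<close>.\<close>
  define \<kappa> where "\<kappa> j = sqrt (V j / N j)" for j
  have \<kappa>: "0 < \<kappa> j" "\<kappa> j * N j = sqrt (N j * V j)" "V j / \<kappa> j = sqrt (N j * V j)" if "j \<in> J" for j
  proof -
    have VN: "0 < V j" "0 < N j" using V N that by auto
    have s: "sqrt (N j) * sqrt (N j) = N j" "sqrt (V j) * sqrt (V j) = V j" using VN by auto
    show "0 < \<kappa> j" using VN by (simp add: \<kappa>_def)
    have "\<kappa> j * N j = sqrt (V j) / sqrt (N j) * (sqrt (N j) * sqrt (N j))" by (simp only: \<kappa>_def real_sqrt_divide s)
    also have "\<dots> = sqrt (N j) * sqrt (V j)"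
    proof -
      have "a / b * (b * b) = b * a" if "0 < b" for a b :: real using that by simp
      from this[of "sqrt (N j)" "sqrt (V j)"] VN show ?thesis by simp
    qed
    finally show "\<kappa> j * N j = sqrt (N j * V j)" by (simp add: real_sqrt_mult)
    have "V j / \<kappa> j = (sqrt (V j) * sqrt (V j)) / (sqrt (V j) / sqrt (N j))" by (simp only: \<kappa>_def real_sqrt_divide s)
    also have "\<dots> = sqrt (N j) * sqrt (V j)"
    proof -
      have "a * a / (a / b) = b * a" if "0 < a" "0 < b" for a b :: real using that by simp
      from this[of "sqrt (V j)" "sqrt (N j)"] VN show ?thesis by simp
    qed
    finally show "V j / \<kappa> j = sqrt (N j * V j)" by (simp add: real_sqrt_mult)
  qed
  define B where "B \<omega> = (\<Sum>i=1..n. e (\<omega> i)) / n + (\<integral>x. e x \<partial>\<pi>)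
      + (\<Sum>j\<in>J. w j * ((\<kappa> j * N j + (\<Sum>p\<in>A j. (D j p \<omega>)\<^sup>2) / \<kappa> j) / 2))" for \<omega>
  have FB: "F \<omega> \<le> B \<omega>" for \<omega>
  proof -
    have "(\<Sum>p\<in>A j. \<bar>D j p \<omega>\<bar>) \<le> (\<kappa> j * N j + (\<Sum>p\<in>A j. (D j p \<omega>)\<^sup>2) / \<kappa> j) / 2" if j: "j \<in> J" for j
    proof -
      have am: "\<bar>d\<bar> \<le> (\<kappa> j + d\<^sup>2 / \<kappa> j) / 2" for d
      proof -
        have "0 \<le> (\<kappa> j - \<bar>d\<bar>)\<^sup>2" by simp
        also have "\<dots> = \<kappa> j * \<kappa> j + d\<^sup>2 - 2 * (\<kappa> j * \<bar>d\<bar>)"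
          unfolding power2_diff power2_abs by (simp add: power2_eq_square)
        finally have "2 * (\<kappa> j * \<bar>d\<bar>) \<le> \<kappa> j * \<kappa> j + d\<^sup>2" by simp
        then show ?thesis using \<kappa>(1)[OF j] by (simp add: field_simps power2_eq_square)
      qed
      have "(\<Sum>p\<in>A j. \<bar>D j p \<omega>\<bar>) \<le> (\<Sum>p\<in>A j. (\<kappa> j + (D j p \<omega>)\<^sup>2 / \<kappa> j) / 2)" by (intro sum_mono am)
      also have "\<dots> = (\<kappa> j * card (A j) + (\<Sum>p\<in>A j. (D j p \<omega>)\<^sup>2) / \<kappa> j) / 2"
        by (simp add: sum_divide_distrib[symmetric] sum.distrib mult.commute)
      also have "\<dots> \<le> (\<kappa> j * N j + (\<Sum>p\<in>A j. (D j p \<omega>)\<^sup>2) / \<kappa> j) / 2"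
        using \<kappa>(1)[OF j] N[OF j] by simp
      finally show ?thesis .
    qed
    then have "(\<Sum>j\<in>J. w j * (\<Sum>p\<in>A j. \<bar>D j p \<omega>\<bar>)) \<le> (\<Sum>j\<in>J. w j * ((\<kappa> j * N j + (\<Sum>p\<in>A j. (D j p \<omega>)\<^sup>2) / \<kappa> j) / 2))"
      using w by (intro sum_mono mult_left_mono) auto
    then show ?thesis using F_le[of \<omega>] by (simp add: B_def D_def)
  qed
  have ie: "integrable (Q x) (\<lambda>\<omega>. e (\<omega> i))" "(\<integral>\<omega>. e (\<omega> i) \<partial>Q x) = (avg ^^ i) e x" for x i
    using integrable_coordinate[OF e e0] by auto
  define G where "G x = (\<Sum>i=1..n. (avg ^^ i) e x) / n + (\<integral>x. e x \<partial>\<pi>) + (\<Sum>j\<in>J. w j * ((\<kappa> j * N j + U j x / \<kappa> j) / 2))" for x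
  have gG: "g x \<le> G x" for x
  proof -
    interpret prob_space "Q x" by (rule prob_Q)
    have iB: "integrable (Q x) B" unfolding B_def using ie U(1) by auto
    have "ennreal (g x) \<le> (\<integral>\<^sup>+\<omega>. ennreal (B \<omega>) \<partial>Q x)"
      unfolding g2(2)[symmetric] by (intro nn_integral_mono ennreal_leI FB)
    also have "\<dots> = ennreal (\<integral>\<omega>. B \<omega> \<partial>Q x)"
      using iB F0 FB by (intro nn_integral_eq_integral) (auto intro: order_trans)
    finally have "g x \<le> (\<integral>\<omega>. B \<omega> \<partial>Q x)"
      using F0 FB by (subst (asm) ennreal_le_iff) (auto intro!: integral_nonneg_AE intro: order_trans)
    also have "\<dots> = (\<Sum>i=1..n. (avg ^^ i) e x) / n + (\<integral>x. e x \<partial>\<pi>)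
      + (\<Sum>j\<in>J. w j * ((\<kappa> j * N j + (\<integral>\<omega>. (\<Sum>p\<in>A j. (D j p \<omega>)\<^sup>2) \<partial>Q x) / \<kappa> j) / 2))"
    proof -
      have 1: "integrable (Q x) (\<lambda>\<omega>. (\<Sum>i=1..n. e (\<omega> i)) / n)" using ie by auto
      have 2: "integrable (Q x) (\<lambda>\<omega>. w j * ((\<kappa> j * N j + (\<Sum>p\<in>A j. (D j p \<omega>)\<^sup>2) / \<kappa> j) / 2))" if "j \<in> J" for j
        using U(1)[OF that] by simp
      have 3: "(\<integral>\<omega>. w j * ((\<kappa> j * N j + (\<Sum>p\<in>A j. (D j p \<omega>)\<^sup>2) / \<kappa> j) / 2) \<partial>Q x)
        = w j * ((\<kappa> j * N j + (\<integral>\<omega>. (\<Sum>p\<in>A j. (D j p \<omega>)\<^sup>2) \<partial>Q x) / \<kappa> j) / 2)" if "j \<in> J" for j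
        using U(1)[OF that] by (simp add: prob_space)
      have 4: "(\<integral>\<omega>. (\<Sum>i=1..n. e (\<omega> i)) / n \<partial>Q x) = (\<Sum>i=1..n. (avg ^^ i) e x) / n"
        using ie by (simp add: Bochner_Integration.integral_sum)
      have "(\<integral>\<omega>. B \<omega> \<partial>Q x) = (\<integral>\<omega>. (\<Sum>i=1..n. e (\<omega> i)) / n \<partial>Q x) + (\<integral>x. e x \<partial>\<pi>)
        + (\<Sum>j\<in>J. \<integral>\<omega>. w j * ((\<kappa> j * N j + (\<Sum>p\<in>A j. (D j p \<omega>)\<^sup>2) / \<kappa> j) / 2) \<partial>Q x)"
        unfolding B_def by (rule expectation_add_const_sum) (use 1 2 in auto)
      then show ?thesis unfolding 4 by (simp only: 3 cong: sum.cong)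
    qed
    also have "\<dots> \<le> G x"
      unfolding G_def using U(2)[of _ x] \<kappa>(1) w
      by (intro add_left_mono sum_mono mult_left_mono divide_right_mono) (auto intro: less_imp_le)
    finally show ?thesis .
  qed
  have iavg: "integrable \<pi> ((avg ^^ i) e)" for i by (rule lipschitz_integrable[OF pi_P1 avg_pow_lipschitz[OF e]])
  have iG: "integrable \<pi> G" unfolding G_def using iavg U(3) by auto
  have "(\<integral>x. g x \<partial>\<pi>) \<le> (\<integral>x. G x \<partial>\<pi>)"
    by (intro integral_mono lipschitz_integrable[OF pi_P1 g] iG gG)
  also have "\<dots> = 2 * (\<integral>x. e x \<partial>\<pi>) + (\<Sum>j\<in>J. w j * ((\<kappa> j * N j + (\<integral>x. U j x \<partial>\<pi>) / \<kappa> j) / 2))"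
  proof -
    have 1: "(\<integral>x. (\<Sum>i=1..n. (avg ^^ i) e x) / n \<partial>\<pi>) = (\<integral>x. e x \<partial>\<pi>)"
      using iavg n by (simp add: Bochner_Integration.integral_sum integral_avg_pow_nonneg[OF e e0])
    have 2: "(\<integral>x. w j * ((\<kappa> j * N j + U j x / \<kappa> j) / 2) \<partial>\<pi>) = w j * ((\<kappa> j * N j + (\<integral>x. U j x \<partial>\<pi>) / \<kappa> j) / 2)" if "j \<in> J" for j
      using U(3)[OF that] pi.prob_space by simp
    have 3: "integrable \<pi> (\<lambda>x. (\<Sum>i=1..n. (avg ^^ i) e x) / n)" using iavg by auto
    have 4: "integrable \<pi> (\<lambda>x. w j * ((\<kappa> j * N j + U j x / \<kappa> j) / 2))" if "j \<in> J" for j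
      using U(3)[OF that] by simp
    have "(\<integral>x. G x \<partial>\<pi>) = (\<integral>x. (\<Sum>i=1..n. (avg ^^ i) e x) / n \<partial>\<pi>) + (\<integral>x. e x \<partial>\<pi>)
        + (\<Sum>j\<in>J. \<integral>x. w j * ((\<kappa> j * N j + U j x / \<kappa> j) / 2) \<partial>\<pi>)"
      unfolding G_def by (rule pi.expectation_add_const_sum) (use 3 4 in auto)
    then show ?thesis unfolding 1 by (simp only: 2 cong: sum.cong)
  qed
  also have "\<dots> \<le> 2 * (\<integral>x. e x \<partial>\<pi>) + (\<Sum>j\<in>J. w j * sqrt (N j * V j))"
  proof (intro add_left_mono sum_mono mult_left_mono)
    fix j assume j: "j \<in> J"
    have "(\<integral>x. U j x \<partial>\<pi>) / \<kappa> j \<le> V j / \<kappa> j"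
      using order_trans[OF U(4)[OF j] conjunct2[OF V[OF j]]] \<kappa>(1)[OF j] by (simp add: divide_right_mono)
    then show "(\<kappa> j * N j + (\<integral>x. U j x \<partial>\<pi>) / \<kappa> j) / 2 \<le> sqrt (N j * V j)"
      using \<kappa>(2,3)[OF j] by simp
  qed (use w in auto)
  finally have gbound: "(\<integral>x. g x \<partial>\<pi>) \<le> 2 * (\<integral>x. e x \<partial>\<pi>) + (\<Sum>j\<in>J. w j * sqrt (N j * V j))" .
  \<comment> \<open>The bias of starting at 0 and not in equilibrium, at most
    \<open>l * m1\<close>.\<close>
  have "g 0 \<le> (\<integral>x. g x + l * norm x \<partial>\<pi>)"
  proof -
    have "(\<integral>x. g 0 \<partial>\<pi>) \<le> (\<integral>x. g x + l * norm x \<partial>\<pi>)"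
      using lipschitz_real_abs[OF g, of 0] lipschitz_integrable[OF pi_P1 g] P1D(3)[OF pi_P1]
      by (intro integral_mono) (auto simp: abs_le_iff algebra_simps)
    then show ?thesis using pi.prob_space by simp
  qed
  also have "\<dots> = (\<integral>x. g x \<partial>\<pi>) + l * (\<integral>x. norm x \<partial>\<pi>)"
    using lipschitz_integrable[OF pi_P1 g] P1D(3)[OF pi_P1] by simp
  finally have g0: "g 0 \<le> l * (\<integral>x. norm x \<partial>\<pi>) + 2 * (\<integral>x. e x \<partial>\<pi>) + (\<Sum>j\<in>J. w j * sqrt (N j * V j))"
    using gbound by simp
  show ?thesis
    unfolding l_def[symmetric] by (intro exI[of _ "g 0"] conjI allI g0 g1)
qed

end

section \<open>The mean Wasserstein distance\<close>

context contractive_kernel_invariant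
begin

abbreviation m1 :: real where "m1 \<equiv> (\<integral>x. norm x \<partial>\<pi>)"

lemma m1_nonneg: "0 \<le> m1" by simp

lemma norm_lipschitz: "1-lipschitz_on UNIV (\<lambda>x::'a. norm x)"
  by (rule lipschitz_realI) (auto intro: norm_triangle_ineq2)

text \<open>The positive part of \<open>z\<close> is at most \<open>exp (l * z) / l\<close>, which
  reduces the tail to an exponential moment of \<open>\<pi>\<close>; the rate \<open>l\<close> stays
  free.\<close>

lemma tail_le:
  assumes l: "0 < l"
  shows "(\<integral>x. max 0 (norm x - b) \<partial>\<pi>) \<le> exp (- (l * b)) / l * exp (l * m1 + C / (4 * (1 - r)) * l\<^sup>2)"
proof -
  have L: "l-lipschitz_on UNIV (\<lambda>x::'a. l * norm x)"
    using norm_lipschitz l by (auto simp: lipschitz_on_def dist_real_def right_diff_distrib[symmetric] abs_mult)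
  note i = subgaussian_integral[OF pi_P1 subgaussian_pi L]
  have pt: "max 0 (norm x - b) \<le> exp (- (l * b)) / l * exp (l * norm x)" for x :: 'a
  proof -
    have "l * (norm x - b) \<le> exp (l * (norm x - b))" using exp_ge_add_one_self[of "l * (norm x - b)"] by linarith
    then have "norm x - b \<le> exp (l * (norm x - b)) / l" using l by (simp add: field_simps)
    also have "\<dots> = exp (- (l * b)) / l * exp (l * norm x)" by (simp add: right_diff_distrib exp_diff exp_minus field_simps)
    finally show ?thesis using l by simp
  qed
  have "(\<integral>x. max 0 (norm x - b) \<partial>\<pi>) \<le> (\<integral>x. exp (- (l * b)) / l * exp (l * norm x) \<partial>\<pi>)"
  proof (rule integral_mono)
    show "integrable \<pi> (\<lambda>x. max 0 (norm x - b))"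
      using P1D(3)[OF pi_P1] by (intro integrable_max) auto
  qed (use i pt in auto)
  also have "\<dots> = exp (- (l * b)) / l * (\<integral>x. exp (l * norm x) \<partial>\<pi>)" by simp
  also have "\<dots> \<le> exp (- (l * b)) / l * exp (l * m1 + C / (4 * (1 - r)) * l\<^sup>2)"
    using i(2) l by (intro mult_left_mono) auto
  finally show ?thesis .
qed

text \<open>Estimating the minimum by 1 keeps the bound at the first moment, free of the factor
  \<open>1 / (1 - r)\<close> that the variance would bring.\<close>

lemma deviation_integral_le_mean:
  assumes "0 \<le> \<Lambda>"
  shows "deviation_integral \<Lambda> \<le> 2 * m1"
proof -
  have "deviation_integral \<Lambda> \<le> (\<integral>x. norm x + m1 \<partial>\<pi>)"
    unfolding deviation_integral_def
  proof (rule integral_mono[OF integrable_min_dev[OF assms]])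
    show "integrable \<pi> (\<lambda>x. norm x + m1)" using P1D(3)[OF pi_P1] by simp
    fix x
    have "min 1 (\<Lambda> * dev x) * dev x \<le> dev x" using dev_nonneg[of x] by (simp add: mult_left_le_one_le assms)
    also have "\<dots> \<le> norm x + m1" by (rule dev_le)
    finally show "min 1 (\<Lambda> * dev x) * dev x \<le> norm x + m1" .
  qed
  then show ?thesis using P1D(3)[OF pi_P1] pi.prob_space by simp
qed

end

locale contractive_kernel_cart = contractive_kernel_invariant P C r \<pi>
  for P :: "real ^ 'd \<Rightarrow> (real ^ 'd) measure" and C r :: real and \<pi> :: "(real ^ 'd) measure"
begin

text \<open>Each coordinate has variance at most \<open>2 * S\<close> by
  \<open>subgaussian_variance\<close>, hence mean absolute deviation at most \<open>q\<close>. The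
  dimension enters through the l1 bound on the norm and through Cauchy-Schwarz over the
  coordinates.\<close>

lemma dev_square:
  shows "integrable \<pi> (\<lambda>x. (dev x)\<^sup>2)" "(\<integral>x. (dev x)\<^sup>2 \<partial>\<pi>) \<le> 8 * (real CARD('d))\<^sup>2 * (C / (1 - r))"
proof -
  define S where "S = C / (1 - r)"
  have S: "0 < S" using C_pos r_less_1 by (simp add: S_def)
  define q where "q = sqrt (2 * S)"
  have q: "0 < q" "q\<^sup>2 = 2 * S" using S by (auto simp: q_def)
  define \<mu> where "\<mu> i = (\<integral>x. x $ i \<partial>\<pi>)" for i :: 'd
  have cL: "1-lipschitz_on UNIV (\<lambda>x::real^'d. x $ i)" for i
    using component_le_norm_cart[of "x - y" i for x y :: "real ^ 'd"]
    by (intro lipschitz_realI) (auto simp: abs_le_iff)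
  have S0: "0 < C / (4 * (1 - r))" "8 * (C / (4 * (1 - r))) = 2 * S" using C_pos r_less_1 by (simp_all add: S_def divide_simps)
  have vi: "integrable \<pi> (\<lambda>x. (x $ i - \<mu> i)\<^sup>2)" "(\<integral>x. (x $ i - \<mu> i)\<^sup>2 \<partial>\<pi>) \<le> 2 * S" for i
    using subgaussian_variance[OF pi_P1 subgaussian_pi S0(1) cL, of i] S0(2) by (auto simp: \<mu>_def)
  have ci: "integrable \<pi> (\<lambda>x. x $ i)" for i by (rule lipschitz_integrable[OF pi_P1 cL])
  have ad: "(\<integral>x. \<bar>x $ i - \<mu> i\<bar> \<partial>\<pi>) \<le> q" for i
  proof -
    have "(\<integral>x. \<bar>x $ i - \<mu> i\<bar> \<partial>\<pi>) \<le> (\<integral>x. ((x $ i - \<mu> i)\<^sup>2 / q + q) / 2 \<partial>\<pi>)"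
    proof (rule integral_mono)
      fix x :: "real ^ 'd"
      have "0 \<le> (\<bar>x $ i - \<mu> i\<bar> - q)\<^sup>2" by simp
      also have "\<dots> = (x $ i - \<mu> i)\<^sup>2 + q * q - 2 * \<bar>x $ i - \<mu> i\<bar> * q"
        unfolding power2_diff[of "\<bar>x $ i - \<mu> i\<bar>"] power2_abs by (simp add: power2_eq_square)
      finally show "\<bar>x $ i - \<mu> i\<bar> \<le> ((x $ i - \<mu> i)\<^sup>2 / q + q) / 2" using q by (simp add: field_simps)
    qed (use ci vi in auto)
    also have "\<dots> = ((\<integral>x. (x $ i - \<mu> i)\<^sup>2 \<partial>\<pi>) / q + q) / 2" using vi pi.prob_space by simp
    also have "\<dots> \<le> (q\<^sup>2 / q + q) / 2" using vi(2)[of i] q by (simp add: divide_right_mono)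
    also have "\<dots> = q" using q(1) by (simp add: power2_eq_square)
    finally show ?thesis .
  qed
  have dle: "dev x \<le> (\<Sum>i\<in>UNIV. \<bar>x $ i - \<mu> i\<bar> + q)" for x
  proof -
    have "dev x \<le> (\<integral>y. (\<Sum>i\<in>UNIV. \<bar>x $ i - \<mu> i\<bar> + \<bar>y $ i - \<mu> i\<bar>) \<partial>\<pi>)"
      unfolding dev_def
    proof (rule integral_mono[OF integrable_norm_diff_pi])
      fix y
      have "norm (x - y) \<le> (\<Sum>i\<in>UNIV. \<bar>(x - y) $ i\<bar>)" by (rule norm_le_l1_cart)
      also have "\<dots> \<le> (\<Sum>i\<in>UNIV. \<bar>x $ i - \<mu> i\<bar> + \<bar>y $ i - \<mu> i\<bar>)" by (intro sum_mono) auto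
      finally show "norm (x - y) \<le> (\<Sum>i\<in>UNIV. \<bar>x $ i - \<mu> i\<bar> + \<bar>y $ i - \<mu> i\<bar>)" .
    qed (use ci in auto)
    also have "\<dots> = (\<Sum>i\<in>UNIV. \<bar>x $ i - \<mu> i\<bar> + (\<integral>y. \<bar>y $ i - \<mu> i\<bar> \<partial>\<pi>))"
      using ci pi.prob_space by (subst Bochner_Integration.integral_sum) auto
    also have "\<dots> \<le> (\<Sum>i\<in>UNIV. \<bar>x $ i - \<mu> i\<bar> + q)" using ad by (intro sum_mono) auto
    finally show ?thesis .
  qed
  have pt: "(dev x)\<^sup>2 \<le> CARD('d) * (\<Sum>i\<in>UNIV. 2 * (x $ i - \<mu> i)\<^sup>2 + 2 * q\<^sup>2)" for x
  proof -
    have "(dev x)\<^sup>2 \<le> (\<Sum>i\<in>UNIV. \<bar>x $ i - \<mu> i\<bar> + q)\<^sup>2" using dle dev_nonneg by (intro power_mono) auto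
    also have "\<dots> \<le> (\<Sum>i\<in>(UNIV::'d set). (\<bar>x $ i - \<mu> i\<bar> + q)\<^sup>2) * CARD('d)" by (rule sum_squared_le_sum_of_squares)
    also have "\<dots> \<le> (\<Sum>i\<in>(UNIV::'d set). 2 * (x $ i - \<mu> i)\<^sup>2 + 2 * q\<^sup>2) * CARD('d)"
    proof (intro mult_right_mono sum_mono)
      fix i :: 'd
      have "0 \<le> (\<bar>x $ i - \<mu> i\<bar> - q)\<^sup>2" by simp
      moreover have "(\<bar>x $ i - \<mu> i\<bar> + q)\<^sup>2 + (\<bar>x $ i - \<mu> i\<bar> - q)\<^sup>2 = 2 * (x $ i - \<mu> i)\<^sup>2 + 2 * q\<^sup>2"
        unfolding power2_sum[of "\<bar>x $ i - \<mu> i\<bar>"] power2_diff[of "\<bar>x $ i - \<mu> i\<bar>"] power2_abs by simp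
      ultimately show "(\<bar>x $ i - \<mu> i\<bar> + q)\<^sup>2 \<le> 2 * (x $ i - \<mu> i)\<^sup>2 + 2 * q\<^sup>2" by linarith
    qed simp
    finally show ?thesis by (simp add: mult.commute)
  qed
  have ib: "integrable \<pi> (\<lambda>x. CARD('d) * (\<Sum>i\<in>UNIV. 2 * (x $ i - \<mu> i)\<^sup>2 + 2 * q\<^sup>2))" using vi by auto
  show i: "integrable \<pi> (\<lambda>x. (dev x)\<^sup>2)"
  proof (rule Bochner_Integration.integrable_bound[OF ib])
    have [measurable]: "dev \<in> borel_measurable \<pi>" by measurable
    show "(\<lambda>x. (dev x)\<^sup>2) \<in> borel_measurable \<pi>" by measurable
    show "AE x in \<pi>. norm ((dev x)\<^sup>2) \<le> norm (CARD('d) * (\<Sum>i\<in>UNIV. 2 * (x $ i - \<mu> i)\<^sup>2 + 2 * q\<^sup>2))"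
      by (intro AE_I2) (simp only: real_norm_def abs_power2, rule order_trans[OF pt abs_ge_self])
  qed
  have "(\<integral>x. (dev x)\<^sup>2 \<partial>\<pi>) \<le> (\<integral>x. CARD('d) * (\<Sum>i\<in>UNIV. 2 * (x $ i - \<mu> i)\<^sup>2 + 2 * q\<^sup>2) \<partial>\<pi>)"
    by (intro integral_mono i ib pt)
  also have "\<dots> = CARD('d) * (\<Sum>i\<in>(UNIV::'d set). 2 * (\<integral>x. (x $ i - \<mu> i)\<^sup>2 \<partial>\<pi>) + 2 * q\<^sup>2)"
    using vi pi.prob_space by (simp add: Bochner_Integration.integral_sum)
  also have "\<dots> \<le> CARD('d) * (\<Sum>i\<in>(UNIV::'d set). 2 * (2 * S) + 2 * (2 * S))"
    using vi(2) q by (intro mult_left_mono sum_mono) auto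
  also have "\<dots> = 8 * (real CARD('d))\<^sup>2 * S" by (simp add: power2_eq_square)
  finally show "(\<integral>x. (dev x)\<^sup>2 \<partial>\<pi>) \<le> 8 * (real CARD('d))\<^sup>2 * (C / (1 - r))" by (simp add: S_def)
qed

lemma deviation_integral_le_variance:
  assumes "0 \<le> \<Lambda>"
  shows "deviation_integral \<Lambda> \<le> \<Lambda> * (8 * (real CARD('d))\<^sup>2 * (C / (1 - r)))"
proof -
  have "deviation_integral \<Lambda> \<le> (\<integral>x. \<Lambda> * (dev x)\<^sup>2 \<partial>\<pi>)"
    unfolding deviation_integral_def
  proof (rule integral_mono[OF integrable_min_dev[OF assms]])
    show "integrable \<pi> (\<lambda>x. \<Lambda> * (dev x)\<^sup>2)" using dev_square(1) by simp
    fix x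
    have "min 1 (\<Lambda> * dev x) * dev x \<le> \<Lambda> * dev x * dev x" using dev_nonneg[of x] by (intro mult_right_mono) auto
    then show "min 1 (\<Lambda> * dev x) * dev x \<le> \<Lambda> * (dev x)\<^sup>2" by (simp add: power2_eq_square)
  qed
  also have "\<dots> = \<Lambda> * (\<integral>x. (dev x)\<^sup>2 \<partial>\<pi>)" by simp
  also have "\<dots> \<le> \<Lambda> * (8 * (real CARD('d))\<^sup>2 * (C / (1 - r)))" using dev_square(2) assms by (rule mult_left_mono)
  finally show ?thesis .
qed

text \<open>\<open>V\<close> is left open because the two regimes of
  \<open>kr_dual_mean_bound\<close> estimate \<open>deviation_integral\<close> in different
  ways.\<close>

lemma kr_dual_concentration:
  fixes n N J :: nat and s0 :: real and V :: "nat \<Rightarrow> real"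
  assumes n: "1 \<le> n" and s0: "0 < s0" and N: "1 \<le> N"
    and V: "\<And>j. j \<le> J \<Longrightarrow> 0 < V j \<and> 2 * (8 * real CARD('d) / (2 ^ j * s0)) / (n * (1 - r)) * deviation_integral (8 * real CARD('d) / (2 ^ j * s0)) \<le> V j"
  shows "\<exists>E. E \<le> 1 / (n * (1 - r)) * m1 + 2 * (\<integral>x. multiscale_error CARD('d) s0 N J x \<partial>\<pi>)
        + (\<Sum>j\<le>J. 3 * real CARD('d) * (2 ^ j * s0) * sqrt ((21 * real (boxes N J j)) ^ CARD('d) * V j))
    \<and> (\<forall>t. (\<integral>\<^sup>+\<omega>. ennreal (exp (t * kr_dual \<pi> n \<omega>)) \<partial>Q 0) \<le> ennreal (exp (t * E + n * (C / 4 * (t * (1 / (n * (1 - r))))\<^sup>2))))"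
proof -
  define M where "M = boxes N J"
  define s where "s j = 2 ^ j * s0" for j :: nat
  have s: "0 < s j" for j using s0 by (simp add: s_def)
  have r1: "0 < 1 - r" using r_less_1 by simp
  have pl: "path_lip (1 / n) (1 / (n * (1 - r))) n (kr_dual \<pi> n)"
    unfolding path_lip_def
  proof (intro allI)
    fix \<omega> \<omega>' :: "nat \<Rightarrow> real ^ 'd"
    have "\<bar>kr_dual \<pi> n \<omega> - kr_dual \<pi> n \<omega>'\<bar> \<le> (\<Sum>i=1..n. 1 / n * norm (\<omega> i - \<omega>' i))" by (rule kr_dual_lipschitz[OF pi_P1 n])
    also have "{1..n} = insert n {1..<n}" using n by auto
    also have "(\<Sum>i\<in>insert n {1..<n}. 1 / n * norm (\<omega> i - \<omega>' i)) = 1 / n * (\<Sum>i\<in>{1..<n}. norm (\<omega> i - \<omega>' i)) + 1 / n * norm (\<omega> n - \<omega>' n)"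
      by (simp add: sum_distrib_left)
    \<comment> \<open>The weight of the last coordinate is enlarged to the value that reproduces
      itself under \<open>path_lip_step\<close> with \<open>c = 1 / n\<close>.\<close>
    also have "1 / n * norm (\<omega> n - \<omega>' n) \<le> 1 / (n * (1 - r)) * norm (\<omega> n - \<omega>' n)"
      using n r1 r_nonneg by (intro mult_right_mono divide_left_mono) (auto simp: mult_le_cancel_left1)
    finally show "\<bar>kr_dual \<pi> n \<omega> - kr_dual \<pi> n \<omega>'\<bar> \<le> 1 / n * (\<Sum>i = 1..<n. norm (\<omega> i - \<omega>' i)) + 1 / (n * (1 - r)) * norm (\<omega> n - \<omega>' n)"
      by simp
  qed
  show ?thesis
    unfolding s_def[symmetric] M_def[symmetric]
  proof (rule concentration_around_mean_bound[where e="multiscale_error CARD('d) s0 N J" and J="{..J}"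
        and A="\<lambda>j. pairs (M j) (M (Suc j))" and \<psi>="\<lambda>j. pbump (s j) (M j) (M (Suc j))"
        and \<Lambda>="\<lambda>j. 8 * real CARD('d) / s j" and w="\<lambda>j. 3 * real CARD('d) * s j"
        and V=V and N="\<lambda>j. (21 * real (M j)) ^ CARD('d)", OF n pl])
    show "0 \<le> kr_dual \<pi> n \<omega>" for \<omega> by (rule kr_dual_nonneg[OF pi_P1 n])
    show "(8 * real CARD('d) / N + 14 * real CARD('d))-lipschitz_on UNIV (multiscale_error CARD('d) s0 N J :: real ^ 'd \<Rightarrow> real)"
      by (rule multiscale_error_lipschitz)
    show "0 \<le> multiscale_error CARD('d) s0 N J x" for x :: "real ^ 'd" by (rule multiscale_error_nonneg[OF s0])
    show "finite (pairs (M j) (M (Suc j)) :: (('d \<Rightarrow> int) \<times> ('d \<Rightarrow> int)) set)" for j by (rule finite_pairs)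
    show "0 \<le> pbump (s j) (M j) (M (Suc j)) p x \<and> pbump (s j) (M j) (M (Suc j)) p x \<le> 1" for j x and p :: "('d \<Rightarrow> int) \<times> ('d \<Rightarrow> int)"
      by (simp add: pbump_nonneg pbump_le_1)
    show "(\<Sum>p\<in>pairs (M j) (M (Suc j)). \<bar>pbump (s j) (M j) (M (Suc j)) p x - pbump (s j) (M j) (M (Suc j)) p y\<bar>) \<le> 8 * real CARD('d) / s j * norm (x - y)"
      for j and x y :: "real ^ 'd"
      using sum_abs_pbump_diff_le[OF s] by simp
    show "0 < V j \<and> 2 * (8 * real CARD('d) / s j) / (n * (1 - r)) * deviation_integral (8 * real CARD('d) / s j) \<le> V j" if "j \<in> {..J}" for j
      using V[of j] that by (simp add: s_def)
    show "0 < (21 * real (M j)) ^ CARD('d) \<and> real (card (pairs (M j) (M (Suc j)) :: (('d \<Rightarrow> int) \<times> ('d \<Rightarrow> int)) set)) \<le> (21 * real (M j)) ^ CARD('d)"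
      if "j \<in> {..J}" for j
    proof -
      have M1: "1 \<le> M j" using boxes_ge_1[OF N, of j J] that by (simp add: M_def)
      have "real (card (pairs (M j) (M (Suc j)) :: (('d \<Rightarrow> int) \<times> ('d \<Rightarrow> int)) set)) \<le> real ((7 * (2 * M j + 1)) ^ CARD('d))"
        using card_pairs_le[of "M j" "M (Suc j)"] of_nat_mono by blast
      \<comment> \<open>\<open>2 * M j + 1 <= 3 * M j\<close>, whence 21.\<close>
      also have "\<dots> \<le> real ((21 * M j) ^ CARD('d))" using M1 by (intro of_nat_mono power_mono) auto
      finally show ?thesis using M1 by simp
    qed
    show "kr_dual \<pi> n \<omega> \<le> (\<Sum>i=1..n. multiscale_error CARD('d) s0 N J (\<omega> i)) / n + (\<integral>x. multiscale_error CARD('d) s0 N J x \<partial>\<pi>)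
      + (\<Sum>j\<in>{..J}. 3 * real CARD('d) * s j * (\<Sum>p\<in>pairs (M j) (M (Suc j)). \<bar>(\<Sum>i=1..n. pbump (s j) (M j) (M (Suc j)) p (\<omega> i)) / n - (\<integral>x. pbump (s j) (M j) (M (Suc j)) p x \<partial>\<pi>)\<bar>))" for \<omega>
      using kr_dual_le_multiscale[OF pi_P1 n s0 N, of \<omega> J] by (simp add: s_def M_def)
  qed (use s in \<open>auto intro: less_imp_le\<close>)
qed

end

section \<open>Summation over the levels and the dimensional constants\<close>

text \<open>A geometric sum is a multiple of its largest term; the threshold 4/3 lies below both
  \<open>sqrt 2\<close> and \<open>sqrt (2 ^ d)\<close>, the two ratios that occur.\<close>

lemma sum_power_le_top:
  fixes b :: real
  assumes "4 / 3 \<le> b"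
  shows "(\<Sum>i\<le>J. b ^ i) \<le> 4 * b ^ J"
proof (induction J)
  case (Suc J)
  have "b ^ J * 4 \<le> b ^ J * (3 * b)" using assms by (intro mult_left_mono) auto
  then show ?case using Suc by (simp add: algebra_simps)
qed simp

lemma sqrt_power_2_ge: "1 \<le> d \<Longrightarrow> 4 / 3 \<le> sqrt (2 ^ d)"
proof -
  assume "1 \<le> d"
  then have "(2::real) ^ 1 \<le> 2 ^ d" by (intro power_increasing) auto
  then have "(4 / 3 :: real)\<^sup>2 \<le> 2 ^ d" by (simp add: power2_eq_square)
  then show ?thesis by (rule real_le_rsqrt)
qed

text \<open>The weight \<open>2^j s0\<close> cancels against the square root of the variance term,
  so only the number of boxes counts: the terms grow like \<open>sqrt (2 ^ d)\<close> to the power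
  \<open>J - j\<close> and the finest level dominates. The ratio \<open>2^J\<close> of outer radius
  to mesh enters with power \<open>d / 2\<close>.\<close>

lemma level_sum_variance:
  fixes d J :: nat and M :: "nat \<Rightarrow> nat" and s0 D :: real
  assumes d: "1 \<le> d" and s0: "0 < s0" and D: "0 \<le> D" and M: "\<And>j. j \<le> J \<Longrightarrow> M j \<le> 2 ^ (J - j)"
  shows "(\<Sum>j\<le>J. 3 * d * (2 ^ j * s0) * sqrt ((21 * M j) ^ d * (1024 * d ^ 4 * D / (2 ^ j * s0)\<^sup>2)))
    \<le> 384 * d ^ 3 * sqrt D * sqrt (21 ^ d * (2 ^ J) ^ d)"
proof -
  define b where "b = sqrt (2 ^ d)"
  have "(\<Sum>j\<le>J. 3 * d * (2 ^ j * s0) * sqrt ((21 * M j) ^ d * (1024 * d ^ 4 * D / (2 ^ j * s0)\<^sup>2)))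
      \<le> (\<Sum>j\<le>J. 96 * d ^ 3 * sqrt D * sqrt (21 ^ d) * b ^ (J - j))"
  proof (rule sum_mono)
    fix j assume "j \<in> {..J}"
    then have Mj: "M j \<le> 2 ^ (J - j)" using M by simp
    define s where "s = 2 ^ j * s0"
    have s: "0 < s" using s0 by (simp add: s_def)
    have "(1024 * d ^ 4 * D / s\<^sup>2) = (32 * d\<^sup>2 / s)\<^sup>2 * D" by (simp add: power_divide power_mult_distrib)
    then have "sqrt ((21 * M j) ^ d * (1024 * d ^ 4 * D / s\<^sup>2)) = sqrt ((21 * M j) ^ d) * (32 * d\<^sup>2 / s * sqrt D)"
      using s by (simp add: real_sqrt_mult)
    then have "3 * d * s * sqrt ((21 * M j) ^ d * (1024 * d ^ 4 * D / s\<^sup>2)) = 96 * d ^ 3 * sqrt D * sqrt ((21 * M j) ^ d)"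
      using s by (simp add: power2_eq_square power3_eq_cube)
    also have "\<dots> \<le> 96 * d ^ 3 * sqrt D * sqrt (21 ^ d * (2 ^ (J - j)) ^ d)"
    proof -
      have "real (M j) ^ d \<le> (2 ^ (J - j)) ^ d"
        using Mj by (intro power_mono) (metis of_nat_le_iff of_nat_numeral of_nat_power, simp)
      then show ?thesis using D by (intro mult_left_mono) (auto simp: power_mult_distrib)
    qed
    also have "\<dots> = 96 * d ^ 3 * sqrt D * sqrt (21 ^ d) * b ^ (J - j)"
      by (simp add: real_sqrt_mult b_def real_sqrt_power[symmetric] power_mult[symmetric] mult.commute[of d])
    finally show "3 * d * (2 ^ j * s0) * sqrt ((21 * M j) ^ d * (1024 * d ^ 4 * D / (2 ^ j * s0)\<^sup>2))
      \<le> 96 * d ^ 3 * sqrt D * sqrt (21 ^ d) * b ^ (J - j)" by (simp add: s_def)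
  qed
  also have "\<dots> = 96 * d ^ 3 * sqrt D * sqrt (21 ^ d) * (\<Sum>j\<le>J. b ^ j)"
    using sum.nat_diff_reindex[of "\<lambda>j. b ^ j" "Suc J"]
    by (simp add: sum_distrib_left[symmetric] lessThan_Suc_atMost)
  also have "\<dots> \<le> 96 * d ^ 3 * sqrt D * sqrt (21 ^ d) * (4 * b ^ J)"
    using D sqrt_power_2_ge[OF d] by (intro mult_left_mono sum_power_le_top) (auto simp: b_def)
  also have "\<dots> = 384 * d ^ 3 * sqrt D * sqrt (21 ^ d * (2 ^ J) ^ d)"
    by (simp add: real_sqrt_mult b_def real_sqrt_power[symmetric] power_mult[symmetric] mult.commute[of d])
  finally show ?thesis .
qed

text \<open>Here the second moments decay only like the inverse mesh, so with at most
  \<open>N\<close> boxes per half-axis the terms grow like \<open>sqrt (2^j s0)\<close> and the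
  coarsest level dominates. The outer radius \<open>2^J s0\<close> thus appears with power 1/2
  instead of \<open>d / 2\<close>.\<close>

lemma level_sum_mean:
  fixes d J N :: nat and M :: "nat \<Rightarrow> nat" and s0 T :: real
  assumes s0: "0 < s0" and T: "0 \<le> T" and M: "\<And>j. j \<le> J \<Longrightarrow> M j \<le> N"
  shows "(\<Sum>j\<le>J. 3 * d * (2 ^ j * s0) * sqrt ((21 * M j) ^ d * (T / (2 ^ j * s0))))
    \<le> 12 * d * sqrt ((21 * N) ^ d * (T * (2 ^ J * s0)))"
proof -
  have "(\<Sum>j\<le>J. 3 * d * (2 ^ j * s0) * sqrt ((21 * M j) ^ d * (T / (2 ^ j * s0))))
      \<le> (\<Sum>j\<le>J. 3 * d * sqrt ((21 * N) ^ d * (T * s0)) * sqrt 2 ^ j)"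
  proof (rule sum_mono)
    fix j assume "j \<in> {..J}"
    then have Mj: "M j \<le> N" using M by simp
    define s where "s = 2 ^ j * s0"
    have s: "0 < s" using s0 by (simp add: s_def)
    have "s * sqrt ((21 * M j) ^ d * (T / s)) = sqrt (s\<^sup>2) * sqrt ((21 * M j) ^ d * (T / s))" using s by simp
    also have "\<dots> = sqrt (s\<^sup>2 * ((21 * M j) ^ d * (T / s)))" by (rule real_sqrt_mult[symmetric])
    also have "s\<^sup>2 * ((21 * M j) ^ d * (T / s)) = (21 * M j) ^ d * (T * s)" using s by (simp add: power2_eq_square)
    also have "sqrt ((21 * M j) ^ d * (T * s)) \<le> sqrt ((21 * N) ^ d * (T * s))"
      using Mj T s by (intro real_sqrt_le_mono mult_right_mono of_nat_mono power_mono) (auto intro!: power_mono)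
    also have "\<dots> = sqrt ((21 * N) ^ d * (T * s0)) * sqrt 2 ^ j"
      by (simp add: s_def real_sqrt_mult real_sqrt_power[symmetric])
    finally have "3 * d * (s * sqrt ((21 * M j) ^ d * (T / s))) \<le> 3 * d * (sqrt ((21 * N) ^ d * (T * s0)) * sqrt 2 ^ j)"
      by (intro mult_left_mono) auto
    then show "3 * d * (2 ^ j * s0) * sqrt ((21 * M j) ^ d * (T / (2 ^ j * s0))) \<le> 3 * d * sqrt ((21 * N) ^ d * (T * s0)) * sqrt 2 ^ j"
      by (simp only: s_def mult.assoc)
  qed
  also have "\<dots> = 3 * d * sqrt ((21 * N) ^ d * (T * s0)) * (\<Sum>j\<le>J. sqrt 2 ^ j)"
    by (simp add: sum_distrib_left)
  also have "\<dots> \<le> 3 * d * sqrt ((21 * N) ^ d * (T * s0)) * (4 * sqrt 2 ^ J)"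
    using sqrt_power_2_ge[of 1] s0 T by (intro mult_left_mono sum_power_le_top) auto
  also have "\<dots> = 12 * d * sqrt ((21 * N) ^ d * (T * (2 ^ J * s0)))"
    by (simp add: real_sqrt_mult real_sqrt_power[symmetric])
  finally show ?thesis .
qed

text \<open>Chosen so that \<open>ln (336 * d * u) <= log_const d * ln u\<close> for
  \<open>u >= 2\<close>; 336 comes from the tail estimate in
  \<open>kr_dual_mean_bound\<close>.\<close>

definition log_const :: "nat \<Rightarrow> real" where
  "log_const d = ln (336 * real d) / ln 2 + 1"

text \<open>The constant of the regime \<open>a * S <= 1\<close>: 21 counts pairs, and
  \<open>256 * d * log_const d\<close> is the factor of \<open>u * ln u\<close> in the bound on
  \<open>2^J\<close>.\<close>

definition variance_const :: "nat \<Rightarrow> real" where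
  "variance_const d = 384 * real d ^ 3 * sqrt ((21 * (256 * real d * log_const d)) ^ d)"

text \<open>The constant of the other regime: \<open>2730 = 21 * 65 * 2\<close>, where 65 comes from
  \<open>N <= 65 * d * u\<close> and 2 from the power of \<open>2 * ln u\<close>.\<close>

definition mean_const :: "nat \<Rightarrow> real" where
  "mean_const d = 12 * real d * sqrt ((2730 * real d) ^ d * (64 * real d * (log_const d + 2)))"

lemma log_const_ge_1: "1 \<le> d \<Longrightarrow> 1 \<le> log_const d"
  by (simp add: log_const_def)

lemma ln_2_ge: "1 / 2 \<le> ln (2::real)"
  using ln_ge_iff[of 2 "1/2"] exp_bound_half[of "1/2 :: real"] by simp

lemma ln_le_log_const:
  assumes d: "1 \<le> d" and u: "2 \<le> u"
  shows "ln (336 * real d * u) \<le> log_const d * ln u"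
proof -
  have "ln 2 \<le> ln u" using u by simp
  then have "ln (336 * real d) / ln 2 * ln 2 \<le> ln (336 * real d) / ln 2 * ln u"
    using d by (intro mult_left_mono) auto
  moreover have "ln (336 * real d) / ln 2 * ln 2 = ln (336 * real d)" by simp
  moreover have "ln (336 * real d * u) = ln (336 * real d) + ln u" using d u by (subst ln_mult) auto
  ultimately show ?thesis unfolding log_const_def distrib_right by linarith
qed

lemma exists_dyadic_scale:
  fixes s0 b :: real
  assumes "0 < s0" "s0 \<le> b"
  shows "\<exists>J. b \<le> 2 ^ J * s0 \<and> 2 ^ J * s0 \<le> 2 * b"
proof -
  have ex: "\<exists>J. b \<le> 2 ^ J * s0"
  proof -
    obtain J where "b / s0 < 2 ^ J" using real_arch_pow[of 2 "b / s0"] by auto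
    then show ?thesis using assms by (intro exI[of _ J]) (simp add: field_simps)
  qed
  define J where "J = (LEAST J. b \<le> 2 ^ J * s0)"
  have 1: "b \<le> 2 ^ J * s0" unfolding J_def by (rule LeastI_ex[OF ex])
  have "2 ^ J * s0 \<le> 2 * b"
  proof (cases J)
    case (Suc k)
    then have "\<not> b \<le> 2 ^ k * s0" using not_less_Least[of k "\<lambda>J. b \<le> 2 ^ J * s0"] by (simp add: J_def)
    then show ?thesis by (simp add: Suc)
  qed (use assms in simp)
  with 1 show ?thesis by blast
qed

context contractive_kernel_cart
begin

text \<open>All free parameters are fixed here so that the approximation error integrates to at most
  \<open>t / 4\<close>, and so that the fluctuation part is a dimensional multiple of
  \<open>sqrt D\<close> in both regimes. Adding the constants of the two regimes removes any trace
  of the case distinction.\<close>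

lemma kr_dual_mean_bound:
  fixes n :: nat and t a :: real
  assumes n: "1 \<le> n" and a_def: "a = 2 / C * (sqrt (4 * m1\<^sup>2 + C * ln 2) - 2 * m1)"
    and t: "0 < t" "t \<le> 1 / (2 * a)"
  shows "\<exists>E. E \<le> t / 2 + m1 / (n * (1 - r)) + (variance_const CARD('d) + mean_const CARD('d))
      * sqrt (C / (n * (1 - r)\<^sup>2)) * sqrt ((1 / (a * t) * ln (1 / (a * t))) ^ CARD('d))
    \<and> (\<forall>t. (\<integral>\<^sup>+\<omega>. ennreal (exp (t * kr_dual \<pi> n \<omega>)) \<partial>Q 0) \<le> ennreal (exp (t * E + n * (C / 4 * (t * (1 / (n * (1 - r))))\<^sup>2))))"
proof -
  define d where "d = CARD('d)"
  have d1: "1 \<le> d" by (simp add: d_def Suc_leI)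
  then have d1': "1 \<le> real d" by simp
  have r1: "0 < 1 - r" using r_less_1 by simp
  have n0: "0 < real n" using n by simp
  note C = C_pos
  define q where "q = sqrt (4 * m1\<^sup>2 + C * ln 2)"
  have q2: "q\<^sup>2 = 4 * m1\<^sup>2 + C * ln 2" using C by (simp add: q_def)
  have q_gt: "2 * m1 < q"
    unfolding q_def by (rule real_less_rsqrt) (use C in \<open>simp add: power_mult_distrib\<close>)
  have aq: "a = 2 / C * (q - 2 * m1)" by (simp add: a_def q_def)
  have a0: "0 < a" using q_gt C by (simp add: aq)
  \<comment> \<open>The equation that defines \<open>a\<close>; both terms on the left are
    nonnegative and \<open>ln 2 <= 1\<close>, so \<open>a * m1 <= 1 / 2\<close>.\<close>
  have quad: "C * a\<^sup>2 / 4 + 2 * (a * m1) = ln 2"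
  proof -
    have "q = C * a / 2 + 2 * m1" using C by (simp add: aq field_simps)
    with q2 have "(C * a / 2 + 2 * m1)\<^sup>2 = 4 * m1\<^sup>2 + C * ln 2" by simp
    then have "C * (C * a\<^sup>2 / 4 + 2 * (a * m1)) = C * ln 2"
      by (simp add: power2_eq_square algebra_simps)
    then show ?thesis using C by simp
  qed
  have ln2: "ln 2 \<le> (1::real)" using ln_le_minus_one[of "2::real"] by simp
  have "0 \<le> C * a\<^sup>2 / 4" using C by simp
  with quad ln2 have am1: "a * m1 \<le> 1 / 2" by linarith
  then have m1a: "2 * m1 \<le> 1 / a" using a0 by (simp add: field_simps)
  define u where "u = 1 / (a * t)"
  have at: "0 < a * t" "a * t \<le> 1 / 2" using a0 t by (auto simp: field_simps)
  have u2: "2 \<le> u" using at by (simp add: u_def field_simps)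
  have tu: "t = 1 / (a * u)" using a0 t by (simp add: u_def)
  have lnu: "1 / 2 \<le> ln u" using ln_2_ge u2 by (intro order_trans[OF ln_2_ge]) simp
  define S where "S = sqrt (C / (1 - r))"
  have S2: "S\<^sup>2 = C / (1 - r)" and S0: "0 < S" using C r1 by (auto simp: S_def)
  \<comment> \<open>\<open>S\<close> is the scale of the fluctuations of \<open>\<pi>\<close>, so
    \<open>H\<close> measures by how much it exceeds \<open>1 / a\<close>. At the rate
    \<open>a / H\<close> the exponential moment of \<open>norm\<close> stays below 3.\<close>
  define H where "H = max 1 (a * S)"
  have H1: "1 \<le> H" "a * S \<le> H" by (auto simp: H_def)
  define D where "D = C / (n * (1 - r)\<^sup>2)"
  have D0: "0 < D" using C r1 n0 by (simp add: D_def)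
  \<comment> \<open>Mesh, relative resolution \<open>1 / N\<close> and outer radius are chosen so
    that the three parts of the integral of the error are at most \<open>t / 16\<close>,
    \<open>t / 16\<close> and \<open>t / 8\<close>.\<close>
  define s0 where "s0 = t / (64 * d)"
  have s0: "0 < s0" using t d1' by (simp add: s0_def)
  define N where "N = nat \<lceil>64 * real d * u\<rceil>"
  have N: "64 * real d * u \<le> N" "real N \<le> 65 * real d * u"
  proof -
    have du: "1 \<le> real d * u" using d1' u2 by (metis mult_mono' mult_1 one_le_numeral order_trans zero_le_one)
    show "64 * real d * u \<le> N" unfolding N_def by (rule real_nat_ceiling_ge)
    have "real N < 64 * real d * u + 1" unfolding N_def using du by linarith
    then show "real N \<le> 65 * real d * u" using du by simp
  qed
  have N1: "1 \<le> N"
  proof -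
    have "0 < 64 * real d * u" using d1' u2 by simp
    then show ?thesis using N(1) by (cases N) auto
  qed
  \<comment> \<open>\<open>336 = 3 * 112\<close>: 3 bounds the exponential moment, and
    \<open>14 * d * t / (112 * d) = t / 8\<close> is the share of the tail. The factors
    \<open>H\<close> and \<open>u\<close> cancel \<open>1 / l\<close> down to
    \<open>t\<close>.\<close>
  define X where "X = 336 * real d * H * u"
  have X: "1 \<le> 336 * real d" "1 \<le> X"
  proof -
    show 1: "1 \<le> 336 * real d" using d1' by simp
    have "1 * 1 * 1 \<le> 336 * real d * H * u" using 1 H1 u2 by (intro mult_mono) auto
    then show "1 \<le> X" by (simp add: X_def)
  qed
  \<comment> \<open>At the rate \<open>a / H\<close> the tail factor beyond \<open>R0 / 2\<close> is
    \<open>1 / X\<close>; the 2 makes up for the halved radius in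
    \<open>multiscale_error\<close>.\<close>
  define R0 where "R0 = 2 * (H / a) * ln X"
  have lnX: "ln X \<le> log_const d * ln u + ln H"
  proof -
    have "ln X = ln (336 * real d * u) + ln H"
      using d1' H1(1) u2 ln_mult[of "336 * real d * u" H] by (simp add: X_def mult_ac)
    then show ?thesis using ln_le_log_const[OF d1 u2] by simp
  qed
  have "s0 \<le> R0"
  proof -
    have "s0 \<le> t" using t d1' by (simp add: s0_def field_simps)
    also have "t \<le> 1 / (2 * a)" by (rule t)
    also have "\<dots> \<le> 2 * (1 / a) * (1 / 2)" using a0 by (simp add: field_simps)
    also have "\<dots> \<le> 2 * (H / a) * ln X"
    proof (intro mult_mono)
      have "u \<le> X"
      proof -
        have "1 * 1 * u \<le> 336 * real d * H * u" using X(1) H1 u2 by (intro mult_mono) auto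
        then show ?thesis by (simp add: X_def)
      qed
      then have "ln u \<le> ln X" using u2 by simp
      then show "1 / 2 \<le> ln X" using lnu by linarith
    qed (use a0 H1 in \<open>auto simp: divide_right_mono\<close>)
    finally show ?thesis by (simp add: R0_def)
  qed
  from exists_dyadic_scale[OF s0 this] obtain J where J: "R0 \<le> 2 ^ J * s0" "2 ^ J * s0 \<le> 2 * R0" by blast
  define e where "e = (multiscale_error d s0 N J :: real ^ 'd \<Rightarrow> real)"
  have e_le: "2 * (\<integral>x. e x \<partial>\<pi>) \<le> t / 2"
  proof -
    define l where "l = a / H"
    have l: "0 < l" using a0 H1 by (simp add: l_def)
    define b where "b = 2 ^ J * s0 / 2"
    have "(\<integral>x. max 0 (norm x - b) \<partial>\<pi>) \<le> exp (- (l * b)) / l * exp (l * m1 + C / (4 * (1 - r)) * l\<^sup>2)"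
      by (rule tail_le[OF l])
    also have "\<dots> \<le> 1 / X / l * 3"
    proof (intro mult_mono divide_right_mono)
      have "ln X = l * (R0 / 2)" using a0 H1 by (simp add: R0_def l_def)
      also have "\<dots> \<le> l * b" using J(1) l by (intro mult_left_mono) (auto simp: b_def)
      finally have "exp (- (l * b)) \<le> exp (- ln X)" by simp
      also have "\<dots> = 1 / X" using X by (simp add: exp_minus inverse_eq_divide)
      finally show "exp (- (l * b)) \<le> 1 / X" .
      have "l * m1 \<le> a * m1" using H1 a0 m1_nonneg by (intro mult_right_mono) (auto simp: l_def field_simps)
      moreover have "C / (4 * (1 - r)) * l\<^sup>2 \<le> 1 / 4"
      proof -
        have "C / (4 * (1 - r)) * l\<^sup>2 = (a * S)\<^sup>2 / H\<^sup>2 / 4"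
        proof -
          have "C / (4 * (1 - r)) = S\<^sup>2 / 4" unfolding S2 by simp
          then show ?thesis by (simp only: l_def power_divide power_mult_distrib) (simp add: mult.commute)
        qed
        moreover have "(a * S)\<^sup>2 \<le> H\<^sup>2" using H1 a0 S0 by (intro power_mono) auto
        then have "(a * S)\<^sup>2 / H\<^sup>2 \<le> 1" using H1 by simp
        ultimately show ?thesis by simp
      qed
      ultimately have "exp (l * m1 + C / (4 * (1 - r)) * l\<^sup>2) \<le> exp 1"
        using am1 unfolding exp_le_cancel_iff by linarith
      then show "exp (l * m1 + C / (4 * (1 - r)) * l\<^sup>2) \<le> 3" using exp_le by (rule order_trans)
    qed (use X l in auto)
    also have "\<dots> = t / (112 * d)"
      using a0 H1 d1' u2 by (simp add: X_def l_def tu field_simps)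
    finally have tail: "(\<integral>x. max 0 (norm x - b) \<partial>\<pi>) \<le> t / (112 * d)" .
    have i1: "integrable \<pi> (\<lambda>x. max 0 (norm x - b))" using P1D(3)[OF pi_P1] by (intro integrable_max) auto
    have "(\<integral>x. e x \<partial>\<pi>) = 4 * d * (s0 + 2 * m1 / N) + 14 * d * (\<integral>x. max 0 (norm x - b) \<partial>\<pi>)"
      unfolding e_def multiscale_error_def b_def[symmetric]
      using i1 P1D(3)[OF pi_P1] pi.prob_space by simp
    also have "\<dots> \<le> 4 * d * (s0 + t / (64 * d)) + 14 * d * (t / (112 * d))"
    proof -
      have "2 * m1 / N \<le> 1 / a / (64 * real d * u)"
        using m1a N d1' u2 m1_nonneg a0 by (intro frac_le) auto
      also have "\<dots> = t / (64 * d)" by (simp add: tu)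
      finally show ?thesis using tail by (intro add_mono mult_left_mono) auto
    qed
    also have "\<dots> = t / 4" using d1' by (simp add: s0_def field_simps)
    finally show ?thesis by simp
  qed
  define Y where "Y = sqrt ((u * ln u) ^ d)"
  have Y0: "0 \<le> Y" using u2 by (simp add: Y_def)
  have c0: "0 \<le> variance_const d" "0 \<le> mean_const d"
    using log_const_ge_1[OF d1] by (auto simp: variance_const_def mean_const_def)
  have "\<exists>V. (\<forall>j\<le>J. 0 < V j \<and> 2 * (8 * real d / (2 ^ j * s0)) / (n * (1 - r)) * deviation_integral (8 * real d / (2 ^ j * s0)) \<le> V j)
    \<and> (\<Sum>j\<le>J. 3 * real d * (2 ^ j * s0) * sqrt ((21 * real (boxes N J j)) ^ d * V j)) \<le> (variance_const d + mean_const d) * sqrt D * Y"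
  \<comment> \<open>For \<open>a * S <= 1\<close> the radius does not depend on \<open>r\<close>,
    and the variance of \<open>\<pi>\<close> gives the factor \<open>1 / (1 - r)^2\<close> in
    \<open>D\<close>: one power from the summed correlations, one from the variance.\<close>
  proof (cases "a * S \<le> 1")
    case True
    then have H: "H = 1" by (simp add: H_def)
    define V where "V j = 1024 * real d ^ 4 * D / (2 ^ j * s0)\<^sup>2" for j :: nat
    have V: "0 < V j \<and> 2 * (8 * real d / (2 ^ j * s0)) / (n * (1 - r)) * deviation_integral (8 * real d / (2 ^ j * s0)) \<le> V j" for j
    proof
      show "0 < V j" using d1' D0 s0 by (simp add: V_def)
      define L where "L = 8 * real d / (2 ^ j * s0)"
      have L: "0 \<le> L" using s0 by (simp add: L_def)
      have "2 * L / (n * (1 - r)) * deviation_integral L \<le> 2 * L / (n * (1 - r)) * (L * (8 * (real d)\<^sup>2 * (C / (1 - r))))"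
        using deviation_integral_le_variance[OF L] L r1 by (intro mult_left_mono) (auto simp: d_def)
      also have "\<dots> = V j"
        unfolding V_def L_def D_def using s0 r1 n0
        by (simp add: power2_eq_square power4_eq_xxxx field_simps)
      finally show "2 * (8 * real d / (2 ^ j * s0)) / (n * (1 - r)) * deviation_integral (8 * real d / (2 ^ j * s0)) \<le> V j"
        by (simp add: L_def)
    qed
    have "(\<Sum>j\<le>J. 3 * real d * (2 ^ j * s0) * sqrt ((21 * real (boxes N J j)) ^ d * V j))
      \<le> 384 * real d ^ 3 * sqrt D * sqrt (21 ^ d * (2 ^ J) ^ d)"
      using level_sum_variance[OF d1 s0 less_imp_le[OF D0], of J "boxes N J"] boxes_le(2)[of _ J N] by (simp add: V_def)
    also have "\<dots> \<le> 384 * real d ^ 3 * sqrt D * sqrt (21 ^ d * (256 * real d * log_const d * (u * ln u)) ^ d)"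
    proof -
      have "2 ^ J = 2 ^ J * s0 / s0" using s0 by simp
      also have "\<dots> \<le> 2 * R0 / s0" using J(2) s0 by (intro divide_right_mono) auto
      also have "\<dots> = 256 * real d * u * ln X" using a0 d1' by (simp add: R0_def H s0_def tu field_simps)
      also have "\<dots> \<le> 256 * real d * u * (log_const d * ln u)"
        using lnX d1' u2 by (intro mult_left_mono) (auto simp: H)
      finally have "(2::real) ^ J \<le> 256 * real d * log_const d * (u * ln u)" by (simp add: mult_ac)
      then show ?thesis using D0 by (intro mult_left_mono real_sqrt_le_mono power_mono) auto
    qed
    also have "\<dots> = variance_const d * sqrt D * Y"
      by (simp add: variance_const_def Y_def power_mult_distrib[symmetric] real_sqrt_mult[symmetric] mult_ac)
    also have "\<dots> \<le> (variance_const d + mean_const d) * sqrt D * Y"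
      using c0 D0 Y0 by (intro mult_right_mono) auto
    finally show ?thesis using V by blast
  next
    case False
    then have H: "H = a * S" by (simp add: H_def)
    \<comment> \<open>From the mean bound \<open>1 / a\<close> on \<open>deviation_integral\<close>,
      with \<open>8 * d / (2 ^ j * s0)\<close> as Lipschitz constant. It carries one power of
      \<open>1 / (1 - r)\<close>, one less than \<open>D\<close>.\<close>
    define T where "T = 16 * real d / (a * (n * (1 - r)))"
    have T: "0 < T" using d1' a0 n0 r1 by (simp add: T_def)
    define V where "V j = T / (2 ^ j * s0)" for j :: nat
    have V: "0 < V j \<and> 2 * (8 * real d / (2 ^ j * s0)) / (n * (1 - r)) * deviation_integral (8 * real d / (2 ^ j * s0)) \<le> V j" for j
    proof
      show "0 < V j" using T s0 by (simp add: V_def)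
      define L where "L = 8 * real d / (2 ^ j * s0)"
      have L: "0 \<le> L" using s0 by (simp add: L_def)
      have "2 * L / (n * (1 - r)) * deviation_integral L \<le> 2 * L / (n * (1 - r)) * (1 / a)"
        using order_trans[OF deviation_integral_le_mean[OF L] m1a] L r1 by (intro mult_left_mono) auto
      also have "\<dots> = V j" by (simp add: V_def L_def T_def)
      finally show "2 * (8 * real d / (2 ^ j * s0)) / (n * (1 - r)) * deviation_integral (8 * real d / (2 ^ j * s0)) \<le> V j"
        by (simp add: L_def)
    qed
    have "(\<Sum>j\<le>J. 3 * real d * (2 ^ j * s0) * sqrt ((21 * real (boxes N J j)) ^ d * V j))
      \<le> 12 * real d * sqrt ((21 * real N) ^ d * (T * (2 ^ J * s0)))"
      using level_sum_mean[OF s0 less_imp_le[OF T], of J "boxes N J" N d] boxes_le(1)[of N J] by (simp add: V_def)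
    also have "\<dots> \<le> 12 * real d * sqrt ((21 * (65 * real d * u)) ^ d * (64 * real d * (log_const d + 2) * D * (2 * ln u) ^ d))"
    proof (rule mult_left_mono, rule real_sqrt_le_mono, rule mult_mono)
      \<comment> \<open>The crude \<open>ln H <= H\<close> is affordable: with the \<open>H\<close>
        in \<open>R0\<close> it makes \<open>H^2 = a^2 * C / (1 - r)\<close>, exactly the factor
        that turns \<open>T / a\<close> into a multiple of \<open>D\<close>.\<close>
      have "ln H \<le> H * (2 * ln u)"
      proof -
        have "ln H \<le> H * 1" using ln_le_minus_one[of H] H1 by simp
        also have "\<dots> \<le> H * (2 * ln u)" using H1 lnu by (intro mult_left_mono) auto
        finally show ?thesis .
      qed
      moreover have "1 * (log_const d * ln u) \<le> H * (log_const d * ln u)"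
        using H1 lnu log_const_ge_1[OF d1] by (intro mult_right_mono) auto
      ultimately have "ln X \<le> (log_const d + 2) * H * ln u" using lnX by (simp add: algebra_simps)
      then have "2 * (H / a) * ln X \<le> 2 * (H / a) * ((log_const d + 2) * H * ln u)"
        using H1 a0 by (intro mult_left_mono) auto
      then have "2 ^ J * s0 \<le> 2 * (2 * (H / a) * ((log_const d + 2) * H * ln u))"
        using J(2) unfolding R0_def by linarith
      also have "\<dots> = 4 * (log_const d + 2) * H\<^sup>2 / a * ln u"
        by (simp add: power2_eq_square)
      finally have "2 ^ J * s0 \<le> 4 * (log_const d + 2) * H\<^sup>2 / a * ln u" .
      then have "T * (2 ^ J * s0) \<le> T * (4 * (log_const d + 2) * H\<^sup>2 / a * ln u)"
        using T by (intro mult_left_mono) auto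
      also have "\<dots> = 64 * real d * (log_const d + 2) * D * ln u"
      proof -
        have "16 * real d / (a * (m * \<rho>)) * (4 * k * (a\<^sup>2 * (C / \<rho>)) / a * ln u) = 64 * real d * k * (C / (m * \<rho>\<^sup>2)) * ln u"
          if "0 < m" "0 < \<rho>" for m \<rho> k :: real
          using that a0 by (simp add: power2_eq_square field_simps)
        from this[OF n0 r1] show ?thesis unfolding H power_mult_distrib S2 T_def D_def .
      qed
      also have "\<dots> \<le> 64 * real d * (log_const d + 2) * D * (2 * ln u) ^ d"
      proof -
        \<comment> \<open>A single logarithm occurs here, but the common form of the bound has
          \<open>(u * ln u) ^ d\<close>; since \<open>2 * ln u >= 1\<close>, the power may be raised
          to \<open>d\<close>.\<close>
        have "ln u \<le> (2 * ln u) ^ 1" using lnu by simp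
        also have "\<dots> \<le> (2 * ln u) ^ d" using lnu d1 by (intro power_increasing) auto
        finally show ?thesis using D0 log_const_ge_1[OF d1] by (intro mult_left_mono) auto
      qed
      finally show "T * (2 ^ J * s0) \<le> 64 * real d * (log_const d + 2) * D * (2 * ln u) ^ d" .
    next
      show "(21 * real N) ^ d \<le> (21 * (65 * real d * u)) ^ d" using N(2) by (intro power_mono) (auto simp: mult_ac)
    qed (use T s0 d1' u2 in auto)
    also have "\<dots> = mean_const d * sqrt D * Y"
    proof -
      have "(21 * (65 * real d * u)) ^ d * (64 * real d * (log_const d + 2) * D * (2 * ln u) ^ d)
        = (2730 * real d) ^ d * (64 * real d * (log_const d + 2)) * D * (u * ln u) ^ d"
      proof -
        have eq: "(21 * (65 * real d * u)) ^ d * (2 * ln u) ^ d = (2730 * real d) ^ d * (u * ln u) ^ d"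
          unfolding power_mult_distrib[symmetric] by (rule arg_cong[where f="\<lambda>x. x ^ d"]) simp
        have gen: "x * (b * z) = y * b * w" if "x * z = y * w" for x b z y w :: real
        proof -
          have "x * (b * z) = (x * z) * b" by (simp add: mult_ac)
          also have "\<dots> = y * b * w" unfolding that by (simp add: mult_ac)
          finally show ?thesis .
        qed
        from gen[OF eq, of "64 * real d * (log_const d + 2) * D"] show ?thesis by (simp only: mult.assoc)
      qed
      note eq = this
      show ?thesis unfolding eq mean_const_def Y_def by (simp only: real_sqrt_mult mult.assoc)
    qed
    also have "\<dots> \<le> (variance_const d + mean_const d) * sqrt D * Y"
      using c0 D0 Y0 by (intro mult_right_mono) auto
    finally show ?thesis using V by blast
  qed
  then obtain V where V: "\<And>j. j \<le> J \<Longrightarrow> 0 < V j \<and> 2 * (8 * real d / (2 ^ j * s0)) / (n * (1 - r)) * deviation_integral (8 * real d / (2 ^ j * s0)) \<le> V j"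
    and VS: "(\<Sum>j\<le>J. 3 * real d * (2 ^ j * s0) * sqrt ((21 * real (boxes N J j)) ^ d * V j)) \<le> (variance_const d + mean_const d) * sqrt D * Y"
    by blast
  obtain E where E: "E \<le> 1 / (n * (1 - r)) * m1 + 2 * (\<integral>x. e x \<partial>\<pi>) + (\<Sum>j\<le>J. 3 * real d * (2 ^ j * s0) * sqrt ((21 * real (boxes N J j)) ^ d * V j))"
    and mgf: "\<And>t. (\<integral>\<^sup>+\<omega>. ennreal (exp (t * kr_dual \<pi> n \<omega>)) \<partial>Q 0) \<le> ennreal (exp (t * E + n * (C / 4 * (t * (1 / (n * (1 - r))))\<^sup>2)))"
    using kr_dual_concentration[OF n s0 N1, where J=J and V=V, folded d_def, folded e_def] V by blast
  have "E \<le> t / 2 + m1 / (n * (1 - r)) + (variance_const d + mean_const d) * sqrt D * Y"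
    using E e_le VS by simp
  then show ?thesis using mgf unfolding D_def Y_def u_def d_def by blast
qed

end

section \<open>Chernoff bound and conclusion\<close>

lemma powr_half_eq_sqrt_power: "0 < x \<Longrightarrow> x powr (real d / 2) = sqrt (x ^ d)"
  by (simp add: powr_half_sqrt[symmetric] powr_realpow[symmetric] powr_powr)

text \<open>If \<open>sqrt D * X\<close> already reaches \<open>t / 2\<close>, the right-hand side
  is at least 1. Otherwise Markov's inequality is used with the optimal exponent for the remaining
  gap \<open>y\<close>.\<close>

lemma gaussian_chernoff:
  fixes F :: "'b \<Rightarrow> real"
  assumes M: "prob_space M" and F: "F \<in> borel_measurable M" and D: "0 < D"
    and mgf: "\<And>l. (\<integral>\<^sup>+\<omega>. ennreal (exp (l * F \<omega>)) \<partial>M) \<le> ennreal (exp (l * E + l\<^sup>2 * D / 4))"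
    and E: "E \<le> t / 2 + sqrt D * X" and X: "0 \<le> X" and t: "0 < t"
  shows "measure M {\<omega> \<in> space M. t \<le> F \<omega>} \<le> exp (X\<^sup>2) * exp (- t\<^sup>2 / (8 * D))"
proof -
  interpret prob_space M by (rule M)
  have F'[measurable]: "F \<in> borel_measurable M" by (rule F)
  define G where "G = sqrt D * X"
  have G: "0 \<le> G" "G\<^sup>2 = D * X\<^sup>2" using D X by (auto simp: G_def power_mult_distrib)
  show ?thesis
  proof (cases "t / 2 \<le> G")
    case True
    have "t\<^sup>2 / 4 = (t / 2)\<^sup>2" by (simp add: power_divide)
    also have "\<dots> \<le> G\<^sup>2" using True t by (intro power_mono) auto
    finally have "t\<^sup>2 / 4 \<le> D * X\<^sup>2" using G by simp
    moreover have "0 \<le> D * X\<^sup>2" using D by simp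
    ultimately have "t\<^sup>2 \<le> 8 * (D * X\<^sup>2)" by linarith
    then have "t\<^sup>2 / (8 * D) \<le> X\<^sup>2" using D by (simp add: divide_le_eq mult_ac)
    then have "1 \<le> exp (X\<^sup>2) * exp (- t\<^sup>2 / (8 * D))" by (simp add: exp_add[symmetric])
    then show ?thesis using prob_le_1 by (rule order_trans[rotated])
  next
    case False
    \<comment> \<open>A lower bound for \<open>t - E\<close>; the exponent \<open>2 * y / D\<close>
      minimises \<open>- l * y + l^2 * D / 4\<close>, with value \<open>- y^2 / D\<close>.\<close>
    define y where "y = t / 2 - G"
    have y: "0 < y" using False by (simp add: y_def)
    define l where "l = 2 * y / D"
    have l: "0 < l" using y D by (simp add: l_def)
    have "emeasure M {\<omega> \<in> space M. t \<le> F \<omega>} = (\<integral>\<^sup>+\<omega>. indicator {\<omega> \<in> space M. t \<le> F \<omega>} \<omega> \<partial>M)" by simp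
    also have "\<dots> \<le> (\<integral>\<^sup>+\<omega>. ennreal (exp (- l * t)) * ennreal (exp (l * F \<omega>)) \<partial>M)"
    proof (rule nn_integral_mono)
      fix \<omega>
      show "indicator {\<omega> \<in> space M. t \<le> F \<omega>} \<omega> \<le> ennreal (exp (- l * t)) * ennreal (exp (l * F \<omega>))"
      proof (cases "t \<le> F \<omega>")
        case True
        have "l * t \<le> l * F \<omega>" using True l by simp
        then have "1 \<le> exp (- l * t) * exp (l * F \<omega>)" by (simp add: exp_add[symmetric])
        then have "1 \<le> ennreal (exp (- l * t)) * ennreal (exp (l * F \<omega>))"
          by (simp add: ennreal_mult[symmetric])
        then show ?thesis using True by (auto split: split_indicator)
      qed simp
    qed
    also have "\<dots> = ennreal (exp (- l * t)) * (\<integral>\<^sup>+\<omega>. ennreal (exp (l * F \<omega>)) \<partial>M)"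
      by (rule nn_integral_cmult) measurable
    also have "\<dots> \<le> ennreal (exp (- l * t)) * ennreal (exp (l * E + l\<^sup>2 * D / 4))"
      by (intro mult_left_mono mgf) simp
    also have "\<dots> = ennreal (exp (l * (E - t) + l\<^sup>2 * D / 4))"
      by (simp add: ennreal_mult[symmetric] exp_add[symmetric] algebra_simps)
    finally have "measure M {\<omega> \<in> space M. t \<le> F \<omega>} \<le> exp (l * (E - t) + l\<^sup>2 * D / 4)"
      by (simp add: emeasure_eq_measure)
    also have "\<dots> \<le> exp (X\<^sup>2 - t\<^sup>2 / (8 * D))"
    proof -
      have "E - t \<le> - y" using E by (simp add: y_def G_def)
      then have "l * (E - t) \<le> l * (- y)" using l by (intro mult_left_mono) auto
      then have "l * (E - t) + l\<^sup>2 * D / 4 \<le> l * (- y) + l\<^sup>2 * D / 4" by simp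
      also have "\<dots> = - (y\<^sup>2 / D)" using D by (simp add: l_def power2_eq_square field_simps)
      also have "\<dots> \<le> - ((t\<^sup>2 / 8 - D * X\<^sup>2) / D)"
      proof -
        \<comment> \<open>This square is the inequality \<open>y^2 >= t^2 / 8 - G^2\<close>, the
          origin of the 8 in the exponent and of the square in \<open>K\<close>.\<close>
        have "0 \<le> (t / 2 - 2 * G)\<^sup>2" by simp
        also have "\<dots> = 2 * (y\<^sup>2 - (t\<^sup>2 / 8 - G\<^sup>2))"
          by (simp add: y_def power2_eq_square algebra_simps)
        finally have "t\<^sup>2 / 8 - D * X\<^sup>2 \<le> y\<^sup>2" using G by simp
        then show ?thesis using D by (simp add: divide_right_mono del: minus_divide_left)
      qed
      also have "\<dots> = X\<^sup>2 - t\<^sup>2 / (8 * D)" using D by (simp add: field_simps)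
      finally show ?thesis by simp
    qed
    finally show ?thesis by (simp add: exp_diff exp_minus inverse_eq_divide)
  qed
qed

theorem theorem2p12:
  shows "\<exists>Cd>0. \<forall>(C::real) (r::real) (P :: real ^ 'd \<Rightarrow> (real ^ 'd) measure) (\<pi> :: (real ^ 'd) measure).
    C > 0 \<longrightarrow> 0 \<le> r \<longrightarrow> r < 1 \<longrightarrow>
    markov_kernel P \<longrightarrow>
    (\<forall>x. T1 C (P x)) \<longrightarrow>
    (\<forall>x y. W1 (P x) (P y) \<le> ennreal (r * norm (x - y))) \<longrightarrow>
    invariant_prob P \<pi> \<longrightarrow>
    (let m1 = (\<integral>x. norm x \<partial>\<pi>);
         a = 2 / C * (sqrt (4 * m1\<^sup>2 + C * ln 2) - 2 * m1);
         K = (\<lambda>(n::nat) (t::real). exp ((m1 / sqrt (real n * C)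
               + Cd * (1 / (a * t) * ln (1 / (a * t))) powr (real CARD('d) / 2))\<^sup>2))
     in \<forall>n\<ge>1. \<forall>t. 0 < t \<longrightarrow> t \<le> 1 / (2 * a) \<longrightarrow>
          measure (chain_law P 0)
              {\<omega> \<in> space (chain_law P 0). W1 (empirical_measure n \<omega>) \<pi> \<ge> ennreal t}
            \<le> K n t * exp (- real n * (1 - r)\<^sup>2 / (8 * C) * t\<^sup>2))"
proof (intro exI[of _ "variance_const CARD('d) + mean_const CARD('d)"] conjI allI impI)
  have d1: "1 \<le> CARD('d)" by (simp add: Suc_leI)
  have Cd0: "0 < variance_const CARD('d)" "0 \<le> mean_const CARD('d)"
    using log_const_ge_1[OF d1] by (auto simp: variance_const_def mean_const_def)
  then show "0 < variance_const CARD('d) + mean_const CARD('d)" by simp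
  fix C r :: real and P :: "real ^ 'd \<Rightarrow> (real ^ 'd) measure" and \<pi> :: "(real ^ 'd) measure"
  assume "C > 0" "0 \<le> r" "r < 1" "markov_kernel P" "\<forall>x. T1 C (P x)"
    "\<forall>x y. W1 (P x) (P y) \<le> ennreal (r * norm (x - y))" "invariant_prob P \<pi>"
  then interpret contractive_kernel_cart P C r \<pi>
    by unfold_locales auto
  show "let m1 = (\<integral>x. norm x \<partial>\<pi>);
         a = 2 / C * (sqrt (4 * m1\<^sup>2 + C * ln 2) - 2 * m1);
         K = (\<lambda>(n::nat) (t::real). exp ((m1 / sqrt (real n * C)
               + (variance_const CARD('d) + mean_const CARD('d)) * (1 / (a * t) * ln (1 / (a * t))) powr (real CARD('d) / 2))\<^sup>2))
     in \<forall>n\<ge>1. \<forall>t. 0 < t \<longrightarrow> t \<le> 1 / (2 * a) \<longrightarrow>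
          measure (chain_law P 0)
              {\<omega> \<in> space (chain_law P 0). W1 (empirical_measure n \<omega>) \<pi> \<ge> ennreal t}
            \<le> K n t * exp (- real n * (1 - r)\<^sup>2 / (8 * C) * t\<^sup>2)"
    unfolding Let_def
  proof (intro allI impI)
    fix n :: nat and t :: real
    define a where "a = 2 / C * (sqrt (4 * m1\<^sup>2 + C * ln 2) - 2 * m1)"
    assume n: "1 \<le> n" and t: "0 < t" "t \<le> 1 / (2 * (2 / C * (sqrt (4 * m1\<^sup>2 + C * ln 2) - 2 * m1)))"
    note t' = t[folded a_def]
    have r1: "0 < 1 - r" using r_less_1 by simp
    have n0: "0 < real n" using n by simp
    define u where "u = 1 / (a * t)"
    define Cd where "Cd = variance_const CARD('d) + mean_const CARD('d)"
    define D where "D = C / (n * (1 - r)\<^sup>2)"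
    have D: "0 < D" using C_pos r1 n0 by (simp add: D_def)
    define X where "X = m1 / sqrt (n * C) + Cd * (u * ln u) powr (real CARD('d) / 2)"
    have a0: "0 < a"
    proof -
      have "0 < 1 / (2 * a)" using t' by linarith
      then show ?thesis by simp
    qed
    have u2: "2 \<le> u" using a0 t' by (simp add: u_def field_simps)
    have ulnu: "0 < u * ln u" using u2 by simp
    have X0: "0 \<le> X"
      unfolding X_def Cd_def using Cd0 C_pos m1_nonneg
      by (intro add_nonneg_nonneg mult_nonneg_nonneg divide_nonneg_nonneg) auto
    have sD: "sqrt D = sqrt C / (sqrt n * (1 - r))"
      using r1 by (simp add: D_def real_sqrt_divide real_sqrt_mult)
    from kr_dual_mean_bound[OF n a_def t'] obtain E where
      E: "E \<le> t / 2 + m1 / (n * (1 - r)) + Cd * sqrt D * sqrt ((u * ln u) ^ CARD('d))"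
      and mgf: "\<And>t. (\<integral>\<^sup>+\<omega>. ennreal (exp (t * kr_dual \<pi> n \<omega>)) \<partial>Q 0) \<le> ennreal (exp (t * E + n * (C / 4 * (t * (1 / (n * (1 - r))))\<^sup>2)))"
      by (auto simp: Cd_def D_def u_def)
    \<comment> \<open>In units of \<open>sqrt D\<close> the starting bias
      \<open>m1 / (n * (1 - r))\<close> becomes \<open>m1 / sqrt (n * C)\<close>, the first term of
      the bracket in \<open>K\<close>.\<close>
    have "sqrt D * X = m1 / (n * (1 - r)) + Cd * sqrt D * sqrt ((u * ln u) ^ CARD('d))"
    proof -
      have "sqrt D * (m1 / sqrt (n * C)) = m1 / ((sqrt n * sqrt n) * (1 - r))"
        using C_pos r1 n0 by (simp add: sD real_sqrt_mult)
      then show ?thesis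
        by (simp add: X_def distrib_left powr_half_eq_sqrt_power[OF ulnu])
    qed
    then have E': "E \<le> t / 2 + sqrt D * X" using E by simp
    have mgf': "(\<integral>\<^sup>+\<omega>. ennreal (exp (l * kr_dual \<pi> n \<omega>)) \<partial>Q 0) \<le> ennreal (exp (l * E + l\<^sup>2 * D / 4))" for l
    proof -
      have "n * (C / 4 * (l * (1 / (n * (1 - r))))\<^sup>2) = l\<^sup>2 * D / 4"
        using n0 r1 by (simp add: D_def power2_eq_square mult_ac)
      then show ?thesis using mgf[of l] by simp
    qed
    have Fm: "kr_dual \<pi> n \<in> borel_measurable (Q 0)"
    proof -
      have "continuous_on UNIV (kr_dual \<pi> n :: (nat \<Rightarrow> real ^ 'd) \<Rightarrow> real)"
        by (rule continuous_on_coordinate_lipschitz[OF kr_dual_lipschitz[OF pi_P1 n]])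
      then have "kr_dual \<pi> n \<in> borel_measurable path_space"
        unfolding measurable_cong_sets[OF sets_PiM_equal_borel refl] by (rule borel_measurable_continuous_onI)
      then show ?thesis by measurable
    qed
    interpret Q0: prob_space "Q 0" by (rule prob_Q)
    \<comment> \<open>By duality the event lies in one for \<open>kr_dual\<close>, which is
      measurable by continuity, so monotonicity of the measure applies.\<close>
    have "measure (Q 0) {\<omega> \<in> space (Q 0). ennreal t \<le> W1 (empirical_measure n \<omega>) \<pi>}
        \<le> measure (Q 0) {\<omega> \<in> space (Q 0). t \<le> kr_dual \<pi> n \<omega>}"
    proof (rule Q0.finite_measure_mono)
      show "{\<omega> \<in> space (Q 0). ennreal t \<le> W1 (empirical_measure n \<omega>) \<pi>} \<subseteq> {\<omega> \<in> space (Q 0). t \<le> kr_dual \<pi> n \<omega>}"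
      proof safe
        fix \<omega> assume "ennreal t \<le> W1 (empirical_measure n \<omega>) \<pi>"
        also have "\<dots> \<le> ennreal (kr_dual \<pi> n \<omega>)" by (rule W1_empirical_le_kr_dual[OF n pi_P1])
        finally show "t \<le> kr_dual \<pi> n \<omega>" using kr_dual_nonneg[OF pi_P1 n] by simp
      qed
      show "{\<omega> \<in> space (Q 0). t \<le> kr_dual \<pi> n \<omega>} \<in> sets (Q 0)" using Fm by measurable
    qed
    also have "\<dots> \<le> exp (X\<^sup>2) * exp (- t\<^sup>2 / (8 * D))"
      by (rule gaussian_chernoff[OF prob_Q Fm D mgf' E' X0 t(1)])
    also have "- t\<^sup>2 / (8 * D) = - real n * (1 - r)\<^sup>2 / (8 * C) * t\<^sup>2"
      by (simp add: D_def)
    finally show "measure (Q 0) {\<omega> \<in> space (Q 0). ennreal t \<le> W1 (empirical_measure n \<omega>) \<pi>} \<le>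
       exp ((m1 / sqrt (real n * C) + (variance_const CARD('d) + mean_const CARD('d)) *
          (1 / (2 / C * (sqrt (4 * m1\<^sup>2 + C * ln 2) - 2 * m1) * t) *
           ln (1 / (2 / C * (sqrt (4 * m1\<^sup>2 + C * ln 2) - 2 * m1) * t))) powr (real CARD('d) / 2))\<^sup>2) *
       exp (- real n * (1 - r)\<^sup>2 / (8 * C) * t\<^sup>2)"
      by (simp only: X_def u_def a_def Cd_def)
  qed
qed

end
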